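(* Let $\mathcal{L}$ be a logic and $Sg$ a small signature (not a proper class). For every $\mathcal{Y}\subseteq\mathrm{Mod}^{\mathcal{L}}_{Sg}$, $\mathrm{Mod}_{\mathrm{Th}(\mathcal{Y})}=\mathbb{H}\mathbb{S}\mathbb{P}(\mathcal{Y})$.
   Context: Syntax and logics: a first-order language $\mathscr{L}$ has quantifier symbols $\mathscr{L}_q$ and connectives $\mathscr{L}_\omega$ with arities (designated $e\in\mathscr{L}_0$, $\otimes\in\mathscr{L}_2$); signatures with sorts, function and relation symbols; terms-in-context $M:\tau\ [\Gamma]$; formulas-in-context (from $R(\vec M)$, $M_1=_\sigma M_2$, connectives, $\Omega_{x:\sigma}$); assertions are equations-in-context $M_1=M_2:\tau\ [\Gamma]$ and sequents-in-context $\phi_1..\phi_n\vdash\phi\ [\Gamma]$; $A_{Sg}$ is the class of $Sg$-assertions; an $Sg$-theory is a set of $Sg$-assertions. A logic assigns to each signature a closure operator $T\mapsto T_{\mathcal{L}}$ satisfying typed equational logic; $T\vdash_{\mathcal{L}}T'$ iff $A(T')\subseteq A(T_{\mathcal{L}})$. $\mathcal{L}^m$ is the least logic closed under Ax, Cut, context weakening, substitution of provably equal terms, congruence of quantifiers and connectives w.r.t. mutual derivability, and the two-way rules $\Phi,\alpha,\beta,\Psi\vdash\theta\iff\Phi,\alpha\otimes\beta,\Psi\vdash\theta$ and $\Phi,e,\Psi\vdash\phi\iff\Phi,\Psi\vdash\phi$. $\mathrm{Ob}(\mathbf{FA})$: prop-categories $(\mathcal{C},P)$ ($\mathcal{C}$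 with designated finite products, $P:\mathcal{C}^{op}\to\mathbf{Pos}$) with $\mathscr{L}_\omega$-algebra structures on each $P(c)$ preserved by $P(f)$, elements $Eq_c\in P(c\times c)$, maps $\Omega_{b,c}:P(b\times c)\to P(b)$ natural in $b$, such that $(P(c),\otimes,e_c)$ is a monoid, $\Omega_{b,1}\circ P(\pi_1^{b,1})=\mathrm{id}$, $\Omega_{b,c\times d}\circ P(a_{b,c,d})=\Omega_{b,c}\circ\Omega_{b\times c,d}$, $Eq_1=e_{1\times1}$, $Eq_{c_1\times c_2}=P(\langle\pi_1^{c_1,c_2}\pi_1,\pi_1^{c_1,c_2}\pi_2\rangle)(Eq_{c_1})\otimes P(\langle\pi_2^{c_1,c_2}\pi_1,\pi_2^{c_1,c_2}\pi_2\rangle)(Eq_{c_2})$. Structures interpret terms as morphisms and formulas as elements of $P$ in the standard way; satisfaction of sequents is $\bigotimes[\![\phi_i]\!]\le[\![\phi]\!]$. $\mathbf{FA}_{\mathcal{L}}$: full sub-2-category on those $(\mathcal{C},P)$ with $T\vdash_{\mathcal{L}}T'\Rightarrow T\models_{(\mathcal{C},P)}T'$. Morphisms $F=(F^o,F^p)$: finite-product-preserving $F^o$, natural $F^p:P\Rightarrow QF^o$ with $\mathscr{L}_\omega$-homomorphic components commuting with quantifiers ($F^p_b\Omega_{b,c}=\Omega_{F^ob,F^oc}Q(a_{F,b,c}^{-1})F^p_{b\times c}$) and equality ($F^p_{c\times c}Eq_c=Q(a_{F,c,c})Eq_{F^oc}$). A subprop-morphism $\iota$: $\iota^o$ faithful,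 $\iota^p$-components order embeddings. Products in $\mathbf{FA}$ are componentwise: $(\prod\mathcal{C}_i,\prod P_i)$, with $\langle F_i\rangle_{i\in I}$ the induced morphism into it. $(\mathcal{C}_{Sg},P_{Sg})$ is the classifying prop-category of the $\mathcal{L}^m$-closure of the empty $Sg$-theory: objects contexts, morphisms lists of terms modulo provable equality, $P_{Sg}(\Gamma)$ = formulas in $[\Gamma]$ modulo mutual derivability, ordered by derivability, operations on representatives, $\Omega_{\Gamma,\Gamma'}[\phi]=[\Omega_{y_1:\tau_1}\cdots\Omega_{y_m:\tau_m}\phi]$, $Eq_\Gamma=[x_1=_{\sigma_1}x_1'\otimes\dots\otimes x_n=_{\sigma_n}x_n']$ ($[e]$ for the empty context). $G$ is its generic structure, so $G[\![M\ [\Gamma]]\!]=[M\ [\Gamma]]$ and $G[\![\phi\ [\Gamma]]\!]=[\phi\ [\Gamma]]$. For a morphism $F$ out of $(\mathcal{C}_{Sg},P_{Sg})$ and an assertion $a$, "$G[\![a]\!]\in\ker F$" means: if $a$ is $M_1=M_2:\tau\ [\Gamma]$, $F^o([M_1])=F^o([M_2])$; if $a$ is $\phi_1..\phi_n\vdash\phi\ [\Gamma]$, $F^p_\Gamma([\phi_1\otimes\dots\otimes\phi_n])\le F^p_\Gamma([\phi])$ (with $e$ for $n=0$). $\mathrm{Mod}^{\mathcal{L}}_{Sg}$ is the class of all morphisms $F:(\mathcal{C}_{Sg},P_{Sg})\to(\mathcal{C},P)$ with $(\mathcal{C},P)\in\mathrm{Ob}(\mathbf{FA}_{\mathcal{L}})$.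 For $\mathcal{Y}\subseteq\mathrm{Mod}^{\mathcal{L}}_{Sg}$, $\mathrm{Th}(\mathcal{Y})$ is the $Sg$-theory $\{a\in A_{Sg}: G[\![a]\!]\in\ker F\ \forall F\in\mathcal{Y}\}$; for an $Sg$-theory $T$, $\mathrm{Mod}_T=\{F\in\mathrm{Mod}^{\mathcal{L}}_{Sg}: G[\![a]\!]\in\ker F\ \forall a\in A(T)\}$. $\mathbb{P}(\mathcal{Y})$: closure under external products $\langle F_i\rangle_{i\in I}:(\mathcal{C}_{Sg},P_{Sg})\to(\prod\mathcal{C}_i,\prod P_i)$ of families $F_i\in\mathcal{Y}$. $\mathbb{S}(\mathcal{Y})$: closure under external submodels: $H:(\mathcal{C}_{Sg},P_{Sg})\to(\mathcal{E},R)$ in $\mathbf{FA}_{\mathcal{L}}$ such that $F=\iota\circ H$ for some $F$ in the class and some subprop-morphism $\iota$ in $\mathbf{FA}_{\mathcal{L}}$. $\mathbb{H}(\mathcal{Y})$: closure under external homomorphic images: $H\circ F$ for $F:(\mathcal{C}_{Sg},P_{Sg})\to(\mathcal{C},P)$ in the class and any morphism $H:(\mathcal{C},P)\to(\mathcal{D},Q)$ with $(\mathcal{D},Q)\in\mathrm{Ob}(\mathbf{FA}_{\mathcal{L}})$. *)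

theory Defs
  imports "HOL-Algebra.Group" "HOL-Library.Equipollence" "HOL-Library.Countable_Set"
    "HOL-Library.Nat_Bijection"
begin

section \<open>Sets and classes\<close>

text \<open>The elements of a fixed type \<open>'u\<close> play the role of the elements of the set-theoretic
  universe, sets over \<open>'u\<close> that of classes, and those satisfying \<open>small\<close> that of sets;
  \<open>tup I\<close> codes \<open>I\<close>-indexed families as elements of \<open>'u\<close>. A type of ZFC sets, with the usual
  notion of smallness, is an instance, but the closure properties below are already satisfied in
  HOL.\<close>

definition universe :: "('u set \<Rightarrow> bool) \<Rightarrow> ('u set \<Rightarrow> ('u \<Rightarrow> 'u) \<Rightarrow> 'u) \<Rightarrow> bool" where
  "universe small tup \<longleftrightarrow>
     (\<exists>A. small A \<and> infinite A) \<and>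
     (\<forall>A B. small B \<and> A \<lesssim> B \<longrightarrow> small A) \<and>
     (\<forall>A B. small A \<and> small B \<longrightarrow> small (A \<union> B)) \<and>
     (\<forall>I. small I \<longrightarrow> inj_on (tup I) (extensional I))"

lemma universe_countable: "\<exists>tup. universe (countable :: (nat \<Rightarrow> bool) set \<Rightarrow> bool) tup"
proof -
  define tup :: "(nat \<Rightarrow> bool) set \<Rightarrow> ((nat \<Rightarrow> bool) \<Rightarrow> nat \<Rightarrow> bool) \<Rightarrow> nat \<Rightarrow> bool" where
    "tup I x n = x (from_nat_into I (fst (prod_decode n))) (snd (prod_decode n))" for I x n
  have "inj_on (tup I) (extensional I)" if I: "countable I" for I
  proof (rule inj_onI, rule extensionalityI)
    fix x y i assume eq: "tup I x = tup I y" and i: "i \<in> I"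
    have "x i k = y i k" for k
      using fun_cong [OF eq, of "prod_encode (to_nat_on I i, k)"] I i by (simp add: tup_def)
    then show "x i = y i" by blast
  qed
  moreover have "countable (range (\<lambda>m n. m = (n::nat)))" "infinite (range (\<lambda>m n. m = (n::nat)))"
    by (auto intro!: range_inj_infinite injI dest: fun_cong)
  moreover have "countable A" if "countable B" "A \<lesssim> B" for A B :: "(nat \<Rightarrow> bool) set"
    using that countable_lepoll by blast
  ultimately have "universe (countable :: (nat \<Rightarrow> bool) set \<Rightarrow> bool) tup"
    unfolding universe_def by (metis countable_Un)
  then show ?thesis by (rule exI [of _ tup])
qed

definition component :: "('u set \<Rightarrow> ('u \<Rightarrow> 'u) \<Rightarrow> 'u) \<Rightarrow> 'u set \<Rightarrow> 'u \<Rightarrow> 'u \<Rightarrow> 'u" where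
  "component tup I x = the_inv_into (extensional I) (tup I) x"


section \<open>Languages, signatures, terms and formulas\<close>

record 'u language =
  quants :: "'u set"
  conns :: "nat \<Rightarrow> 'u set"
  unit_conn :: 'u
  tensor_conn :: 'u

definition is_language :: "('u set \<Rightarrow> bool) \<Rightarrow> 'u language \<Rightarrow> bool" where
  "is_language small La \<longleftrightarrow>
     small (quants La) \<and> small (\<Union>n. conns La n) \<and>
     unit_conn La \<in> conns La 0 \<and> tensor_conn La \<in> conns La 2"

record 'u signature =
  sorts :: "'u set"
  funs :: "'u \<rightharpoonup> 'u list \<times> 'u"
  rels :: "'u \<rightharpoonup> 'u list"

definition is_signature :: "'u signature \<Rightarrow> bool" where
  "is_signature Sg \<longleftrightarrow>
     (\<forall>f \<sigma>s \<tau>. funs Sg f = Some (\<sigma>s, \<tau>) \<longrightarrow> set \<sigma>s \<subseteq> sorts Sg \<and> \<tau> \<in> sorts Sg) \<and>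
     (\<forall>r \<sigma>s. rels Sg r = Some \<sigma>s \<longrightarrow> set \<sigma>s \<subseteq> sorts Sg)"

definition small_signature :: "('u set \<Rightarrow> bool) \<Rightarrow> 'u signature \<Rightarrow> bool" where
  "small_signature small Sg \<longleftrightarrow>
     is_signature Sg \<and> small (sorts Sg) \<and> small (dom (funs Sg)) \<and> small (dom (rels Sg))"

text \<open>Syntax is nameless: a context \<open>x\<^sub>0:\<sigma>\<^sub>0,\<dots>,x\<^sub>n\<^sub>-\<^sub>1:\<sigma>\<^sub>n\<^sub>-\<^sub>1\<close> is its list of sorts, and variables are
  de Bruijn levels. \<open>Var i\<close> is the \<open>i\<close>-th variable of the context, and in a context of length \<open>n\<close>
  the variable bound by \<open>Quant \<omega> \<sigma> \<phi>\<close>, i.e. by $\omega_{x:\sigma}$, is \<open>Var n\<close>; so \<open>\<phi>\<close> lives in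
  the context \<open>\<Gamma> @ [\<sigma>]\<close>. Terms contain no binders, so weakening a term at the end of the
  context does not change it.\<close>

type_synonym 'u ctx = "'u list"

datatype 'u tm = Var nat | Fun 'u "'u tm list"

datatype 'u fm =
    Rel 'u "'u tm list"
  | Equ 'u "'u tm" "'u tm"
  | Conn 'u "'u fm list"
  | Quant 'u 'u "'u fm"

definition is_ctx :: "'u signature \<Rightarrow> 'u ctx \<Rightarrow> bool" where
  "is_ctx Sg \<Gamma> \<longleftrightarrow> set \<Gamma> \<subseteq> sorts Sg"

inductive is_tm :: "'u signature \<Rightarrow> 'u ctx \<Rightarrow> 'u tm \<Rightarrow> 'u \<Rightarrow> bool" for Sg \<Gamma> where
  var: "i < length \<Gamma> \<Longrightarrow> is_tm Sg \<Gamma> (Var i) (\<Gamma> ! i)"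
| "fun": "funs Sg f = Some (\<sigma>s, \<tau>) \<Longrightarrow> list_all2 (is_tm Sg \<Gamma>) Ms \<sigma>s \<Longrightarrow> is_tm Sg \<Gamma> (Fun f Ms) \<tau>"

inductive is_fm :: "'u language \<Rightarrow> 'u signature \<Rightarrow> 'u ctx \<Rightarrow> 'u fm \<Rightarrow> bool" for La Sg where
  rel: "rels Sg r = Some \<sigma>s \<Longrightarrow> list_all2 (is_tm Sg \<Gamma>) Ms \<sigma>s \<Longrightarrow> is_fm La Sg \<Gamma> (Rel r Ms)"
| equ: "\<sigma> \<in> sorts Sg \<Longrightarrow> is_tm Sg \<Gamma> M \<sigma> \<Longrightarrow> is_tm Sg \<Gamma> N \<sigma> \<Longrightarrow> is_fm La Sg \<Gamma> (Equ \<sigma> M N)"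
| conn: "k \<in> conns La (length \<phi>s) \<Longrightarrow> (\<And>\<phi>. \<phi> \<in> set \<phi>s \<Longrightarrow> is_fm La Sg \<Gamma> \<phi>)
    \<Longrightarrow> is_fm La Sg \<Gamma> (Conn k \<phi>s)"
| quant: "\<omega> \<in> quants La \<Longrightarrow> \<sigma> \<in> sorts Sg \<Longrightarrow> is_fm La Sg (\<Gamma> @ [\<sigma>]) \<phi>
    \<Longrightarrow> is_fm La Sg \<Gamma> (Quant \<omega> \<sigma> \<phi>)"

definition vars :: "nat \<Rightarrow> nat \<Rightarrow> 'u tm list" where
  "vars m n = map Var [m..<m + n]"

primrec tm_subst :: "'u tm list \<Rightarrow> 'u tm \<Rightarrow> 'u tm" where
  "tm_subst Ns (Var i) = Ns ! i"
| "tm_subst Ns (Fun f Ms) = Fun f (map (tm_subst Ns) Ms)"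

text \<open>\<open>fm_subst \<phi> m Ns\<close> substitutes the terms \<open>Ns\<close>, which live in a context of length \<open>m\<close>, for
  all the variables of the context of \<open>\<phi>\<close>.\<close>

primrec fm_subst :: "'u fm \<Rightarrow> nat \<Rightarrow> 'u tm list \<Rightarrow> 'u fm" where
  "fm_subst (Rel r Ms) m Ns = Rel r (map (tm_subst Ns) Ms)"
| "fm_subst (Equ \<sigma> M N) m Ns = Equ \<sigma> (tm_subst Ns M) (tm_subst Ns N)"
| "fm_subst (Conn k \<phi>s) m Ns = Conn k (map (\<lambda>\<phi>. fm_subst \<phi> m Ns) \<phi>s)"
| "fm_subst (Quant \<omega> \<sigma> \<phi>) m Ns = Quant \<omega> \<sigma> (fm_subst \<phi> (Suc m) (Ns @ [Var m]))"

text \<open>The product of a list, \<open>e\<close> for the empty list and \<open>x\<close> for \<open>[x]\<close>.\<close>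

fun list_prod :: "'b \<Rightarrow> ('b \<Rightarrow> 'b \<Rightarrow> 'b) \<Rightarrow> 'b list \<Rightarrow> 'b" where
  "list_prod e m [] = e"
| "list_prod e m [x] = x"
| "list_prod e m (x # y # xs) = m x (list_prod e m (y # xs))"

definition Unit :: "'u language \<Rightarrow> 'u fm" where
  "Unit La = Conn (unit_conn La) []"

definition Tensor :: "'u language \<Rightarrow> 'u fm \<Rightarrow> 'u fm \<Rightarrow> 'u fm" where
  "Tensor La \<phi> \<psi> = Conn (tensor_conn La) [\<phi>, \<psi>]"

definition Tensors :: "'u language \<Rightarrow> 'u fm list \<Rightarrow> 'u fm" where
  "Tensors La = list_prod (Unit La) (Tensor La)"


section \<open>Assertions and logics\<close>

text \<open>\<open>Eqn \<Gamma> \<tau> M N\<close> is $M = N : \tau\ [\Gamma]$ and \<open>Seq \<Gamma> \<Phi> \<phi>\<close> is $\Phi \vdash \phi\ [\Gamma]$.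
  A theory over \<open>Sg\<close> is a subset of \<open>assertions La Sg\<close>.\<close>

datatype 'u assertion =
    Eqn "'u ctx" 'u "'u tm" "'u tm"
  | Seq "'u ctx" "'u fm list" "'u fm"

primrec is_assertion :: "'u language \<Rightarrow> 'u signature \<Rightarrow> 'u assertion \<Rightarrow> bool" where
  "is_assertion La Sg (Eqn \<Gamma> \<tau> M N) \<longleftrightarrow> is_ctx Sg \<Gamma> \<and> is_tm Sg \<Gamma> M \<tau> \<and> is_tm Sg \<Gamma> N \<tau>"
| "is_assertion La Sg (Seq \<Gamma> \<Phi> \<phi>) \<longleftrightarrow> is_ctx Sg \<Gamma> \<and> (\<forall>\<psi>\<in>set \<Phi>. is_fm La Sg \<Gamma> \<psi>) \<and> is_fm La Sg \<Gamma> \<phi>"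

definition assertions :: "'u language \<Rightarrow> 'u signature \<Rightarrow> 'u assertion set" where
  "assertions La Sg = {a. is_assertion La Sg a}"

text \<open>The assertions stating that two lists of terms in context \<open>\<Delta>\<close>, of sorts \<open>\<Gamma>\<close>, are equal.\<close>

definition eqns :: "'u ctx \<Rightarrow> 'u ctx \<Rightarrow> 'u tm list \<Rightarrow> 'u tm list \<Rightarrow> 'u assertion set" where
  "eqns \<Delta> \<Gamma> Ms Ns = {Eqn \<Delta> (\<Gamma> ! i) (Ms ! i) (Ns ! i) | i. i < length \<Gamma>}"

text \<open>Rules are pairs of a set of premises and a conclusion. The substitution rule for equations
  yields weakening and congruence for function symbols.\<close>

inductive eq_rule :: "'u signature \<Rightarrow> 'u assertion set \<Rightarrow> 'u assertion \<Rightarrow> bool" for Sg where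
  refl: "is_ctx Sg \<Gamma> \<Longrightarrow> is_tm Sg \<Gamma> M \<tau> \<Longrightarrow> eq_rule Sg {} (Eqn \<Gamma> \<tau> M M)"
| sym: "eq_rule Sg {Eqn \<Gamma> \<tau> M N} (Eqn \<Gamma> \<tau> N M)"
| trans: "eq_rule Sg {Eqn \<Gamma> \<tau> M N, Eqn \<Gamma> \<tau> N K} (Eqn \<Gamma> \<tau> M K)"
| subst: "is_ctx Sg \<Delta> \<Longrightarrow> length Ns = length \<Gamma> \<Longrightarrow> length Ns' = length \<Gamma> \<Longrightarrow>
    eq_rule Sg (insert (Eqn \<Gamma> \<tau> M M') (eqns \<Delta> \<Gamma> Ns Ns'))
      (Eqn \<Delta> \<tau> (tm_subst Ns M) (tm_subst Ns' M'))"

definition closed_under ::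
  "('u assertion set \<Rightarrow> 'u assertion \<Rightarrow> bool) \<Rightarrow> 'u assertion set \<Rightarrow> bool" where
  "closed_under R X \<longleftrightarrow> (\<forall>Ps a. R Ps a \<and> Ps \<subseteq> X \<longrightarrow> a \<in> X)"

type_synonym 'u logic = "'u signature \<Rightarrow> 'u assertion set \<Rightarrow> 'u assertion set"

definition is_logic :: "'u language \<Rightarrow> 'u logic \<Rightarrow> bool" where
  "is_logic La L \<longleftrightarrow> (\<forall>Sg. is_signature Sg \<longrightarrow>
     (\<forall>T. T \<subseteq> assertions La Sg \<longrightarrow>
        T \<subseteq> L Sg T \<and> L Sg T \<subseteq> assertions La Sg \<and> L Sg (L Sg T) = L Sg T \<and>
        closed_under (eq_rule Sg) (L Sg T)) \<and>
     (\<forall>T T'. T \<subseteq> T' \<and> T' \<subseteq> assertions La Sg \<longrightarrow> L Sg T \<subseteq> L Sg T'))"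

text \<open>The rules of \<open>\<L>\<^sup>m\<close>. Contexts are weakened at the end; together with \<open>subst\<close>, which
  substitutes for all variables at once, this gives weakening and permutation in any position.\<close>

inductive m_rule :: "'u language \<Rightarrow> 'u signature \<Rightarrow> 'u assertion set \<Rightarrow> 'u assertion \<Rightarrow> bool"
  for La Sg where
  ax: "is_ctx Sg \<Gamma> \<Longrightarrow> is_fm La Sg \<Gamma> \<phi> \<Longrightarrow> m_rule La Sg {} (Seq \<Gamma> [\<phi>] \<phi>)"
| cut: "m_rule La Sg {Seq \<Gamma> \<Phi> \<alpha>, Seq \<Gamma> (\<Psi> @ [\<alpha>] @ \<Psi>') \<phi>} (Seq \<Gamma> (\<Psi> @ \<Phi> @ \<Psi>') \<phi>)"
| weak: "\<sigma> \<in> sorts Sg \<Longrightarrow> n = length \<Gamma> \<Longrightarrow>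
    m_rule La Sg {Seq \<Gamma> \<Phi> \<phi>}
      (Seq (\<Gamma> @ [\<sigma>]) (map (\<lambda>\<psi>. fm_subst \<psi> (Suc n) (vars 0 n)) \<Phi>) (fm_subst \<phi> (Suc n) (vars 0 n)))"
| subst: "is_ctx Sg \<Delta> \<Longrightarrow> length Ms = length \<Gamma> \<Longrightarrow> length Ns = length \<Gamma> \<Longrightarrow>
    m_rule La Sg (insert (Seq \<Gamma> \<Phi> \<phi>) (eqns \<Delta> \<Gamma> Ms Ns))
      (Seq \<Delta> (map (\<lambda>\<psi>. fm_subst \<psi> (length \<Delta>) Ms) \<Phi>) (fm_subst \<phi> (length \<Delta>) Ns))"
| conn: "is_ctx Sg \<Gamma> \<Longrightarrow> k \<in> conns La (length \<phi>s) \<Longrightarrow> length \<psi>s = length \<phi>s \<Longrightarrow>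
    m_rule La Sg (\<Union>i<length \<phi>s. {Seq \<Gamma> [\<phi>s ! i] (\<psi>s ! i), Seq \<Gamma> [\<psi>s ! i] (\<phi>s ! i)})
      (Seq \<Gamma> [Conn k \<phi>s] (Conn k \<psi>s))"
| quant: "\<omega> \<in> quants La \<Longrightarrow>
    m_rule La Sg {Seq (\<Gamma> @ [\<sigma>]) [\<phi>] \<psi>, Seq (\<Gamma> @ [\<sigma>]) [\<psi>] \<phi>}
      (Seq \<Gamma> [Quant \<omega> \<sigma> \<phi>] (Quant \<omega> \<sigma> \<psi>))"
| tensor: "m_rule La Sg {Seq \<Gamma> (\<Phi> @ [\<alpha>, \<beta>] @ \<Psi>) \<theta>} (Seq \<Gamma> (\<Phi> @ [Tensor La \<alpha> \<beta>] @ \<Psi>) \<theta>)"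
| tensor': "m_rule La Sg {Seq \<Gamma> (\<Phi> @ [Tensor La \<alpha> \<beta>] @ \<Psi>) \<theta>} (Seq \<Gamma> (\<Phi> @ [\<alpha>, \<beta>] @ \<Psi>) \<theta>)"
| unit: "m_rule La Sg {Seq \<Gamma> (\<Phi> @ \<Psi>) \<phi>} (Seq \<Gamma> (\<Phi> @ [Unit La] @ \<Psi>) \<phi>)"
| unit': "m_rule La Sg {Seq \<Gamma> (\<Phi> @ [Unit La] @ \<Psi>) \<phi>} (Seq \<Gamma> (\<Phi> @ \<Psi>) \<phi>)"

inductive_set Lm :: "'u language \<Rightarrow> 'u logic" for La Sg T where
  axiom: "a \<in> T \<Longrightarrow> a \<in> Lm La Sg T"
| eq_rule: "eq_rule Sg Ps a \<Longrightarrow> (\<And>p. p \<in> Ps \<Longrightarrow> p \<in> Lm La Sg T) \<Longrightarrow> a \<in> Lm La Sg T"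
| m_rule: "m_rule La Sg Ps a \<Longrightarrow> (\<And>p. p \<in> Ps \<Longrightarrow> p \<in> Lm La Sg T) \<Longrightarrow> a \<in> Lm La Sg T"


section \<open>Prop-categories\<close>

text \<open>\<open>cmp C g f\<close> is \<open>g \<circ> f\<close>. The poset \<open>P(c)\<close> is \<open>El C c\<close> ordered by \<open>Po C c\<close>, and \<open>reidx C f\<close> is
  \<open>P(f)\<close>.\<close>

record ('o, 'a, 'p, 'u) propcat =
  Ob :: "'o set"
  Ar :: "'a set"
  dm :: "'a \<Rightarrow> 'o"
  cd :: "'a \<Rightarrow> 'o"
  idn :: "'o \<Rightarrow> 'a"
  cmp :: "'a \<Rightarrow> 'a \<Rightarrow> 'a"
  top_ob :: "'o"
  prd :: "'o \<Rightarrow> 'o \<Rightarrow> 'o"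
  pr1 :: "'o \<Rightarrow> 'o \<Rightarrow> 'a"
  pr2 :: "'o \<Rightarrow> 'o \<Rightarrow> 'a"
  El :: "'o \<Rightarrow> 'p set"
  Po :: "'o \<Rightarrow> 'p rel"
  reidx :: "'a \<Rightarrow> 'p \<Rightarrow> 'p"
  conn_op :: "'o \<Rightarrow> 'u \<Rightarrow> 'p list \<Rightarrow> 'p"
  quant_op :: "'u \<Rightarrow> 'o \<Rightarrow> 'o \<Rightarrow> 'p \<Rightarrow> 'p"
  eq_el :: "'o \<Rightarrow> 'p"

definition hom_set :: "('o, 'a, 'p, 'u) propcat \<Rightarrow> 'o \<Rightarrow> 'o \<Rightarrow> 'a set" where
  "hom_set C b c = {f \<in> Ar C. dm C f = b \<and> cd C f = c}"

definition bang :: "('o, 'a, 'p, 'u) propcat \<Rightarrow> 'o \<Rightarrow> 'a" where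
  "bang C b = (THE f. f \<in> hom_set C b (top_ob C))"

definition pair :: "('o, 'a, 'p, 'u) propcat \<Rightarrow> 'a \<Rightarrow> 'a \<Rightarrow> 'a" where
  "pair C f g = (THE h. h \<in> hom_set C (dm C f) (prd C (cd C f) (cd C g)) \<and>
     cmp C (pr1 C (cd C f) (cd C g)) h = f \<and> cmp C (pr2 C (cd C f) (cd C g)) h = g)"

definition inverse_of :: "('o, 'a, 'p, 'u) propcat \<Rightarrow> 'a \<Rightarrow> 'a \<Rightarrow> bool" where
  "inverse_of C f g \<longleftrightarrow> f \<in> Ar C \<and> g \<in> hom_set C (cd C f) (dm C f) \<and>
     cmp C g f = idn C (dm C f) \<and> cmp C f g = idn C (cd C f)"

definition is_iso :: "('o, 'a, 'p, 'u) propcat \<Rightarrow> 'a \<Rightarrow> bool" where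
  "is_iso C f \<longleftrightarrow> (\<exists>g. inverse_of C f g)"

definition inv_ar :: "('o, 'a, 'p, 'u) propcat \<Rightarrow> 'a \<Rightarrow> 'a" where
  "inv_ar C f = (THE g. inverse_of C f g)"

locale fp_category =
  fixes C :: "('o, 'a, 'p, 'u) propcat"
  assumes dm_Ob: "f \<in> Ar C \<Longrightarrow> dm C f \<in> Ob C"
    and cd_Ob: "f \<in> Ar C \<Longrightarrow> cd C f \<in> Ob C"
    and idn_hom: "c \<in> Ob C \<Longrightarrow> idn C c \<in> hom_set C c c"
    and cmp_hom: "f \<in> hom_set C a b \<Longrightarrow> g \<in> hom_set C b c \<Longrightarrow> cmp C g f \<in> hom_set C a c"
    and idn_left: "f \<in> hom_set C a b \<Longrightarrow> cmp C (idn C b) f = f"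
    and idn_right: "f \<in> hom_set C a b \<Longrightarrow> cmp C f (idn C a) = f"
    and cmp_assoc: "f \<in> hom_set C a b \<Longrightarrow> g \<in> hom_set C b c \<Longrightarrow> h \<in> hom_set C c d \<Longrightarrow>
      cmp C h (cmp C g f) = cmp C (cmp C h g) f"
    and top_Ob: "top_ob C \<in> Ob C"
    and bang_ex1: "b \<in> Ob C \<Longrightarrow> \<exists>!f. f \<in> hom_set C b (top_ob C)"
    and prd_Ob: "b \<in> Ob C \<Longrightarrow> c \<in> Ob C \<Longrightarrow> prd C b c \<in> Ob C"
    and pr1_hom: "b \<in> Ob C \<Longrightarrow> c \<in> Ob C \<Longrightarrow> pr1 C b c \<in> hom_set C (prd C b c) b"
    and pr2_hom: "b \<in> Ob C \<Longrightarrow> c \<in> Ob C \<Longrightarrow> pr2 C b c \<in> hom_set C (prd C b c) c"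
    and pair_ex1: "f \<in> hom_set C a b \<Longrightarrow> g \<in> hom_set C a c \<Longrightarrow>
      \<exists>!h. h \<in> hom_set C a (prd C b c) \<and> cmp C (pr1 C b c) h = f \<and> cmp C (pr2 C b c) h = g"

locale prop_category = fp_category C for C :: "('o, 'a, 'p, 'u) propcat" +
  assumes poset: "c \<in> Ob C \<Longrightarrow> partial_order_on (El C c) (Po C c)"
    and reidx_mono: "f \<in> hom_set C b c \<Longrightarrow> (x, y) \<in> Po C c \<Longrightarrow> (reidx C f x, reidx C f y) \<in> Po C b"
    and reidx_idn: "c \<in> Ob C \<Longrightarrow> x \<in> El C c \<Longrightarrow> reidx C (idn C c) x = x"
    and reidx_cmp: "f \<in> hom_set C a b \<Longrightarrow> g \<in> hom_set C b c \<Longrightarrow> x \<in> El C c \<Longrightarrow>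
      reidx C (cmp C g f) x = reidx C f (reidx C g x)"

definition prd_id :: "('o, 'a, 'p, 'u) propcat \<Rightarrow> 'a \<Rightarrow> 'o \<Rightarrow> 'a" where
  "prd_id C f c = pair C (cmp C f (pr1 C (dm C f) c)) (pr2 C (dm C f) c)"

text \<open>The isomorphism \<open>a\<^sub>b\<^sub>,\<^sub>c\<^sub>,\<^sub>d : b \<times> (c \<times> d) \<rightarrow> (b \<times> c) \<times> d\<close>.\<close>

definition assoc_ar :: "('o, 'a, 'p, 'u) propcat \<Rightarrow> 'o \<Rightarrow> 'o \<Rightarrow> 'o \<Rightarrow> 'a" where
  "assoc_ar C b c d =
     (let p = pr1 C b (prd C c d); q = pr2 C b (prd C c d)
      in pair C (pair C p (cmp C (pr1 C c d) q)) (cmp C (pr2 C c d) q))"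

definition unit_el :: "'u language \<Rightarrow> ('o, 'a, 'p, 'u) propcat \<Rightarrow> 'o \<Rightarrow> 'p" where
  "unit_el La C c = conn_op C c (unit_conn La) []"

definition tensor_op :: "'u language \<Rightarrow> ('o, 'a, 'p, 'u) propcat \<Rightarrow> 'o \<Rightarrow> 'p \<Rightarrow> 'p \<Rightarrow> 'p" where
  "tensor_op La C c x y = conn_op C c (tensor_conn La) [x, y]"

locale FA = prop_category C for C :: "('o, 'a, 'p, 'u) propcat" +
  fixes La :: "'u language"
  assumes conn_El: "c \<in> Ob C \<Longrightarrow> k \<in> conns La (length xs) \<Longrightarrow> set xs \<subseteq> El C c \<Longrightarrow>
      conn_op C c k xs \<in> El C c"
    and conn_reidx: "f \<in> hom_set C b c \<Longrightarrow> k \<in> conns La (length xs) \<Longrightarrow> set xs \<subseteq> El C c \<Longrightarrow>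
      reidx C f (conn_op C c k xs) = conn_op C b k (map (reidx C f) xs)"
    and monoid: "c \<in> Ob C \<Longrightarrow>
      monoid \<lparr>carrier = El C c, mult = tensor_op La C c, one = unit_el La C c\<rparr>"
    and quant_El: "\<omega> \<in> quants La \<Longrightarrow> b \<in> Ob C \<Longrightarrow> c \<in> Ob C \<Longrightarrow> x \<in> El C (prd C b c) \<Longrightarrow>
      quant_op C \<omega> b c x \<in> El C b"
    and quant_natural: "\<omega> \<in> quants La \<Longrightarrow> f \<in> hom_set C b' b \<Longrightarrow> c \<in> Ob C \<Longrightarrow> x \<in> El C (prd C b c) \<Longrightarrow>
      reidx C f (quant_op C \<omega> b c x) = quant_op C \<omega> b' c (reidx C (prd_id C f c) x)"
    and quant_top: "\<omega> \<in> quants La \<Longrightarrow> b \<in> Ob C \<Longrightarrow> x \<in> El C b \<Longrightarrow>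
      quant_op C \<omega> b (top_ob C) (reidx C (pr1 C b (top_ob C)) x) = x"
    and quant_prd: "\<omega> \<in> quants La \<Longrightarrow> b \<in> Ob C \<Longrightarrow> c \<in> Ob C \<Longrightarrow> d \<in> Ob C \<Longrightarrow>
      x \<in> El C (prd C (prd C b c) d) \<Longrightarrow>
      quant_op C \<omega> b (prd C c d) (reidx C (assoc_ar C b c d) x) =
        quant_op C \<omega> b c (quant_op C \<omega> (prd C b c) d x)"
    and eq_El: "c \<in> Ob C \<Longrightarrow> eq_el C c \<in> El C (prd C c c)"
    and eq_top: "eq_el C (top_ob C) = unit_el La C (prd C (top_ob C) (top_ob C))"
    and eq_prd: "c \<in> Ob C \<Longrightarrow> d \<in> Ob C \<Longrightarrow> p = pr1 C (prd C c d) (prd C c d) \<Longrightarrow>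
      q = pr2 C (prd C c d) (prd C c d) \<Longrightarrow>
      eq_el C (prd C c d) = tensor_op La C (prd C (prd C c d) (prd C c d))
        (reidx C (pair C (cmp C (pr1 C c d) p) (cmp C (pr1 C c d) q)) (eq_el C c))
        (reidx C (pair C (cmp C (pr2 C c d) p) (cmp C (pr2 C c d) q)) (eq_el C d))"


section \<open>Structures and satisfaction\<close>

record ('o, 'a, 'p, 'u) "structure" =
  sort_ob :: "'u \<Rightarrow> 'o"
  fun_ar :: "'u \<Rightarrow> 'a"
  rel_el :: "'u \<Rightarrow> 'p"

text \<open>Contexts, and the argument sorts of function and relation symbols, are interpreted by
  the left-nested products \<open>((1 \<times> \<sigma>\<^sub>0) \<times> \<dots>) \<times> \<sigma>\<^sub>n\<^sub>-\<^sub>1\<close>.\<close>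

definition ctx_ob ::
  "('o, 'a, 'p, 'u) propcat \<Rightarrow> ('o, 'a, 'p, 'u) structure \<Rightarrow> 'u ctx \<Rightarrow> 'o" where
  "ctx_ob C M \<Gamma> = foldl (prd C) (top_ob C) (map (sort_ob M) \<Gamma>)"

definition is_structure ::
  "'u signature \<Rightarrow> ('o, 'a, 'p, 'u) propcat \<Rightarrow> ('o, 'a, 'p, 'u) structure \<Rightarrow> bool" where
  "is_structure Sg C M \<longleftrightarrow>
     (\<forall>\<sigma>\<in>sorts Sg. sort_ob M \<sigma> \<in> Ob C) \<and>
     (\<forall>f \<sigma>s \<tau>. funs Sg f = Some (\<sigma>s, \<tau>) \<longrightarrow> fun_ar M f \<in> hom_set C (ctx_ob C M \<sigma>s) (sort_ob M \<tau>)) \<and>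
     (\<forall>r \<sigma>s. rels Sg r = Some \<sigma>s \<longrightarrow> rel_el M r \<in> El C (ctx_ob C M \<sigma>s))"

text \<open>The argument is the reversed context.\<close>

primrec rev_proj ::
  "('o, 'a, 'p, 'u) propcat \<Rightarrow> ('o, 'a, 'p, 'u) structure \<Rightarrow> 'u ctx \<Rightarrow> nat \<Rightarrow> 'a" where
  "rev_proj C M [] i = undefined"
| "rev_proj C M (\<sigma> # \<Gamma>) i =
     (if i = length \<Gamma> then pr2 C (ctx_ob C M (rev \<Gamma>)) (sort_ob M \<sigma>)
      else cmp C (rev_proj C M \<Gamma> i) (pr1 C (ctx_ob C M (rev \<Gamma>)) (sort_ob M \<sigma>)))"

definition tuple_ar :: "('o, 'a, 'p, 'u) propcat \<Rightarrow> 'o \<Rightarrow> 'a list \<Rightarrow> 'a" where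
  "tuple_ar C b fs = foldl (pair C) (bang C b) fs"

primrec tm_ar ::
  "('o, 'a, 'p, 'u) propcat \<Rightarrow> ('o, 'a, 'p, 'u) structure \<Rightarrow> 'u ctx \<Rightarrow> 'u tm \<Rightarrow> 'a" where
  "tm_ar C M \<Gamma> (Var i) = rev_proj C M (rev \<Gamma>) i"
| "tm_ar C M \<Gamma> (Fun f Ms) = cmp C (fun_ar M f) (tuple_ar C (ctx_ob C M \<Gamma>) (map (tm_ar C M \<Gamma>) Ms))"

primrec fm_el ::
  "('o, 'a, 'p, 'u) propcat \<Rightarrow> ('o, 'a, 'p, 'u) structure \<Rightarrow> 'u fm \<Rightarrow> 'u ctx \<Rightarrow> 'p" where
  "fm_el C M (Rel r Ms) \<Gamma> = reidx C (tuple_ar C (ctx_ob C M \<Gamma>) (map (tm_ar C M \<Gamma>) Ms)) (rel_el M r)"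
| "fm_el C M (Equ \<sigma> M\<^sub>1 M\<^sub>2) \<Gamma> =
     reidx C (pair C (tm_ar C M \<Gamma> M\<^sub>1) (tm_ar C M \<Gamma> M\<^sub>2)) (eq_el C (sort_ob M \<sigma>))"
| "fm_el C M (Conn k \<phi>s) \<Gamma> = conn_op C (ctx_ob C M \<Gamma>) k (map (\<lambda>\<phi>. fm_el C M \<phi> \<Gamma>) \<phi>s)"
| "fm_el C M (Quant \<omega> \<sigma> \<phi>) \<Gamma> =
     quant_op C \<omega> (ctx_ob C M \<Gamma>) (sort_ob M \<sigma>) (fm_el C M \<phi> (\<Gamma> @ [\<sigma>]))"

primrec satisfies :: "'u language \<Rightarrow> ('o, 'a, 'p, 'u) propcat \<Rightarrow> ('o, 'a, 'p, 'u) structure \<Rightarrow>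
    'u assertion \<Rightarrow> bool" where
  "satisfies La C M (Eqn \<Gamma> \<tau> M\<^sub>1 M\<^sub>2) \<longleftrightarrow> tm_ar C M \<Gamma> M\<^sub>1 = tm_ar C M \<Gamma> M\<^sub>2"
| "satisfies La C M (Seq \<Gamma> \<Phi> \<phi>) \<longleftrightarrow>
     (list_prod (unit_el La C (ctx_ob C M \<Gamma>)) (tensor_op La C (ctx_ob C M \<Gamma>))
        (map (\<lambda>\<psi>. fm_el C M \<psi> \<Gamma>) \<Phi>), fm_el C M \<phi> \<Gamma>) \<in> Po C (ctx_ob C M \<Gamma>)"

definition entails_in :: "'u language \<Rightarrow> 'u signature \<Rightarrow> ('o, 'a, 'p, 'u) propcat \<Rightarrow>
    'u assertion set \<Rightarrow> 'u assertion set \<Rightarrow> bool" where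
  "entails_in La Sg C T T' \<longleftrightarrow> (\<forall>M. is_structure Sg C M \<and> (\<forall>a\<in>T. satisfies La C M a) \<longrightarrow>
     (\<forall>a\<in>T'. satisfies La C M a))"

definition in_FAL :: "'u language \<Rightarrow> 'u logic \<Rightarrow> ('o, 'a, 'p, 'u) propcat \<Rightarrow> bool" where
  "in_FAL La L C \<longleftrightarrow> FA C La \<and>
     (\<forall>Sg T T'. is_signature Sg \<and> T \<subseteq> assertions La Sg \<and> T' \<subseteq> assertions La Sg \<and> T' \<subseteq> L Sg T
        \<longrightarrow> entails_in La Sg C T T')"


section \<open>Morphisms\<close>

record ('o, 'a, 'p, 'o2, 'a2, 'p2, 'u) morphism =
  src :: "('o, 'a, 'p, 'u) propcat"
  tgt :: "('o2, 'a2, 'p2, 'u) propcat"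
  ob_map :: "'o \<Rightarrow> 'o2"
  ar_map :: "'a \<Rightarrow> 'a2"
  el_map :: "'o \<Rightarrow> 'p \<Rightarrow> 'p2"

text \<open>The canonical arrow \<open>a\<^sub>F\<^sub>,\<^sub>b\<^sub>,\<^sub>c : F(b \<times> c) \<rightarrow> F b \<times> F c\<close>.\<close>

definition comparison :: "('o, 'a, 'p, 'o2, 'a2, 'p2, 'u) morphism \<Rightarrow> 'o \<Rightarrow> 'o \<Rightarrow> 'a2" where
  "comparison F b c = pair (tgt F) (ar_map F (pr1 (src F) b c)) (ar_map F (pr2 (src F) b c))"

text \<open>The maps are extensional, so that equality of morphisms is equality of records.\<close>

locale FA_morphism =
  A: FA "src F" La + B: FA "tgt F" La
  for La :: "'u language" and F :: "('o, 'a, 'p, 'o2, 'a2, 'p2, 'u) morphism" +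
  assumes ob_map: "ob_map F \<in> Ob (src F) \<rightarrow>\<^sub>E Ob (tgt F)"
    and ar_map: "ar_map F \<in> Ar (src F) \<rightarrow>\<^sub>E Ar (tgt F)"
    and el_map: "el_map F \<in> (\<Pi>\<^sub>E c\<in>Ob (src F). El (src F) c \<rightarrow>\<^sub>E El (tgt F) (ob_map F c))"
    and map_hom: "f \<in> hom_set (src F) b c \<Longrightarrow>
      ar_map F f \<in> hom_set (tgt F) (ob_map F b) (ob_map F c)"
    and map_idn: "c \<in> Ob (src F) \<Longrightarrow> ar_map F (idn (src F) c) = idn (tgt F) (ob_map F c)"
    and map_cmp: "f \<in> hom_set (src F) a b \<Longrightarrow> g \<in> hom_set (src F) b c \<Longrightarrow>
      ar_map F (cmp (src F) g f) = cmp (tgt F) (ar_map F g) (ar_map F f)"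
    and preserves_top: "is_iso (tgt F) (bang (tgt F) (ob_map F (top_ob (src F))))"
    and preserves_prd: "b \<in> Ob (src F) \<Longrightarrow> c \<in> Ob (src F) \<Longrightarrow> is_iso (tgt F) (comparison F b c)"
    and map_mono: "c \<in> Ob (src F) \<Longrightarrow> (x, y) \<in> Po (src F) c \<Longrightarrow>
      (el_map F c x, el_map F c y) \<in> Po (tgt F) (ob_map F c)"
    and map_reidx: "f \<in> hom_set (src F) b c \<Longrightarrow> x \<in> El (src F) c \<Longrightarrow>
      el_map F b (reidx (src F) f x) = reidx (tgt F) (ar_map F f) (el_map F c x)"
    and map_conn: "c \<in> Ob (src F) \<Longrightarrow> k \<in> conns La (length xs) \<Longrightarrow> set xs \<subseteq> El (src F) c \<Longrightarrow>
      el_map F c (conn_op (src F) c k xs) = conn_op (tgt F) (ob_map F c) k (map (el_map F c) xs)"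
    and map_quant: "\<omega> \<in> quants La \<Longrightarrow> b \<in> Ob (src F) \<Longrightarrow> c \<in> Ob (src F) \<Longrightarrow>
      x \<in> El (src F) (prd (src F) b c) \<Longrightarrow>
      el_map F b (quant_op (src F) \<omega> b c x) =
        quant_op (tgt F) \<omega> (ob_map F b) (ob_map F c)
          (reidx (tgt F) (inv_ar (tgt F) (comparison F b c)) (el_map F (prd (src F) b c) x))"
    and map_eq: "c \<in> Ob (src F) \<Longrightarrow>
      el_map F (prd (src F) c c) (eq_el (src F) c) =
        reidx (tgt F) (comparison F c c) (eq_el (tgt F) (ob_map F c))"

definition comp_morphism :: "('o2, 'a2, 'p2, 'o3, 'a3, 'p3, 'u) morphism \<Rightarrow>
    ('o, 'a, 'p, 'o2, 'a2, 'p2, 'u) morphism \<Rightarrow> ('o, 'a, 'p, 'o3, 'a3, 'p3, 'u) morphism" where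
  "comp_morphism H F = \<lparr>src = src F, tgt = tgt H,
     ob_map = compose (Ob (src F)) (ob_map H) (ob_map F),
     ar_map = compose (Ar (src F)) (ar_map H) (ar_map F),
     el_map = (\<lambda>c\<in>Ob (src F). compose (El (src F) c) (el_map H (ob_map F c)) (el_map F c))\<rparr>"

definition subprop_morphism ::
  "'u language \<Rightarrow> ('o, 'a, 'p, 'o2, 'a2, 'p2, 'u) morphism \<Rightarrow> bool" where
  "subprop_morphism La \<iota> \<longleftrightarrow> FA_morphism La \<iota> \<and>
     (\<forall>b\<in>Ob (src \<iota>). \<forall>c\<in>Ob (src \<iota>). inj_on (ar_map \<iota>) (hom_set (src \<iota>) b c)) \<and>
     (\<forall>c\<in>Ob (src \<iota>). \<forall>x\<in>El (src \<iota>) c. \<forall>y\<in>El (src \<iota>) c.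
        (x, y) \<in> Po (src \<iota>) c \<longleftrightarrow> (el_map \<iota> c x, el_map \<iota> c y) \<in> Po (tgt \<iota>) (ob_map \<iota> c))"

definition prod_propcat :: "('u set \<Rightarrow> ('u \<Rightarrow> 'u) \<Rightarrow> 'u) \<Rightarrow> 'u set \<Rightarrow>
    ('u \<Rightarrow> ('u, 'u, 'u, 'u) propcat) \<Rightarrow> ('u, 'u, 'u, 'u) propcat" where
  "prod_propcat tup I D =
     (let pr = component tup I; tp = (\<lambda>x. tup I (restrict x I)) in
      \<lparr>Ob = tup I ` (\<Pi>\<^sub>E i\<in>I. Ob (D i)),
       Ar = tup I ` (\<Pi>\<^sub>E i\<in>I. Ar (D i)),
       dm = (\<lambda>f. tp (\<lambda>i. dm (D i) (pr f i))),
       cd = (\<lambda>f. tp (\<lambda>i. cd (D i) (pr f i))),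
       idn = (\<lambda>c. tp (\<lambda>i. idn (D i) (pr c i))),
       cmp = (\<lambda>g f. tp (\<lambda>i. cmp (D i) (pr g i) (pr f i))),
       top_ob = tp (\<lambda>i. top_ob (D i)),
       prd = (\<lambda>b c. tp (\<lambda>i. prd (D i) (pr b i) (pr c i))),
       pr1 = (\<lambda>b c. tp (\<lambda>i. pr1 (D i) (pr b i) (pr c i))),
       pr2 = (\<lambda>b c. tp (\<lambda>i. pr2 (D i) (pr b i) (pr c i))),
       El = (\<lambda>c. tup I ` (\<Pi>\<^sub>E i\<in>I. El (D i) (pr c i))),
       Po = (\<lambda>c. {(tup I x, tup I y) | x y.
               x \<in> (\<Pi>\<^sub>E i\<in>I. El (D i) (pr c i)) \<and> y \<in> (\<Pi>\<^sub>E i\<in>I. El (D i) (pr c i)) \<and>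
               (\<forall>i\<in>I. (x i, y i) \<in> Po (D i) (pr c i))}),
       reidx = (\<lambda>f x. tp (\<lambda>i. reidx (D i) (pr f i) (pr x i))),
       conn_op = (\<lambda>c k xs. tp (\<lambda>i. conn_op (D i) (pr c i) k (map (\<lambda>x. pr x i) xs))),
       quant_op = (\<lambda>\<omega> b c x. tp (\<lambda>i. quant_op (D i) \<omega> (pr b i) (pr c i) (pr x i))),
       eq_el = (\<lambda>c. tp (\<lambda>i. eq_el (D i) (pr c i)))\<rparr>)"

definition tuple_morphism :: "('u set \<Rightarrow> ('u \<Rightarrow> 'u) \<Rightarrow> 'u) \<Rightarrow> 'u set \<Rightarrow> ('o, 'a, 'p, 'u) propcat \<Rightarrow>
    ('u \<Rightarrow> ('o, 'a, 'p, 'u, 'u, 'u, 'u) morphism) \<Rightarrow> ('o, 'a, 'p, 'u, 'u, 'u, 'u) morphism" where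
  "tuple_morphism tup I A F =
     \<lparr>src = A, tgt = prod_propcat tup I (\<lambda>i. tgt (F i)),
      ob_map = (\<lambda>c\<in>Ob A. tup I (\<lambda>i\<in>I. ob_map (F i) c)),
      ar_map = (\<lambda>f\<in>Ar A. tup I (\<lambda>i\<in>I. ar_map (F i) f)),
      el_map = (\<lambda>c\<in>Ob A. \<lambda>x\<in>El A c. tup I (\<lambda>i\<in>I. el_map (F i) c x))\<rparr>"


section \<open>The classifying prop-category\<close>

text \<open>An arrow of the classifying prop-category consists of its domain, its codomain, and a class
  of lists of terms.\<close>

type_synonym 'u cl_ar = "'u ctx \<times> 'u ctx \<times> 'u tm list set"

type_synonym 'u cl_propcat = "('u ctx, 'u cl_ar, 'u fm set, 'u) propcat"

definition tms_class ::
  "'u language \<Rightarrow> 'u signature \<Rightarrow> 'u ctx \<Rightarrow> 'u ctx \<Rightarrow> 'u tm list \<Rightarrow> 'u cl_ar" where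
  "tms_class La Sg \<Gamma> \<Delta> Ms =
     (\<Gamma>, \<Delta>, {Ns. list_all2 (is_tm Sg \<Gamma>) Ns \<Delta> \<and> eqns \<Gamma> \<Delta> Ms Ns \<subseteq> Lm La Sg {}})"

definition fm_class :: "'u language \<Rightarrow> 'u signature \<Rightarrow> 'u ctx \<Rightarrow> 'u fm \<Rightarrow> 'u fm set" where
  "fm_class La Sg \<Gamma> \<phi> = {\<psi>. is_fm La Sg \<Gamma> \<psi> \<and> Seq \<Gamma> [\<phi>] \<psi> \<in> Lm La Sg {} \<and> Seq \<Gamma> [\<psi>] \<phi> \<in> Lm La Sg {}}"

definition rep :: "'b set \<Rightarrow> 'b" where
  "rep X = (SOME x. x \<in> X)"

definition classifying :: "'u language \<Rightarrow> 'u signature \<Rightarrow> 'u cl_propcat" where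
  "classifying La Sg =
     \<lparr>Ob = {\<Gamma>. is_ctx Sg \<Gamma>},
      Ar = {tms_class La Sg \<Gamma> \<Delta> Ms | \<Gamma> \<Delta> Ms.
              is_ctx Sg \<Gamma> \<and> is_ctx Sg \<Delta> \<and> list_all2 (is_tm Sg \<Gamma>) Ms \<Delta>},
      dm = (\<lambda>(\<Gamma>, \<Delta>, X). \<Gamma>),
      cd = (\<lambda>(\<Gamma>, \<Delta>, X). \<Delta>),
      idn = (\<lambda>\<Gamma>. tms_class La Sg \<Gamma> \<Gamma> (vars 0 (length \<Gamma>))),
      cmp = (\<lambda>(\<Delta>', \<Theta>, Y) (\<Gamma>, \<Delta>, X). tms_class La Sg \<Gamma> \<Theta> (map (tm_subst (rep X)) (rep Y))),
      top_ob = [],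
      prd = (\<lambda>\<Gamma> \<Delta>. \<Gamma> @ \<Delta>),
      pr1 = (\<lambda>\<Gamma> \<Delta>. tms_class La Sg (\<Gamma> @ \<Delta>) \<Gamma> (vars 0 (length \<Gamma>))),
      pr2 = (\<lambda>\<Gamma> \<Delta>. tms_class La Sg (\<Gamma> @ \<Delta>) \<Delta> (vars (length \<Gamma>) (length \<Delta>))),
      El = (\<lambda>\<Gamma>. fm_class La Sg \<Gamma> ` {\<phi>. is_fm La Sg \<Gamma> \<phi>}),
      Po = (\<lambda>\<Gamma>. {(fm_class La Sg \<Gamma> \<phi>, fm_class La Sg \<Gamma> \<psi>) | \<phi> \<psi>.
              is_fm La Sg \<Gamma> \<phi> \<and> is_fm La Sg \<Gamma> \<psi> \<and> Seq \<Gamma> [\<phi>] \<psi> \<in> Lm La Sg {}}),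
      reidx = (\<lambda>(\<Gamma>, \<Delta>, X) Z. fm_class La Sg \<Gamma> (fm_subst (rep Z) (length \<Gamma>) (rep X))),
      conn_op = (\<lambda>\<Gamma> k Zs. fm_class La Sg \<Gamma> (Conn k (map rep Zs))),
      quant_op = (\<lambda>\<omega> \<Gamma> \<Delta> Z. fm_class La Sg \<Gamma> (foldr (Quant \<omega>) \<Delta> (rep Z))),
      eq_el = (\<lambda>\<Gamma>. fm_class La Sg (\<Gamma> @ \<Gamma>)
         (Tensors La (map (\<lambda>i. Equ (\<Gamma> ! i) (Var i) (Var (length \<Gamma> + i))) [0..<length \<Gamma>])))\<rparr>"


section \<open>External models\<close>

text \<open>The morphisms out of the classifying prop-category with codomain over \<open>'u\<close>.\<close>

type_synonym 'u model = "('u ctx, 'u cl_ar, 'u fm set, 'u, 'u, 'u, 'u) morphism"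

definition Mod :: "'u language \<Rightarrow> 'u logic \<Rightarrow> 'u signature \<Rightarrow> 'u model set" where
  "Mod La L Sg = {F. src F = classifying La Sg \<and> FA_morphism La F \<and> in_FAL La L (tgt F)}"

primrec in_ker :: "'u language \<Rightarrow> 'u signature \<Rightarrow> 'u assertion \<Rightarrow> 'u model \<Rightarrow> bool" where
  "in_ker La Sg (Eqn \<Gamma> \<tau> M\<^sub>1 M\<^sub>2) F \<longleftrightarrow>
     ar_map F (tms_class La Sg \<Gamma> [\<tau>] [M\<^sub>1]) = ar_map F (tms_class La Sg \<Gamma> [\<tau>] [M\<^sub>2])"
| "in_ker La Sg (Seq \<Gamma> \<Phi> \<phi>) F \<longleftrightarrow>
     (el_map F \<Gamma> (fm_class La Sg \<Gamma> (Tensors La \<Phi>)), el_map F \<Gamma> (fm_class La Sg \<Gamma> \<phi>))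
       \<in> Po (tgt F) (ob_map F \<Gamma>)"

definition Th :: "'u language \<Rightarrow> 'u signature \<Rightarrow> 'u model set \<Rightarrow> 'u assertion set" where
  "Th La Sg Y = {a \<in> assertions La Sg. \<forall>F\<in>Y. in_ker La Sg a F}"

definition Mod_of ::
  "'u language \<Rightarrow> 'u logic \<Rightarrow> 'u signature \<Rightarrow> 'u assertion set \<Rightarrow> 'u model set" where
  "Mod_of La L Sg T = {F \<in> Mod La L Sg. \<forall>a\<in>T. in_ker La Sg a F}"

inductive_set products ::
  "('u set \<Rightarrow> bool) \<Rightarrow> ('u set \<Rightarrow> ('u \<Rightarrow> 'u) \<Rightarrow> 'u) \<Rightarrow> 'u language \<Rightarrow> 'u signature \<Rightarrow>
   'u model set \<Rightarrow> 'u model set" for small tup La Sg Y where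
  base: "F \<in> Y \<Longrightarrow> F \<in> products small tup La Sg Y"
| product: "small I \<Longrightarrow> (\<And>i. i \<in> I \<Longrightarrow> F i \<in> products small tup La Sg Y) \<Longrightarrow>
    tuple_morphism tup I (classifying La Sg) F \<in> products small tup La Sg Y"

inductive_set submodels :: "'u language \<Rightarrow> 'u logic \<Rightarrow> 'u signature \<Rightarrow> 'u model set \<Rightarrow> 'u model set"
  for La L Sg Y where
  base: "F \<in> Y \<Longrightarrow> F \<in> submodels La L Sg Y"
| submodel: "comp_morphism \<iota> H \<in> submodels La L Sg Y \<Longrightarrow> H \<in> Mod La L Sg \<Longrightarrow>
    subprop_morphism La \<iota> \<Longrightarrow> src \<iota> = tgt H \<Longrightarrow> in_FAL La L (tgt \<iota>) \<Longrightarrow> H \<in> submodels La L Sg Y"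

inductive_set images :: "'u language \<Rightarrow> 'u logic \<Rightarrow> 'u model set \<Rightarrow> 'u model set" for La L Y where
  base: "F \<in> Y \<Longrightarrow> F \<in> images La L Y"
| image: "F \<in> images La L Y \<Longrightarrow> FA_morphism La H \<Longrightarrow> src H = tgt F \<Longrightarrow> in_FAL La L (tgt H) \<Longrightarrow>
    comp_morphism H F \<in> images La L Y"

end

theory Submission
  imports Defs
begin

text \<open>Kernels of morphisms out of the classifying prop-category are intersected by products,
  reflected along subprop-morphisms, and only grow under composition; and \<open>FA\<^sub>L\<close> is closed under
  products and subobjects because a
  jointly conservative family of morphisms transports structures without changing satisfaction.
  This gives one inclusion.

  Conversely, let \<open>F\<close> satisfy the theory of \<open>Y\<close>. Since the signature is small, there is a small
  family of members of \<open>Y\<close> refuting every assertion outside that theory. The product \<open>G\<close> of the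
  family has its kernel inside that of \<open>F\<close>, so \<open>F\<close> factors through the image of \<open>G\<close>, which is a
  submodel of \<open>G\<close>.\<close>

section \<open>Finite products\<close>

text \<open>Three mismatches shape the proof. First, morphisms preserve products only up to
  isomorphism, while structures interpret contexts by chosen products. Every transport of a
  structure therefore carries comparison isomorphisms, and morphisms preserving products on the nose
  are treated apart. Secondly, kernels test single terms and sequents, but a factorization through
  an image must know when two arbitrary arrows of the classifying prop-category are identified;
  since such arrows are lists of terms, product preservation closes the gap. Thirdly, models have
  targets over \<open>'u\<close> and products run over small sets, whereas contexts and assertions
  live in other types and \<open>Y\<close> may be a proper class. Coding syntax by lists over a
  small infinite set turns contexts into objects and assertions into indices. Transport of
  structures is called for because membership in \<open>FA_L\<close> is defined through the
  structures of all signatures, not through morphisms out of the one classifying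
  prop-category.\<close>

context fp_category
begin

lemma hom_Ob: "f \<in> hom_set C a b \<Longrightarrow> a \<in> Ob C" "f \<in> hom_set C a b \<Longrightarrow> b \<in> Ob C"
  using dm_Ob cd_Ob by (auto simp: hom_set_def)

lemma hom_dm_cd: "f \<in> hom_set C a b \<Longrightarrow> dm C f = a" "f \<in> hom_set C a b \<Longrightarrow> cd C f = b"
  by (auto simp: hom_set_def)

lemma hom_Ar: "f \<in> hom_set C a b \<Longrightarrow> f \<in> Ar C"
  by (auto simp: hom_set_def)

lemma bang_hom: "b \<in> Ob C \<Longrightarrow> bang C b \<in> hom_set C b (top_ob C)"
  unfolding bang_def using bang_ex1 by (rule theI')

lemma top_eqI: "f \<in> hom_set C b (top_ob C) \<Longrightarrow> g \<in> hom_set C b (top_ob C) \<Longrightarrow> f = g"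
  using bang_ex1 hom_Ob(1) by blast

lemma bang_eqI: "f \<in> hom_set C b (top_ob C) \<Longrightarrow> bang C b = f"
  using top_eqI bang_hom hom_Ob(1) by blast

lemma prd_eqI:
  assumes "h \<in> hom_set C a (prd C b c)" "k \<in> hom_set C a (prd C b c)" "b \<in> Ob C" "c \<in> Ob C"
    and "cmp C (pr1 C b c) h = cmp C (pr1 C b c) k" "cmp C (pr2 C b c) h = cmp C (pr2 C b c) k"
  shows "h = k"
  using pair_ex1 [OF cmp_hom [OF assms(1) pr1_hom] cmp_hom [OF assms(1) pr2_hom]] assms by metis

text \<open>\<open>pair\<close> is a definite description whose endpoints are read off from the
  arrows. Once these are typed it becomes the universal property, and \<open>pair_ex1\<close> makes
  the description proper.\<close>

lemma pair_props:
  assumes "f \<in> hom_set C a b" "g \<in> hom_set C a c"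
  shows pair_hom: "pair C f g \<in> hom_set C a (prd C b c)"
    and pr1_pair: "cmp C (pr1 C b c) (pair C f g) = f"
    and pr2_pair: "cmp C (pr2 C b c) (pair C f g) = g"
proof -
  have "pair C f g = (THE h. h \<in> hom_set C a (prd C b c) \<and>
      cmp C (pr1 C b c) h = f \<and> cmp C (pr2 C b c) h = g)"
    using assms by (simp add: pair_def hom_dm_cd)
  then show "pair C f g \<in> hom_set C a (prd C b c)" "cmp C (pr1 C b c) (pair C f g) = f"
      "cmp C (pr2 C b c) (pair C f g) = g"
    using theI' [OF pair_ex1 [OF assms]] by auto
qed

lemma pair_eqI:
  assumes "h \<in> hom_set C a (prd C b c)" "b \<in> Ob C" "c \<in> Ob C"
    and "cmp C (pr1 C b c) h = f" "cmp C (pr2 C b c) h = g"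
  shows "pair C f g = h"
proof (rule prd_eqI [OF _ assms(1,2,3)])
  have "f \<in> hom_set C a b" "g \<in> hom_set C a c"
    using assms cmp_hom pr1_hom pr2_hom by blast+
  then show "pair C f g \<in> hom_set C a (prd C b c)"
    "cmp C (pr1 C b c) (pair C f g) = cmp C (pr1 C b c) h"
    "cmp C (pr2 C b c) (pair C f g) = cmp C (pr2 C b c) h"
    using pair_props assms by auto
qed

lemma pair_cmp:
  assumes "f \<in> hom_set C a b" "g \<in> hom_set C a c" "h \<in> hom_set C z a"
  shows "cmp C (pair C f g) h = pair C (cmp C f h) (cmp C g h)"
proof (rule pair_eqI [symmetric])
  have b: "b \<in> Ob C" "c \<in> Ob C" using assms hom_Ob by auto
  show "b \<in> Ob C" "c \<in> Ob C" by fact+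
  show "cmp C (pair C f g) h \<in> hom_set C z (prd C b c)"
    using pair_hom assms cmp_hom by blast
  show "cmp C (pr1 C b c) (cmp C (pair C f g) h) = cmp C f h"
    "cmp C (pr2 C b c) (cmp C (pair C f g) h) = cmp C g h"
    using cmp_assoc [OF assms(3) pair_hom [OF assms(1,2)]] pr1_hom [OF b] pr2_hom [OF b]
      pair_props [OF assms(1,2)] by simp_all
qed

lemma inverse_of_unique:
  assumes "inverse_of C f g" "inverse_of C f h" shows "g = h"
proof -
  have f: "f \<in> hom_set C (dm C f) (cd C f)" using assms(1) by (simp add: inverse_of_def hom_set_def)
  have gh: "g \<in> hom_set C (cd C f) (dm C f)" "h \<in> hom_set C (cd C f) (dm C f)"
    using assms by (simp_all add: inverse_of_def)
  have "g = cmp C g (cmp C f h)" using assms(2) gh idn_right by (simp add: inverse_of_def)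
  also have "\<dots> = cmp C (cmp C g f) h" using cmp_assoc [OF gh(2) f gh(1)] .
  also have "\<dots> = h" using assms(1) gh idn_left by (simp add: inverse_of_def)
  finally show ?thesis .
qed

lemma inverse_ofI:
  assumes "f \<in> hom_set C b c" "g \<in> hom_set C c b" "cmp C g f = idn C b" "cmp C f g = idn C c"
  shows "inverse_of C f g"
  using assms by (auto simp: inverse_of_def hom_set_def)

lemma inv_ar_eqI: "inverse_of C f g \<Longrightarrow> inv_ar C f = g"
  unfolding inv_ar_def using inverse_of_unique by blast

lemma inv_ar_props:
  assumes "is_iso C f" "f \<in> hom_set C b c"
  shows inv_ar_hom: "inv_ar C f \<in> hom_set C c b"
    and inv_ar_left: "cmp C (inv_ar C f) f = idn C b"
    and inv_ar_right: "cmp C f (inv_ar C f) = idn C c"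
proof -
  obtain g where g: "inverse_of C f g" using assms(1) by (auto simp: is_iso_def)
  then show "inv_ar C f \<in> hom_set C c b" "cmp C (inv_ar C f) f = idn C b"
      "cmp C f (inv_ar C f) = idn C c"
    using inv_ar_eqI [OF g] assms(2) by (auto simp: inverse_of_def hom_dm_cd)
qed

lemma inverse_of_inv_ar: "is_iso C f \<Longrightarrow> inverse_of C f (inv_ar C f)"
  using inv_ar_eqI by (auto simp: is_iso_def)

lemma inverse_of_idn: "c \<in> Ob C \<Longrightarrow> inverse_of C (idn C c) (idn C c)"
  using idn_hom idn_left by (intro inverse_ofI) auto

lemma inverse_of_cmp:
  assumes "inverse_of C f f'" "inverse_of C g g'" "f \<in> hom_set C a b" "g \<in> hom_set C b c"
  shows "inverse_of C (cmp C g f) (cmp C f' g')"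
proof (rule inverse_ofI)
  note f = assms(3) and g = assms(4)
  have f': "f' \<in> hom_set C b a" "cmp C f' f = idn C a" "cmp C f f' = idn C b"
    and g': "g' \<in> hom_set C c b" "cmp C g' g = idn C b" "cmp C g g' = idn C c"
    using assms by (auto simp: inverse_of_def hom_dm_cd)
  show "cmp C g f \<in> hom_set C a c" using f g by (rule cmp_hom)
  show "cmp C f' g' \<in> hom_set C c a" using g'(1) f'(1) by (rule cmp_hom)
  have "cmp C (cmp C f' g') (cmp C g f) = cmp C f' (cmp C (cmp C g' g) f)"
    using cmp_assoc [OF cmp_hom [OF f g] g'(1) f'(1)] cmp_assoc [OF f g g'(1)] by simp
  then show "cmp C (cmp C f' g') (cmp C g f) = idn C a"
    using f f' g' idn_left by simp
  have "cmp C (cmp C g f) (cmp C f' g') = cmp C g (cmp C (cmp C f f') g')"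
    using cmp_assoc [OF cmp_hom [OF g'(1) f'(1)] f g] cmp_assoc [OF g'(1) f'(1) f] by simp
  then show "cmp C (cmp C g f) (cmp C f' g') = idn C c"
    using g f' g' idn_left by simp
qed

lemma prd_id_props:
  assumes "f \<in> hom_set C b' b" "c \<in> Ob C"
  shows prd_id_hom: "prd_id C f c \<in> hom_set C (prd C b' c) (prd C b c)"
    and pr1_prd_id: "cmp C (pr1 C b c) (prd_id C f c) = cmp C f (pr1 C b' c)"
    and pr2_prd_id: "cmp C (pr2 C b c) (prd_id C f c) = pr2 C b' c"
  using pair_props [OF cmp_hom [OF pr1_hom assms(1)] pr2_hom] hom_Ob(1) [OF assms(1)] assms
  by (auto simp: prd_id_def hom_dm_cd)

lemma prd_id_eqI:
  assumes "f \<in> hom_set C b' b" "c \<in> Ob C" "h \<in> hom_set C (prd C b' c) (prd C b c)"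
    and "cmp C (pr1 C b c) h = cmp C f (pr1 C b' c)" "cmp C (pr2 C b c) h = pr2 C b' c"
  shows "prd_id C f c = h"
  using pair_eqI [OF assms(3) _ assms(2,4,5)] assms(1) hom_Ob
  by (auto simp: prd_id_def hom_dm_cd)

lemma prd_id_idn: "b \<in> Ob C \<Longrightarrow> c \<in> Ob C \<Longrightarrow> prd_id C (idn C b) c = idn C (prd C b c)"
  by (rule prd_id_eqI [where b = b]) (auto simp: idn_hom prd_Ob idn_left [OF pr1_hom]
    idn_right [OF pr1_hom] idn_right [OF pr2_hom])

lemma prd_id_cmp:
  assumes f: "f \<in> hom_set C a b" and g: "g \<in> hom_set C b d" and c: "c \<in> Ob C"
  shows "prd_id C (cmp C g f) c = cmp C (prd_id C g c) (prd_id C f c)"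
proof (rule prd_id_eqI)
  note F = prd_id_props [OF f c] and G = prd_id_props [OF g c]
  have ob: "a \<in> Ob C" "b \<in> Ob C" "d \<in> Ob C" using f g hom_Ob by auto
  show "cmp C g f \<in> hom_set C a d" using f g by (rule cmp_hom)
  show "c \<in> Ob C" by fact
  show "cmp C (prd_id C g c) (prd_id C f c) \<in> hom_set C (prd C a c) (prd C d c)"
    using F(1) G(1) by (rule cmp_hom)
  have "cmp C (pr1 C d c) (cmp C (prd_id C g c) (prd_id C f c))
      = cmp C (cmp C g (pr1 C b c)) (prd_id C f c)"
    using cmp_assoc [OF F(1) G(1) pr1_hom] ob c G by simp
  also have "\<dots> = cmp C g (cmp C f (pr1 C a c))"
    using cmp_assoc [OF F(1) pr1_hom g] ob c F by simp
  also have "\<dots> = cmp C (cmp C g f) (pr1 C a c)"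
    using cmp_assoc [OF pr1_hom f g] ob c by simp
  finally show "cmp C (pr1 C d c) (cmp C (prd_id C g c) (prd_id C f c)) = cmp C (cmp C g f) (pr1 C a c)" .
  show "cmp C (pr2 C d c) (cmp C (prd_id C g c) (prd_id C f c)) = pr2 C a c"
    using cmp_assoc [OF F(1) G(1) pr2_hom] ob c F G by simp
qed

text \<open>Multiplication by \<open>c\<close> is functorial by \<open>prd_id_idn\<close> and
  \<open>prd_id_cmp\<close>, hence preserves inverses. This is the induction step for the
  invertibility of \<open>ctx_comparison\<close>.\<close>

lemma inverse_of_prd_id:
  assumes "inverse_of C f g" "f \<in> hom_set C a b" "c \<in> Ob C"
  shows "inverse_of C (prd_id C f c) (prd_id C g c)"
proof -
  have g: "g \<in> hom_set C b a" "cmp C g f = idn C a" "cmp C f g = idn C b"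
    using assms by (auto simp: inverse_of_def hom_dm_cd)
  show ?thesis
    using prd_id_hom [OF assms(2,3)] prd_id_hom [OF g(1) assms(3)]
      prd_id_cmp [OF assms(2) g(1) assms(3)] prd_id_cmp [OF g(1) assms(2,3)]
      prd_id_idn assms hom_Ob [OF assms(2)] g by (intro inverse_ofI) auto
qed

lemma assoc_ar_hom:
  assumes "b \<in> Ob C" "c \<in> Ob C" "d \<in> Ob C"
  shows "assoc_ar C b c d \<in> hom_set C (prd C b (prd C c d)) (prd C (prd C b c) d)"
  unfolding assoc_ar_def Let_def
  using assms by (intro pair_hom cmp_hom [OF pr2_hom] pr1_hom pr2_hom prd_Ob)

end

section \<open>Order, reindexing and monoid structure of the predicates over an object\<close>

context prop_category
begin

lemma Po_El: "c \<in> Ob C \<Longrightarrow> (x, y) \<in> Po C c \<Longrightarrow> x \<in> El C c" "c \<in> Ob C \<Longrightarrow> (x, y) \<in> Po C c \<Longrightarrow> y \<in> El C c"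
  using poset by (auto simp: partial_order_on_def preorder_on_def)

lemma Po_refl: "c \<in> Ob C \<Longrightarrow> x \<in> El C c \<Longrightarrow> (x, x) \<in> Po C c"
  using poset by (auto simp: partial_order_on_def preorder_on_def refl_on_def)

lemma Po_antisym: "c \<in> Ob C \<Longrightarrow> (x, y) \<in> Po C c \<Longrightarrow> (y, x) \<in> Po C c \<Longrightarrow> x = y"
  using poset by (auto simp: partial_order_on_def dest: antisymD)

lemma Po_trans: "c \<in> Ob C \<Longrightarrow> (x, y) \<in> Po C c \<Longrightarrow> (y, z) \<in> Po C c \<Longrightarrow> (x, z) \<in> Po C c"
  using poset by (auto simp: partial_order_on_def preorder_on_def dest: transD)

text \<open>The axioms contain the typing of reindexing only implicitly: it is monotonicity applied
  to the reflexive pair \<open>(x, x)\<close>.\<close>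

lemma reidx_El: "f \<in> hom_set C b c \<Longrightarrow> x \<in> El C c \<Longrightarrow> reidx C f x \<in> El C b"
  using reidx_mono Po_refl Po_El hom_Ob by metis

lemma reidx_inverse:
  assumes "inverse_of C f g" "f \<in> hom_set C b c"
  shows "x \<in> El C c \<Longrightarrow> reidx C g (reidx C f x) = x"
    and "y \<in> El C b \<Longrightarrow> reidx C f (reidx C g y) = y"
proof -
  have g: "g \<in> hom_set C c b" "cmp C g f = idn C b" "cmp C f g = idn C c"
    using assms by (auto simp: inverse_of_def hom_dm_cd)
  show "x \<in> El C c \<Longrightarrow> reidx C g (reidx C f x) = x"
    using reidx_cmp [OF g(1) assms(2)] g reidx_idn hom_Ob(2) [OF assms(2)] by simp
  show "y \<in> El C b \<Longrightarrow> reidx C f (reidx C g y) = y"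
    using reidx_cmp [OF assms(2) g(1)] g reidx_idn hom_Ob(1) [OF assms(2)] by simp
qed

text \<open>Reindexing along the inverse is monotone too, so an isomorphism also reflects the order.
  Satisfaction of sequents is transported this way.\<close>

lemma reidx_iso_Po:
  assumes "is_iso C f" "f \<in> hom_set C b c" "x \<in> El C c" "y \<in> El C c"
  shows "(reidx C f x, reidx C f y) \<in> Po C b \<longleftrightarrow> (x, y) \<in> Po C c"
  using assms reidx_mono reidx_inverse [OF inverse_of_inv_ar] inv_ar_hom by metis

end

context FA
begin

lemma unit_El: "c \<in> Ob C \<Longrightarrow> unit_el La C c \<in> El C c"
  using monoid.one_closed [OF monoid] by fastforce

lemma tensor_El: "c \<in> Ob C \<Longrightarrow> x \<in> El C c \<Longrightarrow> y \<in> El C c \<Longrightarrow> tensor_op La C c x y \<in> El C c"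
  using monoid.m_closed [OF monoid] by fastforce

text \<open>Singletons form a case of their own, here and in later inductions, because
  \<open>list_prod\<close> attaches no unit to a nonempty list.\<close>

lemma list_prod_El:
  "c \<in> Ob C \<Longrightarrow> set xs \<subseteq> El C c \<Longrightarrow> list_prod (unit_el La C c) (tensor_op La C c) xs \<in> El C c"
  by (induction xs rule: induct_list012) (auto simp: unit_El tensor_El)

end

text \<open>Arities appear as lengths of explicit lists in order to match the arity premises of the
  axioms for connectives.\<close>

lemma is_language_conns:
  assumes "is_language small La"
  shows "unit_conn La \<in> conns La (length [])" "tensor_conn La \<in> conns La (length [x, y])"
  using assms by (auto simp: is_language_def numeral_2_eq_2)

context FA
begin

lemma unit_reidx:
  assumes "is_language small La" "f \<in> hom_set C b c"
  shows "reidx C f (unit_el La C c) = unit_el La C b"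
  using conn_reidx [OF assms(2) is_language_conns(1) [OF assms(1)]] by (simp add: unit_el_def)

lemma tensor_reidx:
  assumes "is_language small La" "f \<in> hom_set C b c" "x \<in> El C c" "y \<in> El C c"
  shows "reidx C f (tensor_op La C c x y) = tensor_op La C b (reidx C f x) (reidx C f y)"
  using conn_reidx [OF assms(2) is_language_conns(2) [OF assms(1)]] assms(3,4)
  by (simp add: tensor_op_def)

lemma list_prod_reidx:
  assumes "is_language small La" "f \<in> hom_set C b c" "set xs \<subseteq> El C c"
  shows "reidx C f (list_prod (unit_el La C c) (tensor_op La C c) xs) =
    list_prod (unit_el La C b) (tensor_op La C b) (map (reidx C f) xs)"
  using assms(3)
proof (induction xs rule: induct_list012)
  case (3 x y zs)
  then have "list_prod (unit_el La C c) (tensor_op La C c) (y # zs) \<in> El C c"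
    using list_prod_El hom_Ob [OF assms(2)] by simp
  then show ?case
    using tensor_reidx [OF assms(1,2)] 3 by simp
qed (simp_all add: unit_reidx [OF assms(1,2)])

end


section \<open>Morphisms\<close>

context FA_morphism
begin

lemma ob_map_Ob: "c \<in> Ob (src F) \<Longrightarrow> ob_map F c \<in> Ob (tgt F)"
  using ob_map by auto

lemma el_map_El: "c \<in> Ob (src F) \<Longrightarrow> x \<in> El (src F) c \<Longrightarrow> el_map F c x \<in> El (tgt F) (ob_map F c)"
  using el_map by (auto simp: PiE_iff)

lemma comparison_props:
  assumes "b \<in> Ob (src F)" "c \<in> Ob (src F)"
  shows comparison_hom: "comparison F b c \<in> hom_set (tgt F) (ob_map F (prd (src F) b c))
      (prd (tgt F) (ob_map F b) (ob_map F c))"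
    and pr1_comparison: "cmp (tgt F) (pr1 (tgt F) (ob_map F b) (ob_map F c)) (comparison F b c) =
      ar_map F (pr1 (src F) b c)"
    and pr2_comparison: "cmp (tgt F) (pr2 (tgt F) (ob_map F b) (ob_map F c)) (comparison F b c) =
      ar_map F (pr2 (src F) b c)"
  unfolding comparison_def
  using B.pair_props [OF map_hom [OF A.pr1_hom [OF assms]] map_hom [OF A.pr2_hom [OF assms]]] .

text \<open>Pairs need not be sent to pairs, since the target of the image is only isomorphic to a
  product; \<open>comparison\<close> corrects this.\<close>

lemma comparison_pair:
  assumes f: "f \<in> hom_set (src F) a b" and g: "g \<in> hom_set (src F) a c"
  shows "cmp (tgt F) (comparison F b c) (ar_map F (pair (src F) f g)) =
    pair (tgt F) (ar_map F f) (ar_map F g)"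
proof -
  have bc: "b \<in> Ob (src F)" "c \<in> Ob (src F)" using f g A.hom_Ob by auto
  note p = map_hom [OF A.pr1_hom [OF bc]] map_hom [OF A.pr2_hom [OF bc]]
    map_hom [OF A.pair_hom [OF f g]]
  show ?thesis
    unfolding comparison_def B.pair_cmp [OF p]
    using map_cmp [OF A.pair_hom [OF f g] A.pr1_hom [OF bc]]
      map_cmp [OF A.pair_hom [OF f g] A.pr2_hom [OF bc]] A.pair_props [OF f g] by simp
qed

text \<open>As \<open>comparison\<close> is invertible, the value of \<open>F\<close> on an arrow
  into a product is determined by its values on the two components. This yields both the products of
  the image prop-category and the reduction of kernels to single terms.\<close>

lemma map_prd_eqI:
  assumes f: "f \<in> hom_set (src F) a (prd (src F) b c)" and g: "g \<in> hom_set (src F) a (prd (src F) b c)"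
    and bc: "b \<in> Ob (src F)" "c \<in> Ob (src F)"
    and "ar_map F (cmp (src F) (pr1 (src F) b c) f) = ar_map F (cmp (src F) (pr1 (src F) b c) g)"
    and "ar_map F (cmp (src F) (pr2 (src F) b c) f) = ar_map F (cmp (src F) (pr2 (src F) b c) g)"
  shows "ar_map F f = ar_map F g"
proof -
  let ?k = "comparison F b c" and ?D = "tgt F"
  have c: "is_iso ?D ?k" using bc by (rule preserves_prd)
  \<comment> \<open>Both arrows are pairings of their own projections, so
    \<open>comparison_pair\<close> shows that they agree after \<open>comparison\<close>, which is
    then cancelled.\<close>
  have pf: "pair (src F) (cmp (src F) (pr1 (src F) b c) h) (cmp (src F) (pr2 (src F) b c) h) = h"
    if "h \<in> hom_set (src F) a (prd (src F) b c)" for h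
    using A.pair_eqI [OF that bc] by simp
  have e: "cmp ?D ?k (ar_map F f) = cmp ?D ?k (ar_map F g)"
    using comparison_pair [OF A.cmp_hom [OF f A.pr1_hom [OF bc]] A.cmp_hom [OF f A.pr2_hom [OF bc]]]
      comparison_pair [OF A.cmp_hom [OF g A.pr1_hom [OF bc]] A.cmp_hom [OF g A.pr2_hom [OF bc]]]
      assms(5,6) pf [OF f] pf [OF g] by simp
  have "h = cmp ?D (inv_ar ?D ?k) (cmp ?D ?k h)"
    if "h \<in> hom_set ?D (ob_map F a) (ob_map F (prd (src F) b c))" for h
    using B.cmp_assoc [OF that comparison_hom [OF bc] B.inv_ar_hom [OF c comparison_hom [OF bc]]]
      B.inv_ar_left [OF c comparison_hom [OF bc]] B.idn_left that by simp
  then show ?thesis using e map_hom f g by metis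
qed

lemma map_unit:
  assumes "is_language small La" "c \<in> Ob (src F)"
  shows "el_map F c (unit_el La (src F) c) = unit_el La (tgt F) (ob_map F c)"
  using map_conn [OF assms(2) is_language_conns(1) [OF assms(1)]] by (simp add: unit_el_def)

lemma map_tensor:
  assumes "is_language small La" "c \<in> Ob (src F)" "x \<in> El (src F) c" "y \<in> El (src F) c"
  shows "el_map F c (tensor_op La (src F) c x y) =
    tensor_op La (tgt F) (ob_map F c) (el_map F c x) (el_map F c y)"
  using map_conn [OF assms(2) is_language_conns(2) [OF assms(1)]] assms(3,4)
  by (simp add: tensor_op_def)

lemma map_list_prod:
  assumes "is_language small La" "c \<in> Ob (src F)" "set xs \<subseteq> El (src F) c"
  shows "el_map F c (list_prod (unit_el La (src F) c) (tensor_op La (src F) c) xs) =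
    list_prod (unit_el La (tgt F) (ob_map F c)) (tensor_op La (tgt F) (ob_map F c))
      (map (el_map F c) xs)"
  using assms(3)
proof (induction xs rule: induct_list012)
  case (3 x y zs)
  then have "list_prod (unit_el La (src F) c) (tensor_op La (src F) c) (y # zs) \<in> El (src F) c"
    using A.list_prod_El assms(2) by simp
  then show ?case
    using map_tensor [OF assms(1,2)] 3 by simp
qed (simp_all add: map_unit [OF assms(1,2)])

lemma map_inverse_of:
  assumes "inverse_of (src F) f g" "f \<in> hom_set (src F) a b"
  shows "inverse_of (tgt F) (ar_map F f) (ar_map F g)"
proof -
  have g: "g \<in> hom_set (src F) b a" "cmp (src F) g f = idn (src F) a" "cmp (src F) f g = idn (src F) b"
    using assms by (auto simp: inverse_of_def A.hom_dm_cd)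
  show ?thesis
    using map_hom [OF assms(2)] map_hom [OF g(1)] map_cmp [OF assms(2) g(1)] map_cmp [OF g(1) assms(2)]
      map_idn A.hom_Ob [OF assms(2)] g by (intro B.inverse_ofI) auto
qed

end

section \<open>Composition of morphisms\<close>

lemma comp_morphism_sel [simp]:
  "src (comp_morphism H F) = src F" "tgt (comp_morphism H F) = tgt H"
  "c \<in> Ob (src F) \<Longrightarrow> ob_map (comp_morphism H F) c = ob_map H (ob_map F c)"
  "f \<in> Ar (src F) \<Longrightarrow> ar_map (comp_morphism H F) f = ar_map H (ar_map F f)"
  "c \<in> Ob (src F) \<Longrightarrow> x \<in> El (src F) c \<Longrightarrow>
    el_map (comp_morphism H F) c x = el_map H (ob_map F c) (el_map F c x)"
  by (simp_all add: comp_morphism_def compose_def)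

text \<open>The comparison of the composite pairs two arrows under \<open>H\<close>;
  \<open>comparison_pair\<close> for \<open>H\<close> trades this for the image of their pairing in
  the middle, which is \<open>comparison F\<close>.\<close>

lemma comparison_comp_morphism:
  assumes F: "FA_morphism La F" and H: "FA_morphism La H" and s: "src H = tgt F"
    and bc: "b \<in> Ob (src F)" "c \<in> Ob (src F)"
  shows "comparison (comp_morphism H F) b c =
    cmp (tgt H) (comparison H (ob_map F b) (ob_map F c)) (ar_map H (comparison F b c))"
proof -
  interpret F: FA_morphism La F by fact
  interpret H: FA_morphism La H by fact
  show ?thesis
    using H.comparison_pair [unfolded s, OF F.map_hom [OF F.A.pr1_hom [OF bc]]
        F.map_hom [OF F.A.pr2_hom [OF bc]]]
      F.A.hom_Ar [OF F.A.pr1_hom [OF bc]] F.A.hom_Ar [OF F.A.pr2_hom [OF bc]]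
    by (simp add: comparison_def)
qed

lemma FA_morphism_comp:
  assumes F: "FA_morphism La F" and H: "FA_morphism La H" and s: "src H = tgt F"
  shows "FA_morphism La (comp_morphism H F)"
proof -
  interpret F: FA_morphism La F by fact
  interpret H: FA_morphism La H by fact
  let ?K = "comp_morphism H F"
  \<comment> \<open>An explicit inverse is recorded, not just invertibility: by uniqueness it
    evaluates \<open>inv_ar\<close> of the composite comparison in the quantifier axiom.\<close>
  have k: "inverse_of (tgt H) (comparison ?K b c)
      (cmp (tgt H) (ar_map H (inv_ar (tgt F) (comparison F b c)))
        (inv_ar (tgt H) (comparison H (ob_map F b) (ob_map F c))))"
    if "b \<in> Ob (src F)" "c \<in> Ob (src F)" for b c
    unfolding comparison_comp_morphism [OF F H s that]
    using H.map_inverse_of [unfolded s, OF F.B.inverse_of_inv_ar [OF F.preserves_prd [OF that]]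
        F.comparison_hom [OF that]]
      H.B.inverse_of_inv_ar [OF H.preserves_prd [unfolded s, OF F.ob_map_Ob F.ob_map_Ob, OF that]]
      H.map_hom [unfolded s, OF F.comparison_hom [OF that]]
      H.comparison_hom [unfolded s, OF F.ob_map_Ob F.ob_map_Ob, OF that]
    by (rule H.B.inverse_of_cmp)
  show ?thesis
  proof (intro FA_morphism.intro FA_morphism_axioms.intro; (simp only: comp_morphism_sel(1,2))?)
    show "FA (src F) La" "FA (tgt H) La" by unfold_locales
    show "ob_map ?K \<in> Ob (src F) \<rightarrow>\<^sub>E Ob (tgt H)"
      using F.ob_map_Ob H.ob_map_Ob s by (auto simp: comp_morphism_def compose_def)
    show "ar_map ?K \<in> Ar (src F) \<rightarrow>\<^sub>E Ar (tgt H)"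
      using F.ar_map H.ar_map s by (auto simp: comp_morphism_def compose_def)
    show "el_map ?K \<in> (\<Pi>\<^sub>E c\<in>Ob (src F). El (src F) c \<rightarrow>\<^sub>E El (tgt H) (ob_map ?K c))"
      using F.el_map_El H.el_map_El F.ob_map_Ob s
      by (auto simp: comp_morphism_def compose_def restrict_def PiE_iff extensional_def)
    show "ar_map ?K f \<in> hom_set (tgt H) (ob_map ?K b) (ob_map ?K c)"
      if "f \<in> hom_set (src F) b c" for f b c
      using that F.map_hom H.map_hom s F.A.hom_Ob F.A.hom_Ar by auto
    show "ar_map ?K (idn (src F) c) = idn (tgt H) (ob_map ?K c)" if "c \<in> Ob (src F)" for c
      using that F.map_idn H.map_idn s F.ob_map_Ob F.A.hom_Ar [OF F.A.idn_hom] by auto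
    show "ar_map ?K (cmp (src F) g f) = cmp (tgt H) (ar_map ?K g) (ar_map ?K f)"
      if "f \<in> hom_set (src F) a b" "g \<in> hom_set (src F) b c" for f g a b c
      using F.map_cmp [OF that] H.map_cmp [unfolded s, OF F.map_hom F.map_hom, OF that]
        F.A.hom_Ar [OF F.A.cmp_hom [OF that]] F.A.hom_Ar that by auto
    show "is_iso (tgt H) (bang (tgt H) (ob_map ?K (top_ob (src F))))"
    proof -
      let ?f = "bang (tgt F) (ob_map F (top_ob (src F)))" and ?g = "bang (tgt H) (ob_map H (top_ob (tgt F)))"
      have f: "?f \<in> hom_set (tgt F) (ob_map F (top_ob (src F))) (top_ob (tgt F))"
        and g: "?g \<in> hom_set (tgt H) (ob_map H (top_ob (tgt F))) (top_ob (tgt H))"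
        using F.B.bang_hom H.B.bang_hom F.ob_map_Ob H.ob_map_Ob F.A.top_Ob F.B.top_Ob s by auto
      note Hf = H.map_hom [unfolded s, OF f]
      \<comment> \<open>Arrows into the terminal object agree, and the right-hand side is visibly a
        composite of isomorphisms.\<close>
      have "bang (tgt H) (ob_map ?K (top_ob (src F))) = cmp (tgt H) ?g (ar_map H ?f)"
        using H.B.bang_eqI H.B.cmp_hom [OF Hf g] F.A.top_Ob by simp
      moreover have "inverse_of (tgt H) (cmp (tgt H) ?g (ar_map H ?f))
          (cmp (tgt H) (ar_map H (inv_ar (tgt F) ?f)) (inv_ar (tgt H) ?g))"
        using H.B.inverse_of_cmp [OF H.map_inverse_of [unfolded s, OF F.B.inverse_of_inv_ar f]
            H.B.inverse_of_inv_ar Hf g] F.preserves_top H.preserves_top s by simp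
      ultimately show ?thesis by (auto simp: is_iso_def)
    qed
    show "is_iso (tgt H) (comparison ?K b c)" if "b \<in> Ob (src F)" "c \<in> Ob (src F)" for b c
      using k [OF that] by (auto simp: is_iso_def)
    show "(el_map ?K c x, el_map ?K c y) \<in> Po (tgt H) (ob_map ?K c)"
      if "c \<in> Ob (src F)" "(x, y) \<in> Po (src F) c" for c x y
      using that F.map_mono H.map_mono s F.ob_map_Ob F.A.Po_El by auto
    show "el_map ?K b (reidx (src F) f x) = reidx (tgt H) (ar_map ?K f) (el_map ?K c x)"
      if "f \<in> hom_set (src F) b c" "x \<in> El (src F) c" for f b c x
      using F.map_reidx [OF that] H.map_reidx [unfolded s, OF F.map_hom F.el_map_El, OF that(1) _ that(2)]
        F.A.hom_Ob [OF that(1)] F.A.hom_Ar [OF that(1)] F.A.reidx_El [OF that] that by simp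
    show "el_map ?K c (conn_op (src F) c k xs) = conn_op (tgt H) (ob_map ?K c) k (map (el_map ?K c) xs)"
      if "c \<in> Ob (src F)" "k \<in> conns La (length xs)" "set xs \<subseteq> El (src F) c" for c k xs
    proof -
      have "set (map (el_map F c) xs) \<subseteq> El (tgt F) (ob_map F c)"
        using that F.el_map_El by auto
      moreover have "map (el_map ?K c) xs = map (el_map H (ob_map F c)) (map (el_map F c) xs)"
        using that by auto
      ultimately show ?thesis
        using F.map_conn [OF that] F.A.conn_El [OF that] that F.ob_map_Ob
          H.map_conn [unfolded s, of "ob_map F c" k "map (el_map F c) xs"]
        by (simp add: comp_def cong: map_cong)
    qed
    show "el_map ?K b (quant_op (src F) \<omega> b c x) = quant_op (tgt H) \<omega> (ob_map ?K b) (ob_map ?K c)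
        (reidx (tgt H) (inv_ar (tgt H) (comparison ?K b c)) (el_map ?K (prd (src F) b c) x))"
      if "\<omega> \<in> quants La" "b \<in> Ob (src F)" "c \<in> Ob (src F)" "x \<in> El (src F) (prd (src F) b c)"
      for \<omega> b c x
    proof -
      note bc = that(2,3) and Fbc = F.ob_map_Ob [OF that(2)] F.ob_map_Ob [OF that(3)]
      let ?i = "inv_ar (tgt F) (comparison F b c)"
        and ?j = "inv_ar (tgt H) (comparison H (ob_map F b) (ob_map F c))"
      have i: "?i \<in> hom_set (tgt F) (prd (tgt F) (ob_map F b) (ob_map F c)) (ob_map F (prd (src F) b c))"
        by (rule F.B.inv_ar_hom [OF F.preserves_prd [OF bc] F.comparison_hom [OF bc]])
      have j: "?j \<in> hom_set (tgt H) (prd (tgt H) (ob_map H (ob_map F b)) (ob_map H (ob_map F c)))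
          (ob_map H (prd (tgt F) (ob_map F b) (ob_map F c)))"
        by (rule H.B.inv_ar_hom [OF H.preserves_prd [unfolded s, OF Fbc]
              H.comparison_hom [unfolded s, OF Fbc]])
      have x: "el_map F (prd (src F) b c) x \<in> El (tgt F) (ob_map F (prd (src F) b c))"
        using F.el_map_El F.A.prd_Ob that by blast
      \<comment> \<open>The quantifier axiom of \<open>H\<close> contributes the reindexing along
        \<open>?j\<close>, naturality of \<open>H\<close> moves past the one along
        \<open>?i\<close>, and functoriality of \<open>reidx\<close> merges the two.\<close>
      have "el_map H (ob_map F b) (quant_op (tgt F) \<omega> (ob_map F b) (ob_map F c)
            (reidx (tgt F) ?i (el_map F (prd (src F) b c) x))) =
          quant_op (tgt H) \<omega> (ob_map H (ob_map F b)) (ob_map H (ob_map F c))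
            (reidx (tgt H) (cmp (tgt H) (ar_map H ?i) ?j)
              (el_map H (ob_map F (prd (src F) b c)) (el_map F (prd (src F) b c) x)))"
        using H.map_quant [unfolded s, OF that(1) Fbc F.B.reidx_El [OF i x]]
          H.map_reidx [unfolded s, OF i x] H.B.reidx_cmp [OF j H.map_hom [unfolded s, OF i]]
          H.el_map_El [unfolded s, OF F.B.hom_Ob(2) [OF i] x] by simp
      then show ?thesis
        using F.map_quant [OF that] F.A.quant_El [OF that] F.A.prd_Ob [OF bc] bc that(4)
          H.B.inv_ar_eqI [OF k [OF bc]] by simp
    qed
    show "el_map ?K (prd (src F) c c) (eq_el (src F) c) =
        reidx (tgt H) (comparison ?K c c) (eq_el (tgt H) (ob_map ?K c))" if c: "c \<in> Ob (src F)" for c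
    proof -
      note Fc = F.ob_map_Ob [OF c]
      note k = F.comparison_hom [OF c c] and Hk = H.comparison_hom [unfolded s, OF Fc Fc]
      show ?thesis
        using F.map_eq [OF c] H.map_eq [unfolded s, OF Fc] H.map_reidx [unfolded s, OF k F.B.eq_El [OF Fc]]
          F.A.prd_Ob [OF c c] F.A.eq_El [OF c] c
          comparison_comp_morphism [OF F H s c c]
          H.B.reidx_cmp [OF H.map_hom [unfolded s, OF k] Hk H.B.eq_El [OF H.ob_map_Ob [unfolded s, OF Fc]]]
        by simp
    qed
  qed
qed


section \<open>Structures\<close>

lemma ctx_ob_Nil [simp]: "ctx_ob C M [] = top_ob C"
  by (simp add: ctx_ob_def)

lemma ctx_ob_snoc [simp]: "ctx_ob C M (\<Gamma> @ [\<sigma>]) = prd C (ctx_ob C M \<Gamma>) (sort_ob M \<sigma>)"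
  by (simp add: ctx_ob_def)

text \<open>\<open>rev_proj\<close> recurses on the reversed context; in this form the recursion
  removes the last variable of the context itself and fits reverse induction.\<close>

lemma tm_ar_Var_snoc:
  "tm_ar C M (\<Gamma> @ [\<sigma>]) (Var i) = (if i = length \<Gamma> then pr2 C (ctx_ob C M \<Gamma>) (sort_ob M \<sigma>)
    else cmp C (tm_ar C M \<Gamma> (Var i)) (pr1 C (ctx_ob C M \<Gamma>) (sort_ob M \<sigma>)))"
  by simp

lemma tuple_ar_Nil [simp]: "tuple_ar C b [] = bang C b"
  by (simp add: tuple_ar_def)

lemma tuple_ar_snoc [simp]: "tuple_ar C b (fs @ [f]) = pair C (tuple_ar C b fs) f"
  by (simp add: tuple_ar_def)

lemma is_ctx_snoc [simp]: "is_ctx Sg (\<Gamma> @ [\<sigma>]) \<longleftrightarrow> is_ctx Sg \<Gamma> \<and> \<sigma> \<in> sorts Sg"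
  by (auto simp: is_ctx_def)

lemma is_ctx_Nil [simp]: "is_ctx Sg []"
  by (simp add: is_ctx_def)

lemma list_all2_snoc_cases:
  assumes "list_all2 P xs (ys @ [y])"
  obtains xs' x where "xs = xs' @ [x]" "list_all2 P xs' ys" "P x y"
  using assms by (auto simp: list_all2_append2 list_all2_Cons2)

context fp_category
begin

lemma ctx_ob_Ob: "is_structure Sg C M \<Longrightarrow> is_ctx Sg \<Gamma> \<Longrightarrow> ctx_ob C M \<Gamma> \<in> Ob C"
  by (induction \<Gamma> rule: rev_induct) (auto simp: top_Ob is_structure_def intro!: prd_Ob)

lemma tm_ar_Var_hom:
  "is_structure Sg C M \<Longrightarrow> is_ctx Sg \<Gamma> \<Longrightarrow> i < length \<Gamma> \<Longrightarrow>
    tm_ar C M \<Gamma> (Var i) \<in> hom_set C (ctx_ob C M \<Gamma>) (sort_ob M (\<Gamma> ! i))"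
proof (induction \<Gamma> rule: rev_induct)
  case (snoc \<sigma> \<Gamma>)
  then have ob: "ctx_ob C M \<Gamma> \<in> Ob C" "sort_ob M \<sigma> \<in> Ob C"
    using ctx_ob_Ob by (auto simp: is_structure_def)
  show ?case
  proof (cases "i = length \<Gamma>")
    case True
    then show ?thesis unfolding tm_ar_Var_snoc using pr2_hom [OF ob] by simp
  next
    case False
    then have "tm_ar C M \<Gamma> (Var i) \<in> hom_set C (ctx_ob C M \<Gamma>) (sort_ob M (\<Gamma> ! i))"
      using snoc by (simp add: less_Suc_eq)
    with False snoc.prems show ?thesis
      unfolding tm_ar_Var_snoc using cmp_hom [OF pr1_hom [OF ob]] by (simp add: nth_append)
  qed
qed simp

lemma tuple_ar_hom:
  "b \<in> Ob C \<Longrightarrow> list_all2 (\<lambda>f \<sigma>. f \<in> hom_set C b (sort_ob M \<sigma>)) fs \<sigma>s \<Longrightarrow>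
    tuple_ar C b fs \<in> hom_set C b (ctx_ob C M \<sigma>s)"
proof (induction \<sigma>s arbitrary: fs rule: rev_induct)
  case (snoc \<sigma> \<sigma>s)
  from snoc.prems(2) show ?case
    by (rule list_all2_snoc_cases) (simp add: pair_hom snoc.IH [OF snoc.prems(1)])
qed (simp add: bang_hom)

text \<open>Precomposition passes through each pairing; at the empty tuple, uniqueness of arrows
  into the terminal object takes over. The structure only names the codomains, through
  \<open>sort_ob\<close>.\<close>

lemma tuple_ar_cmp:
  fixes M :: "('o, 'a, 'p, 'u) structure"
  assumes "h \<in> hom_set C z b"
  shows "list_all2 (\<lambda>f \<sigma>. f \<in> hom_set C b (sort_ob M \<sigma>)) fs \<sigma>s \<Longrightarrow>
    cmp C (tuple_ar C b fs) h = tuple_ar C z (map (\<lambda>f. cmp C f h) fs)"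
proof (induction \<sigma>s arbitrary: fs rule: rev_induct)
  case Nil
  then show ?case using bang_eqI cmp_hom [OF assms bang_hom] hom_Ob [OF assms] by simp
next
  case (snoc \<sigma> \<sigma>s)
  from snoc.prems show ?case
  proof (rule list_all2_snoc_cases)
    fix fs' f assume "fs = fs' @ [f]" "f \<in> hom_set C b (sort_ob M \<sigma>)"
      and fs': "list_all2 (\<lambda>f \<sigma>. f \<in> hom_set C b (sort_ob M \<sigma>)) fs' \<sigma>s"
    then show ?thesis
      using pair_cmp [OF tuple_ar_hom [OF _ fs'] _ assms] snoc.IH [OF fs'] hom_Ob [OF assms] by simp
  qed
qed

lemma tm_ar_hom:
  assumes Sg: "is_signature Sg" and M: "is_structure Sg C M" and \<Gamma>: "is_ctx Sg \<Gamma>"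
  shows "is_tm Sg \<Gamma> t \<tau> \<Longrightarrow> tm_ar C M \<Gamma> t \<in> hom_set C (ctx_ob C M \<Gamma>) (sort_ob M \<tau>)"
proof (induction rule: is_tm.induct)
  case (var i)
  then show ?case using tm_ar_Var_hom [OF M \<Gamma>] by blast
next
  case ("fun" f \<sigma>s \<tau> Ms)
  have "list_all2 (\<lambda>g \<sigma>. g \<in> hom_set C (ctx_ob C M \<Gamma>) (sort_ob M \<sigma>)) (map (tm_ar C M \<Gamma>) Ms) \<sigma>s"
    using "fun"(2) by (auto simp: list_all2_map1 elim: list_all2_mono)
  then have t: "tuple_ar C (ctx_ob C M \<Gamma>) (map (tm_ar C M \<Gamma>) Ms)
      \<in> hom_set C (ctx_ob C M \<Gamma>) (ctx_ob C M \<sigma>s)"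
    by (rule tuple_ar_hom [OF ctx_ob_Ob [OF M \<Gamma>]])
  have "fun_ar M f \<in> hom_set C (ctx_ob C M \<sigma>s) (sort_ob M \<tau>)"
    using M "fun"(1) by (simp add: is_structure_def)
  from cmp_hom [OF t this] show ?case by simp
qed

lemma tms_ar_hom:
  assumes "is_signature Sg" "is_structure Sg C M" "is_ctx Sg \<Gamma>" "list_all2 (is_tm Sg \<Gamma>) Ms \<sigma>s"
  shows "list_all2 (\<lambda>g \<sigma>. g \<in> hom_set C (ctx_ob C M \<Gamma>) (sort_ob M \<sigma>)) (map (tm_ar C M \<Gamma>) Ms) \<sigma>s"
  using assms(4) tm_ar_hom [OF assms(1,2,3)] by (auto simp: list_all2_map1 elim: list_all2_mono)

lemma prd_id_pair:
  assumes "f \<in> hom_set C b b'" "g \<in> hom_set C a b" "h \<in> hom_set C a c"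
  shows "cmp C (prd_id C f c) (pair C g h) = pair C (cmp C f g) h"
proof (rule pair_eqI [symmetric])
  have ob: "b \<in> Ob C" "b' \<in> Ob C" "c \<in> Ob C" using assms hom_Ob by auto
  note p = prd_id_props [OF assms(1) ob(3)] and q = pair_props [OF assms(2,3)]
  show "b' \<in> Ob C" "c \<in> Ob C" by fact+
  show "cmp C (prd_id C f c) (pair C g h) \<in> hom_set C a (prd C b' c)"
    using q(1) p(1) by (rule cmp_hom)
  show "cmp C (pr1 C b' c) (cmp C (prd_id C f c) (pair C g h)) = cmp C f g"
    using cmp_assoc [OF q(1) p(1) pr1_hom] cmp_assoc [OF q(1) pr1_hom assms(1)] p q ob by simp
  show "cmp C (pr2 C b' c) (cmp C (prd_id C f c) (pair C g h)) = h"
    using cmp_assoc [OF q(1) p(1) pr2_hom] p q ob by simp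
qed

end

lemma (in FA) fm_el_El:
  assumes Sg: "is_signature Sg" and M: "is_structure Sg C M"
  shows "is_fm La Sg \<Gamma> \<phi> \<Longrightarrow> is_ctx Sg \<Gamma> \<Longrightarrow> fm_el C M \<phi> \<Gamma> \<in> El C (ctx_ob C M \<Gamma>)"
proof (induction rule: is_fm.induct)
  case (rel r \<sigma>s \<Gamma> Ms)
  show ?case
    using rel M reidx_El [OF tuple_ar_hom [OF ctx_ob_Ob [OF M rel(3)] tms_ar_hom [OF Sg M rel(3,2)]]]
    by (auto simp: is_structure_def)
next
  case (equ \<sigma> \<Gamma> M1 M2)
  have "sort_ob M \<sigma> \<in> Ob C" using M equ(1) by (simp add: is_structure_def)
  then show ?case
    using reidx_El [OF pair_hom [OF tm_ar_hom [OF Sg M equ(4,2)] tm_ar_hom [OF Sg M equ(4,3)]] eq_El]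
    by simp
next
  case (conn k \<phi>s \<Gamma>)
  then show ?case
    using conn_El [OF ctx_ob_Ob [OF M], of \<Gamma> k "map (\<lambda>\<phi>. fm_el C M \<phi> \<Gamma>) \<phi>s"] by auto
next
  case (quant \<omega> \<sigma> \<Gamma> \<phi>)
  then show ?case
    using quant_El [OF quant(1) ctx_ob_Ob [OF M]] M by (simp add: is_structure_def)
qed


section \<open>Images of structures under morphisms\<close>

text \<open>This iterates \<open>comparison\<close> along a context, from the image of its
  interpretation to the product of the images of its sorts: the last sort is split off first and the
  rest is compared under \<open>prd_id\<close>. Contexts nest to the left and grow at the end, hence
  the reversed list.\<close>

primrec rev_ctx_comparison ::
  "('o, 'a, 'p, 'o2, 'a2, 'p2, 'u) morphism \<Rightarrow> ('o, 'a, 'p, 'u) structure \<Rightarrow> 'u ctx \<Rightarrow> 'a2" where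
  "rev_ctx_comparison F M [] = bang (tgt F) (ob_map F (top_ob (src F)))"
| "rev_ctx_comparison F M (\<sigma> # \<Gamma>) = cmp (tgt F)
     (prd_id (tgt F) (rev_ctx_comparison F M \<Gamma>) (ob_map F (sort_ob M \<sigma>)))
     (comparison F (ctx_ob (src F) M (rev \<Gamma>)) (sort_ob M \<sigma>))"

definition ctx_comparison where
  "ctx_comparison F M \<Gamma> = rev_ctx_comparison F M (rev \<Gamma>)"

lemma ctx_comparison_simps [simp]:
  "ctx_comparison F M [] = bang (tgt F) (ob_map F (top_ob (src F)))"
  "ctx_comparison F M (\<Gamma> @ [\<sigma>]) = cmp (tgt F)
     (prd_id (tgt F) (ctx_comparison F M \<Gamma>) (ob_map F (sort_ob M \<sigma>)))
     (comparison F (ctx_ob (src F) M \<Gamma>) (sort_ob M \<sigma>))"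
  by (simp_all add: ctx_comparison_def)

text \<open>Function and relation symbols must live over a product of images of sorts, whereas
  \<open>F\<close> yields the image of a product; the inverse of \<open>ctx_comparison\<close>
  mediates. The \<open>the\<close> is meaningful on the symbols of \<open>Sg\<close>, to which all
  later statements are restricted.\<close>

definition image_structure :: "'u signature \<Rightarrow> ('o, 'a, 'p, 'o2, 'a2, 'p2, 'u) morphism \<Rightarrow>
    ('o, 'a, 'p, 'u) structure \<Rightarrow> ('o2, 'a2, 'p2, 'u) structure" where
  "image_structure Sg F M =
     \<lparr>sort_ob = (\<lambda>\<sigma>. ob_map F (sort_ob M \<sigma>)),
      fun_ar = (\<lambda>f. cmp (tgt F) (ar_map F (fun_ar M f))
        (inv_ar (tgt F) (ctx_comparison F M (fst (the (funs Sg f)))))),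
      rel_el = (\<lambda>r. reidx (tgt F) (inv_ar (tgt F) (ctx_comparison F M (the (rels Sg r))))
        (el_map F (ctx_ob (src F) M (the (rels Sg r))) (rel_el M r)))\<rparr>"

locale structure_image = FA_morphism La F
  for La :: "'u language" and F :: "('o, 'a, 'p, 'o2, 'a2, 'p2, 'u) morphism" +
  fixes small :: "'u set \<Rightarrow> bool" and Sg :: "'u signature" and M :: "('o, 'a, 'p, 'u) structure"
  assumes language: "is_language small La" and signature: "is_signature Sg"
    and M: "is_structure Sg (src F) M"
begin

abbreviation "N \<equiv> image_structure Sg F M"

abbreviation "\<theta> \<equiv> ctx_comparison F M"

lemma sort_ob_N [simp]: "sort_ob N \<sigma> = ob_map F (sort_ob M \<sigma>)"
  by (simp add: image_structure_def)

lemma sort_Ob: "\<sigma> \<in> sorts Sg \<Longrightarrow> sort_ob M \<sigma> \<in> Ob (src F)"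
  using M by (simp add: is_structure_def)

lemma \<theta>_iso:
  "is_ctx Sg \<Gamma> \<Longrightarrow> \<theta> \<Gamma> \<in> hom_set (tgt F) (ob_map F (ctx_ob (src F) M \<Gamma>)) (ctx_ob (tgt F) N \<Gamma>) \<and>
    is_iso (tgt F) (\<theta> \<Gamma>)"
proof (induction \<Gamma> rule: rev_induct)
  case Nil
  then show ?case using B.bang_hom ob_map_Ob A.top_Ob preserves_top by simp
next
  case (snoc \<sigma> \<Gamma>)
  let ?s = "sort_ob M \<sigma>" and ?c = "ctx_ob (src F) M \<Gamma>"
  have ob: "?c \<in> Ob (src F)" "?s \<in> Ob (src F)"
    using snoc.prems A.ctx_ob_Ob [OF M] sort_Ob by auto
  have \<theta>: "\<theta> \<Gamma> \<in> hom_set (tgt F) (ob_map F ?c) (ctx_ob (tgt F) N \<Gamma>)" "is_iso (tgt F) (\<theta> \<Gamma>)"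
    using snoc by auto
  note k = comparison_hom [OF ob] and p = B.prd_id_hom [OF \<theta>(1) ob_map_Ob [OF ob(2)]]
  have "is_iso (tgt F) (cmp (tgt F) (prd_id (tgt F) (\<theta> \<Gamma>) (ob_map F ?s)) (comparison F ?c ?s))"
    using B.inverse_of_cmp [OF B.inverse_of_inv_ar [OF preserves_prd [OF ob]]
        B.inverse_of_prd_id [OF B.inverse_of_inv_ar [OF \<theta>(2)] \<theta>(1) ob_map_Ob [OF ob(2)]] k p]
    by (auto simp: is_iso_def)
  then show ?case using B.cmp_hom [OF k p] by simp
qed

lemmas \<theta>_hom = \<theta>_iso [THEN conjunct1] and \<theta>_is_iso = \<theta>_iso [THEN conjunct2]

lemma ctx_Ob: "is_ctx Sg \<Gamma> \<Longrightarrow> ctx_ob (tgt F) N \<Gamma> \<in> Ob (tgt F)"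
  by (rule B.hom_Ob(2) [OF \<theta>_hom])

lemma funs_ctx: "funs Sg f = Some (\<sigma>s, \<tau>) \<Longrightarrow> is_ctx Sg \<sigma>s" "funs Sg f = Some (\<sigma>s, \<tau>) \<Longrightarrow> \<tau> \<in> sorts Sg"
  and rels_ctx: "rels Sg r = Some \<sigma>s \<Longrightarrow> is_ctx Sg \<sigma>s"
  using signature by (auto simp: is_signature_def is_ctx_def)

lemma inv_\<theta>_hom:
  "is_ctx Sg \<Gamma> \<Longrightarrow> inv_ar (tgt F) (\<theta> \<Gamma>) \<in> hom_set (tgt F) (ctx_ob (tgt F) N \<Gamma>) (ob_map F (ctx_ob (src F) M \<Gamma>))"
  by (rule B.inv_ar_hom [OF \<theta>_is_iso \<theta>_hom])

lemma fun_ar_hom: "funs Sg f = Some (\<sigma>s, \<tau>) \<Longrightarrow>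
    ar_map F (fun_ar M f) \<in> hom_set (tgt F) (ob_map F (ctx_ob (src F) M \<sigma>s)) (ob_map F (sort_ob M \<tau>))"
  using M by (intro map_hom) (simp add: is_structure_def)

lemma rel_el_El: "rels Sg r = Some \<sigma>s \<Longrightarrow>
    el_map F (ctx_ob (src F) M \<sigma>s) (rel_el M r) \<in> El (tgt F) (ob_map F (ctx_ob (src F) M \<sigma>s))"
  using M rels_ctx by (intro el_map_El A.ctx_ob_Ob [OF M]) (simp_all add: is_structure_def)

lemma N_structure: "is_structure Sg (tgt F) N"
  unfolding is_structure_def
proof (intro conjI ballI allI impI)
  show "fun_ar N f \<in> hom_set (tgt F) (ctx_ob (tgt F) N \<sigma>s) (sort_ob N \<tau>)"
    if "funs Sg f = Some (\<sigma>s, \<tau>)" for f \<sigma>s \<tau>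
    using B.cmp_hom [OF inv_\<theta>_hom fun_ar_hom, OF funs_ctx(1) that, OF that] that
    by (simp add: image_structure_def)
  show "rel_el N r \<in> El (tgt F) (ctx_ob (tgt F) N \<sigma>s)" if "rels Sg r = Some \<sigma>s" for r \<sigma>s
    using B.reidx_El [OF inv_\<theta>_hom rel_el_El, OF rels_ctx that, OF that] that
    by (simp add: image_structure_def)
qed (simp add: ob_map_Ob sort_Ob)

text \<open>For a variable other than the last, the first projection crosses \<open>prd_id\<close>
  by \<open>pr1_prd_id\<close> and then \<open>comparison\<close> by \<open>pr1_comparison\<close>,
  which leaves the case of the shorter context.\<close>

lemma Var_\<theta>:
  "is_ctx Sg \<Gamma> \<Longrightarrow> i < length \<Gamma> \<Longrightarrow>
    cmp (tgt F) (tm_ar (tgt F) N \<Gamma> (Var i)) (\<theta> \<Gamma>) = ar_map F (tm_ar (src F) M \<Gamma> (Var i))"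
proof (induction \<Gamma> rule: rev_induct)
  case (snoc \<sigma> \<Gamma>)
  let ?s = "sort_ob M \<sigma>" and ?c = "ctx_ob (src F) M \<Gamma>" and ?D = "tgt F"
  have \<Gamma>: "is_ctx Sg \<Gamma>" and ob: "?c \<in> Ob (src F)" "?s \<in> Ob (src F)"
    using snoc.prems A.ctx_ob_Ob [OF M] sort_Ob by auto
  note k = comparison_props [OF ob] and Fs = ob_map_Ob [OF ob(2)] and t = \<theta>_hom [OF \<Gamma>]
  note p = B.prd_id_props [OF t Fs]
  show ?case
  proof (cases "i = length \<Gamma>")
    case True
    then show ?thesis
      unfolding tm_ar_Var_snoc
      using B.cmp_assoc [OF k(1) p(1) B.pr2_hom [OF ctx_Ob [OF \<Gamma>] Fs]] p k by simp
  next
    case False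
    then have i: "i < length \<Gamma>" using snoc.prems by simp
    let ?v = "tm_ar ?D N \<Gamma> (Var i)" and ?w = "tm_ar (src F) M \<Gamma> (Var i)"
    have v: "?v \<in> hom_set ?D (ctx_ob ?D N \<Gamma>) (ob_map F (sort_ob M (\<Gamma> ! i)))"
      using B.tm_ar_Var_hom [OF N_structure \<Gamma> i] unfolding sort_ob_N .
    have w: "?w \<in> hom_set (src F) ?c (sort_ob M (\<Gamma> ! i))"
      by (rule A.tm_ar_Var_hom [OF M \<Gamma> i])
    note q = B.pr1_hom [OF ctx_Ob [OF \<Gamma>] Fs] and q' = B.pr1_hom [OF ob_map_Ob [OF ob(1)] Fs]
    have "cmp ?D (cmp ?D ?v (pr1 ?D (ctx_ob ?D N \<Gamma>) (ob_map F ?s))) (\<theta> (\<Gamma> @ [\<sigma>])) =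
        cmp ?D ?v (cmp ?D (cmp ?D (pr1 ?D (ctx_ob ?D N \<Gamma>) (ob_map F ?s))
          (prd_id ?D (\<theta> \<Gamma>) (ob_map F ?s))) (comparison F ?c ?s))"
      unfolding ctx_comparison_simps
        B.cmp_assoc [OF B.cmp_hom [OF k(1) p(1)] q v, symmetric] B.cmp_assoc [OF k(1) p(1) q] ..
    also have "\<dots> = cmp ?D ?v (cmp ?D (\<theta> \<Gamma>) (ar_map F (pr1 (src F) ?c ?s)))"
      unfolding p(2) B.cmp_assoc [OF k(1) q' t, symmetric] k(2) ..
    also have "\<dots> = cmp ?D (ar_map F ?w) (ar_map F (pr1 (src F) ?c ?s))"
      unfolding B.cmp_assoc [OF map_hom [OF A.pr1_hom [OF ob]] t v] snoc.IH [OF \<Gamma> i] ..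
    also have "\<dots> = ar_map F (cmp (src F) ?w (pr1 (src F) ?c ?s))"
      by (rule map_cmp [OF A.pr1_hom [OF ob] w, symmetric])
    finally show ?thesis
      unfolding tm_ar_Var_snoc using False by (simp del: tm_ar.simps ctx_comparison_simps)
  qed
qed simp

text \<open>The analogue of \<open>comparison_pair\<close> for tuples of any length: each step
  applies the binary law and pushes \<open>prd_id\<close> into the pairing by
  \<open>prd_id_pair\<close>.\<close>

lemma \<theta>_tuple_ar:
  assumes "b \<in> Ob (src F)"
  shows "list_all2 (\<lambda>f \<sigma>. f \<in> hom_set (src F) b (sort_ob M \<sigma>)) fs \<sigma>s \<Longrightarrow> is_ctx Sg \<sigma>s \<Longrightarrow>
    cmp (tgt F) (\<theta> \<sigma>s) (ar_map F (tuple_ar (src F) b fs)) =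
      tuple_ar (tgt F) (ob_map F b) (map (ar_map F) fs)"
proof (induction \<sigma>s arbitrary: fs rule: rev_induct)
  case Nil
  then show ?case
    using B.bang_eqI [OF B.cmp_hom [OF map_hom [OF A.bang_hom [OF assms]]
      B.bang_hom [OF ob_map_Ob [OF A.top_Ob]]]] by simp
next
  case (snoc \<sigma> \<sigma>s)
  let ?s = "sort_ob M \<sigma>" and ?c = "ctx_ob (src F) M \<sigma>s" and ?D = "tgt F"
  have \<sigma>s: "is_ctx Sg \<sigma>s" and ob: "?c \<in> Ob (src F)" "?s \<in> Ob (src F)"
    using snoc.prems A.ctx_ob_Ob [OF M] sort_Ob by auto
  from snoc.prems(1) show ?case
  proof (rule list_all2_snoc_cases)
    fix fs' f assume fs: "fs = fs' @ [f]" and f: "f \<in> hom_set (src F) b ?s"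
      and fs': "list_all2 (\<lambda>f \<sigma>. f \<in> hom_set (src F) b (sort_ob M \<sigma>)) fs' \<sigma>s"
    have t: "tuple_ar (src F) b fs' \<in> hom_set (src F) b ?c"
      by (rule A.tuple_ar_hom [OF assms fs'])
    note p = B.prd_id_hom [OF \<theta>_hom [OF \<sigma>s] ob_map_Ob [OF ob(2)]]
    have "cmp ?D (\<theta> (\<sigma>s @ [\<sigma>])) (ar_map F (tuple_ar (src F) b fs)) =
        cmp ?D (prd_id ?D (\<theta> \<sigma>s) (ob_map F ?s))
          (pair ?D (ar_map F (tuple_ar (src F) b fs')) (ar_map F f))"
      using B.cmp_assoc [OF map_hom [OF A.pair_hom [OF t f]] comparison_hom [OF ob] p]
        comparison_pair [OF t f] fs by simp
    also have "\<dots> = pair ?D (cmp ?D (\<theta> \<sigma>s) (ar_map F (tuple_ar (src F) b fs'))) (ar_map F f)"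
      by (rule B.prd_id_pair [OF \<theta>_hom [OF \<sigma>s] map_hom [OF t] map_hom [OF f]])
    finally show ?thesis using snoc.IH [OF fs' \<sigma>s] fs by simp
  qed
qed

text \<open>Arguments of function and of relation symbols meet the same inverse comparison from
  \<open>image_structure\<close>; it cancels against the comparison produced by
  \<open>\<theta>_tuple_ar\<close>. The statement about the single terms is a premise so that the
  lemma can serve inside the induction on terms as well as after it.\<close>

lemma tuple_\<theta>:
  assumes \<Gamma>: "is_ctx Sg \<Gamma>" and \<sigma>s: "is_ctx Sg \<sigma>s" and Ms: "list_all2 (is_tm Sg \<Gamma>) Ms \<sigma>s"
    and IH: "\<forall>M'\<in>set Ms.
      cmp (tgt F) (tm_ar (tgt F) N \<Gamma> M') (\<theta> \<Gamma>) = ar_map F (tm_ar (src F) M \<Gamma> M')"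
  shows "cmp (tgt F) (inv_ar (tgt F) (\<theta> \<sigma>s)) (cmp (tgt F)
      (tuple_ar (tgt F) (ctx_ob (tgt F) N \<Gamma>) (map (tm_ar (tgt F) N \<Gamma>) Ms)) (\<theta> \<Gamma>)) =
    ar_map F (tuple_ar (src F) (ctx_ob (src F) M \<Gamma>) (map (tm_ar (src F) M \<Gamma>) Ms))"
proof -
  note A = A.tms_ar_hom [OF signature M \<Gamma> Ms] and B = B.tms_ar_hom [OF signature N_structure \<Gamma> Ms]
  note c = A.ctx_ob_Ob [OF M \<Gamma>]
  note t = map_hom [OF A.tuple_ar_hom [OF c A]]
  have "cmp (tgt F) (tuple_ar (tgt F) (ctx_ob (tgt F) N \<Gamma>) (map (tm_ar (tgt F) N \<Gamma>) Ms)) (\<theta> \<Gamma>) =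
      cmp (tgt F) (\<theta> \<sigma>s) (ar_map F (tuple_ar (src F) (ctx_ob (src F) M \<Gamma>) (map (tm_ar (src F) M \<Gamma>) Ms)))"
    unfolding B.tuple_ar_cmp [OF \<theta>_hom [OF \<Gamma>] B] \<theta>_tuple_ar [OF c A \<sigma>s]
    using IH by (simp add: comp_def cong: map_cong)
  then show ?thesis
    using B.cmp_assoc [OF t \<theta>_hom [OF \<sigma>s] inv_\<theta>_hom [OF \<sigma>s]]
      B.inv_ar_left [OF \<theta>_is_iso [OF \<sigma>s] \<theta>_hom [OF \<sigma>s]] B.idn_left [OF t] by simp
qed

lemma tm_\<theta>:
  assumes \<Gamma>: "is_ctx Sg \<Gamma>"
  shows "is_tm Sg \<Gamma> t \<tau> \<Longrightarrow>
    cmp (tgt F) (tm_ar (tgt F) N \<Gamma> t) (\<theta> \<Gamma>) = ar_map F (tm_ar (src F) M \<Gamma> t)"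
proof (induction rule: is_tm.induct)
  case (var i)
  then show ?case using Var_\<theta> [OF \<Gamma>] by blast
next
  case ("fun" f \<sigma>s \<tau> Ms)
  have Ms: "list_all2 (is_tm Sg \<Gamma>) Ms \<sigma>s" using "fun"(2) by (auto elim: list_all2_mono)
  have IH: "\<forall>M'\<in>set Ms. cmp (tgt F) (tm_ar (tgt F) N \<Gamma> M') (\<theta> \<Gamma>) = ar_map F (tm_ar (src F) M \<Gamma> M')"
    using "fun"(2) by (auto simp: list_all2_conv_all_nth in_set_conv_nth)
  note \<sigma>s = funs_ctx(1) [OF "fun"(1)]
  let ?t = "tuple_ar (tgt F) (ctx_ob (tgt F) N \<Gamma>) (map (tm_ar (tgt F) N \<Gamma>) Ms)"
  let ?u = "tuple_ar (src F) (ctx_ob (src F) M \<Gamma>) (map (tm_ar (src F) M \<Gamma>) Ms)"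
  have t: "?t \<in> hom_set (tgt F) (ctx_ob (tgt F) N \<Gamma>) (ctx_ob (tgt F) N \<sigma>s)"
    using B.tuple_ar_hom [OF ctx_Ob [OF \<Gamma>] B.tms_ar_hom [OF signature N_structure \<Gamma> Ms]] .
  have u: "?u \<in> hom_set (src F) (ctx_ob (src F) M \<Gamma>) (ctx_ob (src F) M \<sigma>s)"
    using A.tuple_ar_hom [OF A.ctx_ob_Ob [OF M \<Gamma>] A.tms_ar_hom [OF signature M \<Gamma> Ms]] .
  have m: "fun_ar M f \<in> hom_set (src F) (ctx_ob (src F) M \<sigma>s) (sort_ob M \<tau>)"
    using M "fun"(1) by (simp add: is_structure_def)
  note f = fun_ar_hom [OF "fun"(1)] and i = inv_\<theta>_hom [OF \<sigma>s]
  have "cmp (tgt F) (cmp (tgt F) (cmp (tgt F) (ar_map F (fun_ar M f)) (inv_ar (tgt F) (\<theta> \<sigma>s))) ?t) (\<theta> \<Gamma>) =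
      cmp (tgt F) (ar_map F (fun_ar M f)) (cmp (tgt F) (inv_ar (tgt F) (\<theta> \<sigma>s)) (cmp (tgt F) ?t (\<theta> \<Gamma>)))"
    unfolding B.cmp_assoc [OF \<theta>_hom [OF \<Gamma>] t B.cmp_hom [OF i f], symmetric]
      B.cmp_assoc [OF B.cmp_hom [OF \<theta>_hom [OF \<Gamma>] t] i f] ..
  also have "\<dots> = ar_map F (cmp (src F) (fun_ar M f) ?u)"
    unfolding tuple_\<theta> [OF \<Gamma> \<sigma>s Ms IH] map_cmp [OF u m] ..
  finally show ?case using "fun"(1) by (simp add: image_structure_def)
qed

text \<open>Each clause of the interpretation has a counterpart among the axioms of a morphism. The
  comparison in \<open>map_eq\<close> is absorbed by \<open>comparison_pair\<close>, the inverse
  comparison in \<open>map_quant\<close> by the innermost factor of \<open>\<theta>\<close> at the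
  extended context.\<close>

lemma fm_\<theta>:
  "is_fm La Sg \<Gamma> \<phi> \<Longrightarrow> is_ctx Sg \<Gamma> \<Longrightarrow>
    reidx (tgt F) (\<theta> \<Gamma>) (fm_el (tgt F) N \<phi> \<Gamma>) = el_map F (ctx_ob (src F) M \<Gamma>) (fm_el (src F) M \<phi> \<Gamma>)"
proof (induction rule: is_fm.induct)
  case (rel r \<sigma>s \<Gamma> Ms)
  note \<Gamma> = rel(3) and Ms = rel(2) and \<sigma>s = rels_ctx [OF rel(1)]
  let ?t = "tuple_ar (tgt F) (ctx_ob (tgt F) N \<Gamma>) (map (tm_ar (tgt F) N \<Gamma>) Ms)"
  let ?u = "tuple_ar (src F) (ctx_ob (src F) M \<Gamma>) (map (tm_ar (src F) M \<Gamma>) Ms)"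
  let ?r = "el_map F (ctx_ob (src F) M \<sigma>s) (rel_el M r)"
  have t: "?t \<in> hom_set (tgt F) (ctx_ob (tgt F) N \<Gamma>) (ctx_ob (tgt F) N \<sigma>s)"
    using B.tuple_ar_hom [OF ctx_Ob [OF \<Gamma>] B.tms_ar_hom [OF signature N_structure \<Gamma> Ms]] .
  have u: "?u \<in> hom_set (src F) (ctx_ob (src F) M \<Gamma>) (ctx_ob (src F) M \<sigma>s)"
    using A.tuple_ar_hom [OF A.ctx_ob_Ob [OF M \<Gamma>] A.tms_ar_hom [OF signature M \<Gamma> Ms]] .
  have m: "rel_el M r \<in> El (src F) (ctx_ob (src F) M \<sigma>s)"
    using M rel(1) by (simp add: is_structure_def)
  note i = inv_\<theta>_hom [OF \<sigma>s] and r = rel_el_El [OF rel(1)]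
  have IH: "\<forall>M'\<in>set Ms. cmp (tgt F) (tm_ar (tgt F) N \<Gamma> M') (\<theta> \<Gamma>) = ar_map F (tm_ar (src F) M \<Gamma> M')"
  proof
    fix M' assume "M' \<in> set Ms"
    then obtain \<sigma> where "is_tm Sg \<Gamma> M' \<sigma>"
      using Ms by (auto simp: list_all2_conv_all_nth in_set_conv_nth)
    then show "cmp (tgt F) (tm_ar (tgt F) N \<Gamma> M') (\<theta> \<Gamma>) = ar_map F (tm_ar (src F) M \<Gamma> M')"
      by (rule tm_\<theta> [OF \<Gamma>])
  qed
  have "reidx (tgt F) (\<theta> \<Gamma>) (reidx (tgt F) ?t (reidx (tgt F) (inv_ar (tgt F) (\<theta> \<sigma>s)) ?r)) =
      reidx (tgt F) (ar_map F ?u) ?r"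
    unfolding tuple_\<theta> [OF \<Gamma> \<sigma>s Ms IH, symmetric]
      B.reidx_cmp [OF B.cmp_hom [OF \<theta>_hom [OF \<Gamma>] t] i r]
      B.reidx_cmp [OF \<theta>_hom [OF \<Gamma>] t B.reidx_El [OF i r]] ..
  also have "\<dots> = el_map F (ctx_ob (src F) M \<Gamma>) (reidx (src F) ?u (rel_el M r))"
    by (rule map_reidx [OF u m, symmetric])
  finally show ?case using rel(1) by (simp add: image_structure_def)
next
  case (equ \<sigma> \<Gamma> M1 M2)
  note \<Gamma> = equ(4) and s = sort_Ob [OF equ(1)]
  note t = B.tm_ar_hom [OF signature N_structure \<Gamma> equ(2), unfolded sort_ob_N]
    B.tm_ar_hom [OF signature N_structure \<Gamma> equ(3), unfolded sort_ob_N]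
  note u = A.tm_ar_hom [OF signature M \<Gamma> equ(2)] A.tm_ar_hom [OF signature M \<Gamma> equ(3)]
  note e = B.eq_El [OF ob_map_Ob [OF s]]
  have "reidx (tgt F) (\<theta> \<Gamma>) (fm_el (tgt F) N (Equ \<sigma> M1 M2) \<Gamma>) =
      reidx (tgt F) (pair (tgt F) (ar_map F (tm_ar (src F) M \<Gamma> M1)) (ar_map F (tm_ar (src F) M \<Gamma> M2)))
        (eq_el (tgt F) (ob_map F (sort_ob M \<sigma>)))"
    unfolding fm_el.simps sort_ob_N B.reidx_cmp [OF \<theta>_hom [OF \<Gamma>] B.pair_hom [OF t] e, symmetric]
      B.pair_cmp [OF t \<theta>_hom [OF \<Gamma>]] tm_\<theta> [OF \<Gamma> equ(2)] tm_\<theta> [OF \<Gamma> equ(3)] ..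
  also have "\<dots> = reidx (tgt F) (ar_map F (pair (src F) (tm_ar (src F) M \<Gamma> M1) (tm_ar (src F) M \<Gamma> M2)))
      (el_map F (prd (src F) (sort_ob M \<sigma>) (sort_ob M \<sigma>)) (eq_el (src F) (sort_ob M \<sigma>)))"
    unfolding comparison_pair [OF u, symmetric] map_eq [OF s]
      B.reidx_cmp [OF map_hom [OF A.pair_hom [OF u]] comparison_hom [OF s s] e] ..
  also have "\<dots> = el_map F (ctx_ob (src F) M \<Gamma>) (fm_el (src F) M (Equ \<sigma> M1 M2) \<Gamma>)"
    unfolding fm_el.simps map_reidx [OF A.pair_hom [OF u] A.eq_El [OF s]] ..
  finally show ?case .
next
  case (conn k \<phi>s \<Gamma>)
  let ?xs = "map (\<lambda>\<phi>. fm_el (src F) M \<phi> \<Gamma>) \<phi>s" and ?ys = "map (\<lambda>\<phi>. fm_el (tgt F) N \<phi> \<Gamma>) \<phi>s"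
  have x: "set ?xs \<subseteq> El (src F) (ctx_ob (src F) M \<Gamma>)" and y: "set ?ys \<subseteq> El (tgt F) (ctx_ob (tgt F) N \<Gamma>)"
    using conn A.fm_el_El [OF signature M] B.fm_el_El [OF signature N_structure] by auto
  show ?case
    using conn B.conn_reidx [OF \<theta>_hom [OF conn(4)] _ y, of k]
      map_conn [OF A.ctx_ob_Ob [OF M conn(4)] _ x, of k] by (simp add: comp_def cong: map_cong)
next
  case (quant \<omega> \<sigma> \<Gamma> \<phi>)
  let ?s = "sort_ob M \<sigma>" and ?c = "ctx_ob (src F) M \<Gamma>" and ?D = "tgt F"
  note \<Gamma> = quant(5)
  have ob: "?c \<in> Ob (src F)" "?s \<in> Ob (src F)" and \<Gamma>\<sigma>: "is_ctx Sg (\<Gamma> @ [\<sigma>])"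
    using quant A.ctx_ob_Ob [OF M] sort_Ob by auto
  let ?\<phi> = "fm_el (src F) M \<phi> (\<Gamma> @ [\<sigma>])" and ?\<psi> = "fm_el ?D N \<phi> (\<Gamma> @ [\<sigma>])"
  have \<phi>: "?\<phi> \<in> El (src F) (prd (src F) ?c ?s)"
    using A.fm_el_El [OF signature M quant(3) \<Gamma>\<sigma>] by simp
  have \<psi>: "?\<psi> \<in> El ?D (prd ?D (ctx_ob ?D N \<Gamma>) (ob_map F ?s))"
    using B.fm_el_El [OF signature N_structure quant(3) \<Gamma>\<sigma>] by simp
  note k = comparison_hom [OF ob] and p = B.prd_id_hom [OF \<theta>_hom [OF \<Gamma>] ob_map_Ob [OF ob(2)]]
  have "reidx ?D (comparison F ?c ?s) (reidx ?D (prd_id ?D (\<theta> \<Gamma>) (ob_map F ?s)) ?\<psi>) =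
      el_map F (prd (src F) ?c ?s) ?\<phi>"
    using quant.IH [OF \<Gamma>\<sigma>] B.reidx_cmp [OF k p \<psi>] by simp
  \<comment> \<open>At the extended context \<open>\<theta>\<close> is \<open>prd_id\<close>
    composed after \<open>comparison\<close>. Cancelling the latter leaves the reindexing along
    \<open>prd_id\<close> that \<open>quant_natural\<close> produces on one side, and the left-hand
    side is what \<open>map_quant\<close> produces on the other.\<close>
  then have "reidx ?D (inv_ar ?D (comparison F ?c ?s)) (el_map F (prd (src F) ?c ?s) ?\<phi>) =
      reidx ?D (prd_id ?D (\<theta> \<Gamma>) (ob_map F ?s)) ?\<psi>"
    using B.reidx_inverse(1) [OF B.inverse_of_inv_ar [OF preserves_prd [OF ob]] k B.reidx_El [OF p \<psi>]]
    by simp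
  then show ?case
    using B.quant_natural [OF quant(1) \<theta>_hom [OF \<Gamma>] ob_map_Ob [OF ob(2)] \<psi>] map_quant [OF quant(1) ob \<phi>]
    by simp
qed

lemma satisfies_Eqn:
  assumes "is_assertion La Sg (Eqn \<Gamma> \<tau> M1 M2)"
  shows "satisfies La (tgt F) N (Eqn \<Gamma> \<tau> M1 M2) \<longleftrightarrow>
    ar_map F (tm_ar (src F) M \<Gamma> M1) = ar_map F (tm_ar (src F) M \<Gamma> M2)"
proof -
  have a: "is_ctx Sg \<Gamma>" "is_tm Sg \<Gamma> M1 \<tau>" "is_tm Sg \<Gamma> M2 \<tau>" using assms by auto
  note i = B.inv_ar_props [OF \<theta>_is_iso \<theta>_hom, OF a(1,1)]
  \<comment> \<open>Precomposition with the isomorphism \<open>\<theta> \<Gamma>\<close> is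
    injective, because an arrow is recovered by composing back.\<close>
  have r: "t = cmp (tgt F) (cmp (tgt F) t (\<theta> \<Gamma>)) (inv_ar (tgt F) (\<theta> \<Gamma>))"
    if "t \<in> hom_set (tgt F) (ctx_ob (tgt F) N \<Gamma>) (sort_ob N \<tau>)" for t
    using B.cmp_assoc [OF i(1) \<theta>_hom [OF a(1)] that] i B.idn_right [OF that] by simp
  note t = B.tm_ar_hom [OF signature N_structure a(1,2)] B.tm_ar_hom [OF signature N_structure a(1,3)]
  show ?thesis
    unfolding satisfies.simps tm_\<theta> [OF a(1,2), symmetric] tm_\<theta> [OF a(1,3), symmetric]
    using arg_cong [where f = "\<lambda>t. cmp (tgt F) t (inv_ar (tgt F) (\<theta> \<Gamma>))"] r [OF t(1)] r [OF t(2)] by metis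
qed

lemma satisfies_Seq:
  assumes "is_assertion La Sg (Seq \<Gamma> \<Phi> \<phi>)"
  shows "satisfies La (tgt F) N (Seq \<Gamma> \<Phi> \<phi>) \<longleftrightarrow>
    (el_map F (ctx_ob (src F) M \<Gamma>) (list_prod (unit_el La (src F) (ctx_ob (src F) M \<Gamma>))
        (tensor_op La (src F) (ctx_ob (src F) M \<Gamma>)) (map (\<lambda>\<psi>. fm_el (src F) M \<psi> \<Gamma>) \<Phi>)),
      el_map F (ctx_ob (src F) M \<Gamma>) (fm_el (src F) M \<phi> \<Gamma>))
    \<in> Po (tgt F) (ob_map F (ctx_ob (src F) M \<Gamma>))"
proof -
  have \<Gamma>: "is_ctx Sg \<Gamma>" and \<phi>: "is_fm La Sg \<Gamma> \<phi>" and \<Phi>: "\<And>\<psi>. \<psi> \<in> set \<Phi> \<Longrightarrow> is_fm La Sg \<Gamma> \<psi>"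
    using assms by auto
  let ?xs = "map (\<lambda>\<psi>. fm_el (src F) M \<psi> \<Gamma>) \<Phi>" and ?ys = "map (\<lambda>\<psi>. fm_el (tgt F) N \<psi> \<Gamma>) \<Phi>"
  have x: "set ?xs \<subseteq> El (src F) (ctx_ob (src F) M \<Gamma>)" and y: "set ?ys \<subseteq> El (tgt F) (ctx_ob (tgt F) N \<Gamma>)"
    using \<Gamma> \<Phi> A.fm_el_El [OF signature M] B.fm_el_El [OF signature N_structure] by auto
  have m: "map (reidx (tgt F) (\<theta> \<Gamma>)) ?ys = map (el_map F (ctx_ob (src F) M \<Gamma>)) ?xs"
    using fm_\<theta> \<Phi> \<Gamma> by simp
  show ?thesis
    unfolding satisfies.simps map_list_prod [OF language A.ctx_ob_Ob [OF M \<Gamma>] x] m [symmetric]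
      fm_\<theta> [OF \<phi> \<Gamma>, symmetric] B.list_prod_reidx [OF language \<theta>_hom [OF \<Gamma>] y, symmetric]
    by (rule B.reidx_iso_Po [OF \<theta>_is_iso [OF \<Gamma>] \<theta>_hom [OF \<Gamma>] B.list_prod_El [OF ctx_Ob [OF \<Gamma>] y]
        B.fm_el_El [OF signature N_structure \<phi> \<Gamma>], symmetric])
qed

end

text \<open>Premises travel forward along each morphism because equality and order are preserved;
  the conclusion travels back, and that is where joint faithfulness and joint reflection of the
  order enter. The index type is a parameter: products use projections indexed by \<open>I\<close>,
  submodels a family with one member.\<close>

lemma in_FAL_reflect:
  fixes C :: "('o, 'a, 'p, 'u) propcat" and F :: "'i \<Rightarrow> ('o, 'a, 'p, 'o2, 'a2, 'p2, 'u) morphism"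
  assumes La: "is_language small La" and C: "FA C La"
    and F: "\<And>i. i \<in> I \<Longrightarrow> FA_morphism La (F i)" "\<And>i. i \<in> I \<Longrightarrow> src (F i) = C"
      "\<And>i. i \<in> I \<Longrightarrow> in_FAL La L (tgt (F i))"
    and faithful: "\<And>b c f g. f \<in> hom_set C b c \<Longrightarrow> g \<in> hom_set C b c \<Longrightarrow>
      (\<And>i. i \<in> I \<Longrightarrow> ar_map (F i) f = ar_map (F i) g) \<Longrightarrow> f = g"
    and embed: "\<And>c x y. c \<in> Ob C \<Longrightarrow> x \<in> El C c \<Longrightarrow> y \<in> El C c \<Longrightarrow>
      (\<And>i. i \<in> I \<Longrightarrow> (el_map (F i) c x, el_map (F i) c y) \<in> Po (tgt (F i)) (ob_map (F i) c)) \<Longrightarrow>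
      (x, y) \<in> Po C c"
  shows "in_FAL La L C"
proof -
  interpret C: FA C La by fact
  have "satisfies La C M a"
    if Sg: "is_signature Sg" and T: "T \<subseteq> assertions La Sg" "T' \<subseteq> assertions La Sg" "T' \<subseteq> L Sg T"
      and str: "is_structure Sg C M" and sat0: "\<forall>a\<in>T. satisfies La C M a" and a: "a \<in> T'"
    for Sg T T' M a
  proof -
    have img: "structure_image La (F i) small Sg M" if "i \<in> I" for i
      using F [OF that] La Sg str by (simp add: structure_image_def structure_image_axioms_def)
    have sat: "satisfies La (tgt (F i)) (image_structure Sg (F i) M) a'"
      if i: "i \<in> I" and a': "a' \<in> T" for i a'
    proof -
      interpret structure_image La "F i" small Sg M using img i .
      have C: "src (F i) = C" using F(2) i .
      have as: "is_assertion La Sg a'" "satisfies La C M a'"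
        using T(1) a' sat0 by (auto simp: assertions_def)
      show ?thesis
      proof (cases a')
        case (Eqn \<Gamma> \<tau> M1 M2)
        then show ?thesis
          using satisfies_Eqn as C by (metis satisfies.simps(1))
      next
        case (Seq \<Gamma> \<Phi> \<phi>)
        then have "is_ctx Sg \<Gamma>" using as(1) by simp
        then show ?thesis
          using satisfies_Seq as C map_mono [OF A.ctx_ob_Ob [OF structure_image.M [OF img [OF i]]], of \<Gamma>]
            Seq by simp
      qed
    qed
    have sat': "satisfies La (tgt (F i)) (image_structure Sg (F i) M) a" if i: "i \<in> I" for i
    proof -
      have "is_structure Sg (tgt (F i)) (image_structure Sg (F i) M)"
        using structure_image.N_structure [OF img [OF i]] .
      moreover have "entails_in La Sg (tgt (F i)) T T'"
        using F(3) [OF i] Sg T unfolding in_FAL_def by blast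
      ultimately show ?thesis
        using sat [OF i] a unfolding entails_in_def by blast
    qed
    have as: "is_assertion La Sg a" using T(2) a by (auto simp: assertions_def)
    show ?thesis
    proof (cases a)
      case (Eqn \<Gamma> \<tau> M1 M2)
      then have a: "is_ctx Sg \<Gamma>" "is_tm Sg \<Gamma> M1 \<tau>" "is_tm Sg \<Gamma> M2 \<tau>" using as by auto
      have "tm_ar C M \<Gamma> M1 = tm_ar C M \<Gamma> M2"
      proof (rule faithful [OF C.tm_ar_hom [OF Sg str a(1,2)] C.tm_ar_hom [OF Sg str a(1,3)]])
        fix i assume i: "i \<in> I"
        show "ar_map (F i) (tm_ar C M \<Gamma> M1) = ar_map (F i) (tm_ar C M \<Gamma> M2)"
          using structure_image.satisfies_Eqn [OF img [OF i] as [unfolded Eqn]]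
            sat' [OF i, unfolded Eqn] unfolding F(2) [OF i] by blast
      qed
      then show ?thesis using Eqn by simp
    next
      case (Seq \<Gamma> \<Phi> \<phi>)
      then have a: "is_ctx Sg \<Gamma>" "is_fm La Sg \<Gamma> \<phi>" "\<forall>\<psi>\<in>set \<Phi>. is_fm La Sg \<Gamma> \<psi>" using as by auto
      note c = C.ctx_ob_Ob [OF str a(1)]
      have l: "set (map (\<lambda>\<psi>. fm_el C M \<psi> \<Gamma>) \<Phi>) \<subseteq> El C (ctx_ob C M \<Gamma>)"
        using a C.fm_el_El [OF Sg str] by auto
      show ?thesis
        unfolding Seq satisfies.simps
      proof (rule embed [OF c C.list_prod_El [OF c l] C.fm_el_El [OF Sg str a(2,1)]])
        fix i assume i: "i \<in> I"
        show "(el_map (F i) (ctx_ob C M \<Gamma>) (list_prod (unit_el La C (ctx_ob C M \<Gamma>))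
            (tensor_op La C (ctx_ob C M \<Gamma>)) (map (\<lambda>\<psi>. fm_el C M \<psi> \<Gamma>) \<Phi>)),
            el_map (F i) (ctx_ob C M \<Gamma>) (fm_el C M \<phi> \<Gamma>)) \<in> Po (tgt (F i)) (ob_map (F i) (ctx_ob C M \<Gamma>))"
          using structure_image.satisfies_Seq [OF img [OF i] as [unfolded Seq]]
            sat' [OF i, unfolded Seq] unfolding F(2) [OF i] by blast
      qed
    qed
  qed
  then show ?thesis
    using C unfolding in_FAL_def entails_in_def by blast
qed


section \<open>Strict morphisms\<close>

text \<open>If products are preserved on the nose, each \<open>comparison\<close> and the arrow to
  the terminal object are identities, so the coherence isomorphisms disappear from the axioms for
  quantifiers and equality. Projections and corestrictions are of this kind.\<close>

lemma FA_morphism_strictI: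
  assumes A: "FA (src F) La" and B: "FA (tgt F) La"
    and ob: "ob_map F \<in> Ob (src F) \<rightarrow>\<^sub>E Ob (tgt F)"
    and ar: "ar_map F \<in> Ar (src F) \<rightarrow>\<^sub>E Ar (tgt F)"
    and el: "el_map F \<in> (\<Pi>\<^sub>E c\<in>Ob (src F). El (src F) c \<rightarrow>\<^sub>E El (tgt F) (ob_map F c))"
    and hom: "\<And>f b c. f \<in> hom_set (src F) b c \<Longrightarrow>
      ar_map F f \<in> hom_set (tgt F) (ob_map F b) (ob_map F c)"
    and idn: "\<And>c. c \<in> Ob (src F) \<Longrightarrow> ar_map F (idn (src F) c) = idn (tgt F) (ob_map F c)"
    and cmp: "\<And>f g a b c. f \<in> hom_set (src F) a b \<Longrightarrow> g \<in> hom_set (src F) b c \<Longrightarrow>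
      ar_map F (cmp (src F) g f) = cmp (tgt F) (ar_map F g) (ar_map F f)"
    and top: "ob_map F (top_ob (src F)) = top_ob (tgt F)"
    and prd: "\<And>b c. b \<in> Ob (src F) \<Longrightarrow> c \<in> Ob (src F) \<Longrightarrow>
      ob_map F (prd (src F) b c) = prd (tgt F) (ob_map F b) (ob_map F c)"
    and pr1: "\<And>b c. b \<in> Ob (src F) \<Longrightarrow> c \<in> Ob (src F) \<Longrightarrow>
      ar_map F (pr1 (src F) b c) = pr1 (tgt F) (ob_map F b) (ob_map F c)"
    and pr2: "\<And>b c. b \<in> Ob (src F) \<Longrightarrow> c \<in> Ob (src F) \<Longrightarrow>
      ar_map F (pr2 (src F) b c) = pr2 (tgt F) (ob_map F b) (ob_map F c)"
    and mono: "\<And>c x y. c \<in> Ob (src F) \<Longrightarrow> (x, y) \<in> Po (src F) c \<Longrightarrow>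
      (el_map F c x, el_map F c y) \<in> Po (tgt F) (ob_map F c)"
    and reidx: "\<And>f b c x. f \<in> hom_set (src F) b c \<Longrightarrow> x \<in> El (src F) c \<Longrightarrow>
      el_map F b (reidx (src F) f x) = reidx (tgt F) (ar_map F f) (el_map F c x)"
    and conn: "\<And>c k xs. c \<in> Ob (src F) \<Longrightarrow> k \<in> conns La (length xs) \<Longrightarrow> set xs \<subseteq> El (src F) c \<Longrightarrow>
      el_map F c (conn_op (src F) c k xs) = conn_op (tgt F) (ob_map F c) k (map (el_map F c) xs)"
    and quant: "\<And>\<omega> b c x. \<omega> \<in> quants La \<Longrightarrow> b \<in> Ob (src F) \<Longrightarrow> c \<in> Ob (src F) \<Longrightarrow>
      x \<in> El (src F) (prd (src F) b c) \<Longrightarrow> el_map F b (quant_op (src F) \<omega> b c x) =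
        quant_op (tgt F) \<omega> (ob_map F b) (ob_map F c) (el_map F (prd (src F) b c) x)"
    and eq: "\<And>c. c \<in> Ob (src F) \<Longrightarrow>
      el_map F (prd (src F) c c) (eq_el (src F) c) = eq_el (tgt F) (ob_map F c)"
  shows "FA_morphism La F"
proof -
  interpret A: FA "src F" La by fact
  interpret B: FA "tgt F" La by fact
  have Fob: "ob_map F c \<in> Ob (tgt F)" if "c \<in> Ob (src F)" for c using ob that by auto
  have Fel: "el_map F c x \<in> El (tgt F) (ob_map F c)" if "c \<in> Ob (src F)" "x \<in> El (src F) c" for c x
    using el that by (auto simp: PiE_iff)
  have k: "comparison F b c = idn (tgt F) (prd (tgt F) (ob_map F b) (ob_map F c))"
    if "b \<in> Ob (src F)" "c \<in> Ob (src F)" for b c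
    unfolding comparison_def pr1 [OF that] pr2 [OF that]
    using Fob [OF that(1)] Fob [OF that(2)]
    by (intro B.pair_eqI [OF B.idn_hom] B.idn_right [OF B.pr1_hom] B.idn_right [OF B.pr2_hom] B.prd_Ob)
  have b: "bang (tgt F) (ob_map F (top_ob (src F))) = idn (tgt F) (top_ob (tgt F))"
    unfolding top by (rule B.bang_eqI [OF B.idn_hom [OF B.top_Ob]])
  have iso: "is_iso (tgt F) (idn (tgt F) c)" if "c \<in> Ob (tgt F)" for c
    using B.inverse_of_idn [OF that] by (auto simp: is_iso_def)
  show ?thesis
  proof (intro FA_morphism.intro FA_morphism_axioms.intro A B ob ar el hom idn cmp mono reidx conn)
    show "is_iso (tgt F) (bang (tgt F) (ob_map F (top_ob (src F))))"
      unfolding b by (rule iso [OF B.top_Ob])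
    show "is_iso (tgt F) (comparison F b c)" if "b \<in> Ob (src F)" "c \<in> Ob (src F)" for b c
      unfolding k [OF that] by (rule iso [OF B.prd_Ob [OF Fob Fob, OF that]])
    show "el_map F b (quant_op (src F) \<omega> b c x) = quant_op (tgt F) \<omega> (ob_map F b) (ob_map F c)
        (reidx (tgt F) (inv_ar (tgt F) (comparison F b c)) (el_map F (prd (src F) b c) x))"
      if "\<omega> \<in> quants La" "b \<in> Ob (src F)" "c \<in> Ob (src F)" "x \<in> El (src F) (prd (src F) b c)" for \<omega> b c x
    proof -
      note p = B.prd_Ob [OF Fob Fob, OF that(2,3)]
      show ?thesis
        unfolding k [OF that(2,3)] B.inv_ar_eqI [OF B.inverse_of_idn [OF p]] quant [OF that]
        using B.reidx_idn [OF p] Fel [OF A.prd_Ob [OF that(2,3)] that(4)] prd [OF that(2,3)] by simp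
    qed
    show "el_map F (prd (src F) c c) (eq_el (src F) c) =
        reidx (tgt F) (comparison F c c) (eq_el (tgt F) (ob_map F c))" if "c \<in> Ob (src F)" for c
      unfolding k [OF that that] eq [OF that]
      by (rule B.reidx_idn [OF B.prd_Ob B.eq_El, symmetric]) (simp_all add: Fob that)
  qed
qed


section \<open>Products of prop-categories\<close>

locale product_family =
  fixes small :: "'u set \<Rightarrow> bool" and tup :: "'u set \<Rightarrow> ('u \<Rightarrow> 'u) \<Rightarrow> 'u" and La :: "'u language"
    and I :: "'u set" and D :: "'u \<Rightarrow> ('u, 'u, 'u, 'u) propcat"
  assumes universe: "universe small tup" and language: "is_language small La"
    and small_I: "small I" and FA_D: "\<And>i. i \<in> I \<Longrightarrow> FA (D i) La"
begin

abbreviation "P \<equiv> prod_propcat tup I D"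
abbreviation "pr \<equiv> component tup I"
abbreviation "tp \<equiv> \<lambda>x. tup I (restrict x I)"

text \<open>The codes of all families, whatever their components. Membership in a carrier of the
  product splits into being a code and a componentwise condition, and equations between codes can be
  checked componentwise.\<close>

definition "tuples = tup I ` extensional I"

text \<open>The universe promises injectivity of \<open>tup I\<close> for small \<open>I\<close> and
  on extensional functions; \<open>tp\<close> restricts its argument so that it always
  qualifies.\<close>

lemma pr_tup: "x \<in> extensional I \<Longrightarrow> pr (tup I x) = x"
  using universe small_I by (simp add: component_def universe_def the_inv_into_f_f)

lemma pr_tp [simp]: "i \<in> I \<Longrightarrow> pr (tp x) i = x i"
  by (simp add: pr_tup)

lemma tp_tuples [simp]: "tp x \<in> tuples"
  by (simp add: tuples_def)

lemma tuples_eqI: "x \<in> tuples \<Longrightarrow> y \<in> tuples \<Longrightarrow> (\<And>i. i \<in> I \<Longrightarrow> pr x i = pr y i) \<Longrightarrow> x = y"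
  unfolding tuples_def
  by (elim imageE, hypsubst) (simp add: pr_tup, rule arg_cong [of _ _ "tup I"], rule extensionalityI)

lemma image_PiE: "x \<in> tup I ` PiE I A \<longleftrightarrow> x \<in> tuples \<and> (\<forall>i\<in>I. pr x i \<in> A i)"
  by (auto simp: tuples_def PiE_def pr_tup)

lemma Ob_P: "c \<in> Ob P \<longleftrightarrow> c \<in> tuples \<and> (\<forall>i\<in>I. pr c i \<in> Ob (D i))"
  by (simp add: prod_propcat_def Let_def image_PiE)

lemma Ar_P: "f \<in> Ar P \<longleftrightarrow> f \<in> tuples \<and> (\<forall>i\<in>I. pr f i \<in> Ar (D i))"
  by (simp add: prod_propcat_def Let_def image_PiE)

lemma El_P: "x \<in> El P c \<longleftrightarrow> x \<in> tuples \<and> (\<forall>i\<in>I. pr x i \<in> El (D i) (pr c i))"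
  by (simp add: prod_propcat_def Let_def image_PiE)

lemma P_sel:
  "dm P f = tp (\<lambda>i. dm (D i) (pr f i))"
  "cd P f = tp (\<lambda>i. cd (D i) (pr f i))"
  "idn P c = tp (\<lambda>i. idn (D i) (pr c i))"
  "cmp P g f = tp (\<lambda>i. cmp (D i) (pr g i) (pr f i))"
  "top_ob P = tp (\<lambda>i. top_ob (D i))"
  "prd P b c = tp (\<lambda>i. prd (D i) (pr b i) (pr c i))"
  "pr1 P b c = tp (\<lambda>i. pr1 (D i) (pr b i) (pr c i))"
  "pr2 P b c = tp (\<lambda>i. pr2 (D i) (pr b i) (pr c i))"
  "reidx P f x = tp (\<lambda>i. reidx (D i) (pr f i) (pr x i))"
  "conn_op P c k xs = tp (\<lambda>i. conn_op (D i) (pr c i) k (map (\<lambda>x. pr x i) xs))"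
  "quant_op P \<omega> b c x = tp (\<lambda>i. quant_op (D i) \<omega> (pr b i) (pr c i) (pr x i))"
  "eq_el P c = tp (\<lambda>i. eq_el (D i) (pr c i))"
  by (simp_all add: prod_propcat_def Let_def)

text \<open>Domain and codomain are computed by \<open>tp\<close> and hence are codes, so
  \<open>b\<close> and \<open>c\<close> must be codes before they can be compared with them
  componentwise.\<close>

lemma hom_P: "f \<in> hom_set P b c \<longleftrightarrow> f \<in> tuples \<and> b \<in> tuples \<and> c \<in> tuples \<and>
    (\<forall>i\<in>I. pr f i \<in> hom_set (D i) (pr b i) (pr c i))"
proof -
  have "tp x = b \<longleftrightarrow> b \<in> tuples \<and> (\<forall>i\<in>I. x i = pr b i)" for x b
    using tuples_eqI [of "tp x" b] tp_tuples [of x] by auto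
  then show ?thesis
    unfolding hom_set_def by (auto simp: Ar_P P_sel(1,2))
qed

text \<open>Carrier conditions are absent on the right because the order of each component relates
  only elements of its carrier, given that \<open>c\<close> is an object.\<close>

lemma Po_P:
  assumes c: "c \<in> Ob P"
  shows "(x, y) \<in> Po P c \<longleftrightarrow> x \<in> tuples \<and> y \<in> tuples \<and> (\<forall>i\<in>I. (pr x i, pr y i) \<in> Po (D i) (pr c i))"
proof
  show "(x, y) \<in> Po P c \<Longrightarrow> x \<in> tuples \<and> y \<in> tuples \<and> (\<forall>i\<in>I. (pr x i, pr y i) \<in> Po (D i) (pr c i))"
    by (auto simp: prod_propcat_def Let_def tuples_def pr_tup PiE_def)
  assume a: "x \<in> tuples \<and> y \<in> tuples \<and> (\<forall>i\<in>I. (pr x i, pr y i) \<in> Po (D i) (pr c i))"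
  have "pr x i \<in> El (D i) (pr c i)" "pr y i \<in> El (D i) (pr c i)" if "i \<in> I" for i
    using a that c prop_category.Po_El [OF FA.axioms(1) [OF FA_D [OF that]]] by (auto simp: Ob_P)
  then have "x \<in> El P c" "y \<in> El P c" using a by (auto simp: El_P)
  then obtain x' y' where x: "x = tup I x'" "x' \<in> (\<Pi>\<^sub>E i\<in>I. El (D i) (pr c i))"
    and y: "y = tup I y'" "y' \<in> (\<Pi>\<^sub>E i\<in>I. El (D i) (pr c i))"
    by (auto simp: prod_propcat_def Let_def)
  then have "\<forall>i\<in>I. (x' i, y' i) \<in> Po (D i) (pr c i)"
    using a by (auto simp: pr_tup PiE_def)
  then show "(x, y) \<in> Po P c"
    using x y by (auto simp: prod_propcat_def Let_def)
qed

lemmas P_iff = Ob_P Ar_P El_P hom_P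

lemma hom_component: "f \<in> hom_set P b c \<Longrightarrow> i \<in> I \<Longrightarrow> pr f i \<in> hom_set (D i) (pr b i) (pr c i)"
  and Ob_component: "c \<in> Ob P \<Longrightarrow> i \<in> I \<Longrightarrow> pr c i \<in> Ob (D i)"
  and El_component: "x \<in> El P c \<Longrightarrow> i \<in> I \<Longrightarrow> pr x i \<in> El (D i) (pr c i)"
  by (simp_all add: P_iff)

lemma hom_tuples: "f \<in> hom_set P b c \<Longrightarrow> f \<in> tuples" "f \<in> hom_set P b c \<Longrightarrow> b \<in> tuples"
    "f \<in> hom_set P b c \<Longrightarrow> c \<in> tuples"
  and Ob_tuples: "c \<in> Ob P \<Longrightarrow> c \<in> tuples"
  and El_tuples: "x \<in> El P c \<Longrightarrow> x \<in> tuples"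
  by (simp_all add: P_iff)

lemmas FA_fp = prop_category.axioms(1) [OF FA.axioms(1) [OF FA_D]]
  and FA_prop = FA.axioms(1) [OF FA_D]

lemmas hom_Ob_component = fp_category.hom_Ob [OF FA_fp hom_component]

lemma pair_component:
  assumes "f \<in> hom_set P a b" "g \<in> hom_set P a c" "i \<in> I"
  shows "pair (D i) (pr f i) (pr g i) \<in> hom_set (D i) (pr a i) (prd (D i) (pr b i) (pr c i))"
    "cmp (D i) (pr1 (D i) (pr b i) (pr c i)) (pair (D i) (pr f i) (pr g i)) = pr f i"
    "cmp (D i) (pr2 (D i) (pr b i) (pr c i)) (pair (D i) (pr f i) (pr g i)) = pr g i"
  using fp_category.pair_props [OF FA_fp [OF assms(3)] hom_component [OF assms(1,3)]
      hom_component [OF assms(2,3)]] by auto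

text \<open>\<open>pair P\<close> is a definite description and cannot be evaluated before
  uniqueness is known, so the componentwise pairing is studied first; \<open>pair_P\<close>
  identifies the two afterwards.\<close>

lemma pair_P_props:
  assumes "f \<in> hom_set P a b" "g \<in> hom_set P a c"
  defines "h \<equiv> tp (\<lambda>i. pair (D i) (pr f i) (pr g i))"
  shows "h \<in> hom_set P a (prd P b c)" "cmp P (pr1 P b c) h = f" "cmp P (pr2 P b c) h = g"
proof -
  note t = hom_tuples [OF assms(1)] hom_tuples [OF assms(2)]
    and c = pair_component [OF assms(1,2)]
  show "h \<in> hom_set P a (prd P b c)" using t c by (simp add: h_def hom_P P_sel)
  show "cmp P (pr1 P b c) h = f" "cmp P (pr2 P b c) h = g"
    using t c by (rule_tac tuples_eqI; simp add: h_def P_sel)+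
qed

sublocale P: fp_category P
proof
  fix f g h a b c
  show "f \<in> Ar P \<Longrightarrow> dm P f \<in> Ob P" "f \<in> Ar P \<Longrightarrow> cd P f \<in> Ob P"
    "c \<in> Ob P \<Longrightarrow> idn P c \<in> hom_set P c c" "top_ob P \<in> Ob P"
    "b \<in> Ob P \<Longrightarrow> c \<in> Ob P \<Longrightarrow> prd P b c \<in> Ob P"
    "b \<in> Ob P \<Longrightarrow> c \<in> Ob P \<Longrightarrow> pr1 P b c \<in> hom_set P (prd P b c) b"
    "b \<in> Ob P \<Longrightarrow> c \<in> Ob P \<Longrightarrow> pr2 P b c \<in> hom_set P (prd P b c) c"
    by (simp_all add: P_iff P_sel fp_category.dm_Ob [OF FA_fp] fp_category.cd_Ob [OF FA_fp]
      fp_category.idn_hom [OF FA_fp] fp_category.top_Ob [OF FA_fp] fp_category.prd_Ob [OF FA_fp]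
      fp_category.pr1_hom [OF FA_fp] fp_category.pr2_hom [OF FA_fp])
  show "cmp P g f \<in> hom_set P a c" if f: "f \<in> hom_set P a b" and g: "g \<in> hom_set P b c"
    using hom_tuples [OF f] hom_tuples [OF g]
      fp_category.cmp_hom [OF FA_fp hom_component [OF f] hom_component [OF g]]
    by (simp add: hom_P P_sel)
  show "cmp P (idn P b) f = f" "cmp P f (idn P a) = f" if f: "f \<in> hom_set P a b"
    using hom_tuples [OF f] fp_category.idn_left [OF FA_fp hom_component [OF f]]
      fp_category.idn_right [OF FA_fp hom_component [OF f]]
    by (rule_tac tuples_eqI; simp add: P_sel)+
  show "cmp P h (cmp P g f) = cmp P (cmp P h g) f"
    if "f \<in> hom_set P a b" "g \<in> hom_set P b c" "h \<in> hom_set P c d" for d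
    using fp_category.cmp_assoc [OF FA_fp that [THEN hom_component]]
    by (rule_tac tuples_eqI) (simp_all add: P_sel)
  show "\<exists>!f. f \<in> hom_set P b (top_ob P)" if b: "b \<in> Ob P"
  proof (rule ex1I [of _ "tp (\<lambda>i. bang (D i) (pr b i))"])
    show "tp (\<lambda>i. bang (D i) (pr b i)) \<in> hom_set P b (top_ob P)"
      using Ob_tuples [OF b] fp_category.bang_hom [OF FA_fp Ob_component [OF b]]
      by (simp add: hom_P P_sel)
    show "f = tp (\<lambda>i. bang (D i) (pr b i))" if f: "f \<in> hom_set P b (top_ob P)" for f
    proof (rule tuples_eqI [OF hom_tuples(1) [OF f] tp_tuples])
      fix i assume i: "i \<in> I"
      have "pr f i \<in> hom_set (D i) (pr b i) (top_ob (D i))"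
        using hom_component [OF f i] i by (simp add: P_sel)
      then show "pr f i = pr (tp (\<lambda>i. bang (D i) (pr b i))) i"
        using fp_category.bang_eqI [OF FA_fp [OF i]] i by simp
    qed
  qed
  show "\<exists>!h. h \<in> hom_set P a (prd P b c) \<and> cmp P (pr1 P b c) h = f \<and> cmp P (pr2 P b c) h = g"
    if f: "f \<in> hom_set P a b" and g: "g \<in> hom_set P a c"
  proof (rule ex1I [of _ "tp (\<lambda>i. pair (D i) (pr f i) (pr g i))"])
    show "tp (\<lambda>i. pair (D i) (pr f i) (pr g i)) \<in> hom_set P a (prd P b c) \<and>
        cmp P (pr1 P b c) (tp (\<lambda>i. pair (D i) (pr f i) (pr g i))) = f \<and>
        cmp P (pr2 P b c) (tp (\<lambda>i. pair (D i) (pr f i) (pr g i))) = g"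
      using pair_P_props [OF f g] by blast
    fix h
    assume h: "h \<in> hom_set P a (prd P b c) \<and> cmp P (pr1 P b c) h = f \<and> cmp P (pr2 P b c) h = g"
    show "h = tp (\<lambda>i. pair (D i) (pr f i) (pr g i))"
    proof (rule tuples_eqI [OF hom_tuples(1) [OF conjunct1 [OF h]] tp_tuples])
      fix i assume i: "i \<in> I"
      have ob: "pr b i \<in> Ob (D i)" "pr c i \<in> Ob (D i)"
        using hom_Ob_component(2) [OF i f i] hom_Ob_component(2) [OF i g i] .
      have "pr h i \<in> hom_set (D i) (pr a i) (prd (D i) (pr b i) (pr c i))"
        using hom_component [OF conjunct1 [OF h] i] i by (simp add: P_sel)
      moreover have "cmp (D i) (pr1 (D i) (pr b i) (pr c i)) (pr h i) = pr f i"
        "cmp (D i) (pr2 (D i) (pr b i) (pr c i)) (pr h i) = pr g i"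
        using h i by (auto simp: P_sel)
      ultimately have "pair (D i) (pr f i) (pr g i) = pr h i"
        using fp_category.pair_eqI [OF FA_fp [OF i] _ ob] by blast
      then show "pr h i = pr (tp (\<lambda>i. pair (D i) (pr f i) (pr g i))) i"
        using i by simp
    qed
  qed
qed

lemma pair_P:
  assumes f: "f \<in> hom_set P a b" and g: "g \<in> hom_set P a c"
  shows "pair P f g = tp (\<lambda>i. pair (D i) (pr f i) (pr g i))"
  using P.pair_eqI [OF pair_P_props(1) [OF f g] P.hom_Ob(2) [OF f] P.hom_Ob(2) [OF g]]
    pair_P_props(2,3) [OF f g] by blast

lemma bang_P:
  assumes "b \<in> Ob P"
  shows "bang P b = tp (\<lambda>i. bang (D i) (pr b i))"
  using Ob_tuples [OF assms] fp_category.bang_hom [OF FA_fp Ob_component [OF assms]]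
  by (intro P.bang_eqI) (simp add: hom_P P_sel)

lemma prd_id_P:
  assumes f: "f \<in> hom_set P b' b" and c: "c \<in> Ob P"
  shows "prd_id P f c = tp (\<lambda>i. prd_id (D i) (pr f i) (pr c i))"
proof -
  note p = fp_category.prd_id_props [OF FA_fp hom_component [OF f] Ob_component [OF c]]
  show ?thesis
  proof (rule P.prd_id_eqI [OF assms])
    show "tp (\<lambda>i. prd_id (D i) (pr f i) (pr c i)) \<in> hom_set P (prd P b' c) (prd P b c)"
      using p(1) by (simp add: hom_P P_sel)
    show "cmp P (pr1 P b c) (tp (\<lambda>i. prd_id (D i) (pr f i) (pr c i))) = cmp P f (pr1 P b' c)"
      "cmp P (pr2 P b c) (tp (\<lambda>i. prd_id (D i) (pr f i) (pr c i))) = pr2 P b' c"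
      using p(2,3) by (rule_tac tuples_eqI; simp add: P_sel)+
  qed
qed

lemma assoc_ar_P:
  assumes "b \<in> Ob P" "c \<in> Ob P" "d \<in> Ob P"
  shows "assoc_ar P b c d = tp (\<lambda>i. assoc_ar (D i) (pr b i) (pr c i) (pr d i))"
proof -
  note p = P.pr1_hom [OF assms(1) P.prd_Ob [OF assms(2,3)]]
    and q = P.pr2_hom [OF assms(1) P.prd_Ob [OF assms(2,3)]]
  note q1 = P.cmp_hom [OF q P.pr1_hom [OF assms(2,3)]] and q2 = P.cmp_hom [OF q P.pr2_hom [OF assms(2,3)]]
  show ?thesis
    unfolding assoc_ar_def Let_def
    by (subst pair_P [OF P.pair_hom [OF p q1] q2], subst pair_P [OF p q1], rule tuples_eqI)
      (auto simp: P_sel)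
qed

text \<open>Inverses are assembled from inverses of the components. Uniqueness of inverses then
  evaluates \<open>inv_ar\<close> in the product, as the quantifier axiom for induced morphisms
  requires.\<close>

lemma inverse_of_P:
  assumes f: "f \<in> hom_set P b c" and g: "\<And>i. i \<in> I \<Longrightarrow> inverse_of (D i) (pr f i) (g i)"
  shows "inverse_of P f (tp g)"
proof (rule P.inverse_ofI [OF f])
  have d: "dm (D i) (pr f i) = pr b i" "cd (D i) (pr f i) = pr c i" if "i \<in> I" for i
    using f that fp_category.hom_dm_cd [OF FA_fp [OF that]] by (auto simp: hom_P)
  show "tp g \<in> hom_set P c b" "cmp P (tp g) f = idn P b" "cmp P f (tp g) = idn P c"
    using f g d hom_tuples [OF f] by (simp add: hom_P P_sel inverse_of_def)
      (use g d in \<open>rule_tac tuples_eqI; simp add: P_sel inverse_of_def\<close>)+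
qed

sublocale P: prop_category P
proof
  fix f g x y a b c
  show "partial_order_on (El P c) (Po P c)" if c: "c \<in> Ob P"
    unfolding partial_order_on_def preorder_on_def
  proof (intro conjI)
    note D = FA_prop Ob_component [OF c]
    show "Po P c \<subseteq> El P c \<times> El P c"
      using prop_category.Po_El [OF D] by (fastforce simp: Po_P [OF c] El_P)
    show "refl_on (El P c) (Po P c)"
      using prop_category.Po_refl [OF D] by (auto simp: Po_P [OF c] El_P refl_on_def)
    show "trans (Po P c)"
    proof (rule transI)
      fix x y z assume "(x, y) \<in> Po P c" "(y, z) \<in> Po P c"
      then show "(x, z) \<in> Po P c"
        using prop_category.Po_trans [OF D] by (simp add: Po_P [OF c]) blast
    qed
    show "antisym (Po P c)"
    proof (rule antisymI)
      fix x y assume "(x, y) \<in> Po P c" "(y, x) \<in> Po P c"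
      then show "x = y"
        using prop_category.Po_antisym [OF D] by (rule_tac tuples_eqI; simp add: Po_P [OF c])
    qed
  qed
  show "(reidx P f x, reidx P f y) \<in> Po P b" if f: "f \<in> hom_set P b c" and xy: "(x, y) \<in> Po P c"
    using prop_category.reidx_mono [OF FA_prop hom_component [OF f]] xy
      P.hom_Ob [OF f] by (simp add: Po_P P_sel)
  show "reidx P (idn P c) x = x" if "c \<in> Ob P" "x \<in> El P c"
    using prop_category.reidx_idn [OF FA_prop Ob_component [OF that(1)] El_component [OF that(2)]]
      El_tuples [OF that(2)] by (rule_tac tuples_eqI; simp add: P_sel)
  show "reidx P (cmp P g f) x = reidx P f (reidx P g x)"
    if "f \<in> hom_set P a b" "g \<in> hom_set P b c" "x \<in> El P c"
    using prop_category.reidx_cmp [OF FA_prop that(1,2) [THEN hom_component] El_component [OF that(3)]]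
    by (rule_tac tuples_eqI; simp add: P_sel)
qed

lemma unit_P: "unit_el La P c = tp (\<lambda>i. unit_el La (D i) (pr c i))"
  by (simp add: unit_el_def P_sel)

lemma tensor_P: "tensor_op La P c x y = tp (\<lambda>i. tensor_op La (D i) (pr c i) (pr x i) (pr y i))"
  by (simp add: tensor_op_def P_sel)

text \<open>Every axiom is a membership or an equation, hence follows from its instances in the
  components once \<open>pair\<close>, \<open>prd_id\<close> and \<open>assoc_ar\<close> have been
  computed componentwise.\<close>

sublocale P: FA P La
proof (rule FA.intro [OF P.prop_category_axioms], rule FA_axioms.intro)
  fix f b c d k xs \<omega> x
  show "conn_op P c k xs \<in> El P c" if "c \<in> Ob P" "k \<in> conns La (length xs)" "set xs \<subseteq> El P c"
  proof -
    have "conn_op (D i) (pr c i) k (map (\<lambda>x. pr x i) xs) \<in> El (D i) (pr c i)" if i: "i \<in> I" for i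
      using \<open>c \<in> Ob P\<close> \<open>k \<in> conns La (length xs)\<close> \<open>set xs \<subseteq> El P c\<close> i
      by (intro FA.conn_El [OF FA_D]) (auto simp: Ob_P El_P)
    then show ?thesis by (simp add: El_P P_sel)
  qed
  show "reidx P f (conn_op P c k xs) = conn_op P b k (map (reidx P f) xs)"
    if "f \<in> hom_set P b c" "k \<in> conns La (length xs)" "set xs \<subseteq> El P c"
  proof (rule tuples_eqI)
    fix i assume i: "i \<in> I"
    have "set (map (\<lambda>x. pr x i) xs) \<subseteq> El (D i) (pr c i)"
      using that i by (auto simp: El_P)
    then show "pr (reidx P f (conn_op P c k xs)) i = pr (conn_op P b k (map (reidx P f) xs)) i"
      using that(2) i FA.conn_reidx [OF FA_D [OF i] hom_component [OF that(1) i], of k "map (\<lambda>x. pr x i) xs"]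
      by (simp add: P_sel comp_def)
  qed (simp_all add: P_sel)
  show "monoid \<lparr>carrier = El P c, mult = tensor_op La P c, one = unit_el La P c\<rparr>" if c: "c \<in> Ob P"
  proof -
    have m: "monoid \<lparr>carrier = El (D i) (pr c i), mult = tensor_op La (D i) (pr c i),
        one = unit_el La (D i) (pr c i)\<rparr>" if "i \<in> I" for i
      using FA.monoid [OF FA_D [OF that]] c that by (auto simp: Ob_P)
    note m' = monoid.m_closed [OF m, simplified] monoid.one_closed [OF m, simplified]
      monoid.m_assoc [OF m, simplified] monoid.l_one [OF m, simplified] monoid.r_one [OF m, simplified]
    show ?thesis
      by (rule monoidI) (simp_all add: El_P tensor_P unit_P m', (rule tuples_eqI; simp add: m')+)
  qed
  have El_prd: "pr x i \<in> El (D i) (prd (D i) (pr b i) (pr c i))"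
    if "x \<in> El P (prd P b c)" "i \<in> I" for x b c i
    using El_component [OF that] that(2) by (simp add: P_sel)
  show "quant_op P \<omega> b c x \<in> El P b"
    if "\<omega> \<in> quants La" "b \<in> Ob P" "c \<in> Ob P" "x \<in> El P (prd P b c)"
    using FA.quant_El [OF FA_D that(1) that(2,3) [THEN Ob_component] El_prd [OF that(4)]]
    by (simp add: El_P P_sel)
  show "reidx P f (quant_op P \<omega> b c x) = quant_op P \<omega> b' c (reidx P (prd_id P f c) x)"
    if "\<omega> \<in> quants La" "f \<in> hom_set P b' b" "c \<in> Ob P" "x \<in> El P (prd P b c)" for b'
    unfolding prd_id_P [OF that(2,3)]
    using FA.quant_natural [OF FA_D that(1) hom_component [OF that(2)] Ob_component [OF that(3)]
        El_prd [OF that(4)]]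
    by (rule_tac tuples_eqI; simp add: P_sel)
  show "quant_op P \<omega> b (top_ob P) (reidx P (pr1 P b (top_ob P)) x) = x"
    if "\<omega> \<in> quants La" "b \<in> Ob P" "x \<in> El P b"
    using FA.quant_top [OF FA_D that(1) Ob_component [OF that(2)] El_component [OF that(3)]]
      El_tuples [OF that(3)]
    by (rule_tac tuples_eqI; simp add: P_sel)
  show "quant_op P \<omega> b (prd P c d) (reidx P (assoc_ar P b c d) x) =
      quant_op P \<omega> b c (quant_op P \<omega> (prd P b c) d x)"
    if "\<omega> \<in> quants La" "b \<in> Ob P" "c \<in> Ob P" "d \<in> Ob P" "x \<in> El P (prd P (prd P b c) d)"
  proof (rule tuples_eqI)
    fix i assume i: "i \<in> I"
    have "pr x i \<in> El (D i) (prd (D i) (prd (D i) (pr b i) (pr c i)) (pr d i))"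
      using El_component [OF that(5) i] i by (simp add: P_sel)
    from FA.quant_prd [OF FA_D [OF i] that(1) Ob_component [OF that(2) i]
        Ob_component [OF that(3) i] Ob_component [OF that(4) i] this] i
    show "pr (quant_op P \<omega> b (prd P c d) (reidx P (assoc_ar P b c d) x)) i =
        pr (quant_op P \<omega> b c (quant_op P \<omega> (prd P b c) d x)) i"
      by (simp add: assoc_ar_P [OF that(2-4)] P_sel)
  qed (simp_all add: P_sel)
  show "eq_el P c \<in> El P (prd P c c)" if "c \<in> Ob P"
    using FA.eq_El [OF FA_D Ob_component [OF that]] by (simp add: El_P P_sel)
  show "eq_el P (top_ob P) = unit_el La P (prd P (top_ob P) (top_ob P))"
    by (rule tuples_eqI) (simp_all add: unit_P P_sel FA.eq_top [OF FA_D])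
  show "eq_el P (prd P c d) = tensor_op La P (prd P (prd P c d) (prd P c d))
        (reidx P (pair P (cmp P (pr1 P c d) p) (cmp P (pr1 P c d) q)) (eq_el P c))
        (reidx P (pair P (cmp P (pr2 P c d) p) (cmp P (pr2 P c d) q)) (eq_el P d))"
    if "c \<in> Ob P" "d \<in> Ob P" "p = pr1 P (prd P c d) (prd P c d)" "q = pr2 P (prd P c d) (prd P c d)" for p q
  proof -
    note cd = P.prd_Ob [OF that(1,2)]
    have p: "p \<in> hom_set P (prd P (prd P c d) (prd P c d)) (prd P c d)"
      and q: "q \<in> hom_set P (prd P (prd P c d) (prd P c d)) (prd P c d)"
      unfolding that(3,4) by (rule P.pr1_hom [OF cd cd], rule P.pr2_hom [OF cd cd])
    note p1 = P.pr1_hom [OF that(1,2)] and p2 = P.pr2_hom [OF that(1,2)]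
    note e = pair_P [OF P.cmp_hom [OF p p1] P.cmp_hom [OF q p1]]
      pair_P [OF P.cmp_hom [OF p p2] P.cmp_hom [OF q p2]]
    show ?thesis
      unfolding e
    proof (rule tuples_eqI)
      fix i assume i: "i \<in> I"
      have "pr c i \<in> Ob (D i)" "pr d i \<in> Ob (D i)" using that i by (auto simp: Ob_P)
      from FA.eq_prd [OF FA_D [OF i] this HOL.refl HOL.refl] i
      show "pr (eq_el P (prd P c d)) i = pr (tensor_op La P (prd P (prd P c d) (prd P c d))
          (reidx P (tp (\<lambda>i. pair (D i) (pr (cmp P (pr1 P c d) p) i) (pr (cmp P (pr1 P c d) q) i))) (eq_el P c))
          (reidx P (tp (\<lambda>i. pair (D i) (pr (cmp P (pr2 P c d) p) i) (pr (cmp P (pr2 P c d) q) i))) (eq_el P d))) i"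
        by (simp add: tensor_P P_sel that(3,4))
    qed (simp_all add: P_sel tensor_P)
  qed
qed

section \<open>Projections, and closure of \<open>FA_L\<close> under products\<close>

definition projection :: "'u \<Rightarrow> ('u, 'u, 'u, 'u, 'u, 'u, 'u) morphism" where
  "projection i = \<lparr>src = P, tgt = D i, ob_map = (\<lambda>c\<in>Ob P. pr c i), ar_map = (\<lambda>f\<in>Ar P. pr f i),
     el_map = (\<lambda>c\<in>Ob P. \<lambda>x\<in>El P c. pr x i)\<rparr>"

lemma FA_morphism_projection:
  assumes i: "i \<in> I"
  shows "FA_morphism La (projection i)"
proof -
  interpret D: FA "D i" La by (rule FA_D [OF i])
  have F: "src (projection i) = P" "tgt (projection i) = D i"
    "\<And>c. c \<in> Ob P \<Longrightarrow> ob_map (projection i) c = pr c i"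
    "\<And>f. f \<in> Ar P \<Longrightarrow> ar_map (projection i) f = pr f i"
    "\<And>c x. c \<in> Ob P \<Longrightarrow> x \<in> El P c \<Longrightarrow> el_map (projection i) c x = pr x i"
    by (simp_all add: projection_def)
  have A: "ar_map (projection i) f = pr f i" if "f \<in> hom_set P b c" for f b c
    using F(4) P.hom_Ar [OF that] .
  show ?thesis
  proof (rule FA_morphism_strictI; unfold F(1,2))
    show "FA P La" "FA (D i) La" by unfold_locales
    show "ob_map (projection i) \<in> Ob P \<rightarrow>\<^sub>E Ob (D i)" "ar_map (projection i) \<in> Ar P \<rightarrow>\<^sub>E Ar (D i)"
      using i by (auto simp: projection_def P_iff)
    show "el_map (projection i) \<in> (\<Pi>\<^sub>E c\<in>Ob P. El P c \<rightarrow>\<^sub>E El (D i) (ob_map (projection i) c))"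
      using i by (auto simp: projection_def El_P)
    show "ar_map (projection i) f \<in> hom_set (D i) (ob_map (projection i) b) (ob_map (projection i) c)"
      if f: "f \<in> hom_set P b c" for f b c
      using A [OF f] F(3) P.hom_Ob [OF f] f i by (auto simp: hom_P)
    show "ar_map (projection i) (idn P c) = idn (D i) (ob_map (projection i) c)" if c: "c \<in> Ob P" for c
      using A [OF P.idn_hom [OF c]] F(3) [OF c] i by (simp add: P_sel)
    show "ar_map (projection i) (cmp P g f) = cmp (D i) (ar_map (projection i) g) (ar_map (projection i) f)"
      if f: "f \<in> hom_set P a b" and g: "g \<in> hom_set P b c" for f g a b c
      using A [OF P.cmp_hom [OF f g]] A [OF f] A [OF g] i by (simp add: P_sel)
    show "ob_map (projection i) (top_ob P) = top_ob (D i)"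
      using F(3) [OF P.top_Ob] i by (simp add: P_sel)
    fix b c assume bc: "b \<in> Ob P" "c \<in> Ob P"
    show "ob_map (projection i) (prd P b c) = prd (D i) (ob_map (projection i) b) (ob_map (projection i) c)"
      using F(3) [OF P.prd_Ob [OF bc]] F(3) bc i by (simp add: P_sel)
    show "ar_map (projection i) (pr1 P b c) = pr1 (D i) (ob_map (projection i) b) (ob_map (projection i) c)"
      using A [OF P.pr1_hom [OF bc]] F(3) bc i by (simp add: P_sel)
    show "ar_map (projection i) (pr2 P b c) = pr2 (D i) (ob_map (projection i) b) (ob_map (projection i) c)"
      using A [OF P.pr2_hom [OF bc]] F(3) bc i by (simp add: P_sel)
    fix x
    show "el_map (projection i) b (quant_op P \<omega> b c x) =
        quant_op (D i) \<omega> (ob_map (projection i) b) (ob_map (projection i) c) (el_map (projection i) (prd P b c) x)"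
      if "\<omega> \<in> quants La" "x \<in> El P (prd P b c)" for \<omega>
      using F(3,5) P.quant_El [OF that(1) bc that(2)] P.prd_Ob [OF bc] bc that i by (simp add: P_sel)
  next
    fix c assume c: "c \<in> Ob P"
    show "(el_map (projection i) c x, el_map (projection i) c y) \<in> Po (D i) (ob_map (projection i) c)"
      if "(x, y) \<in> Po P c" for x y
      using F(3,5) c that P.Po_El [OF c that] i by (simp add: Po_P)
    show "el_map (projection i) c (conn_op P c k xs) =
        conn_op (D i) (ob_map (projection i) c) k (map (el_map (projection i) c) xs)"
      if "k \<in> conns La (length xs)" "set xs \<subseteq> El P c" for k xs
    proof -
      have "map (el_map (projection i) c) xs = map (\<lambda>x. pr x i) xs"
        using F(5) [OF c] that by auto
      show ?thesis
        unfolding \<open>map (el_map (projection i) c) xs = map (\<lambda>x. pr x i) xs\<close>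
        using F(3,5) P.conn_El [OF c that] c i by (simp add: P_sel)
    qed
    show "el_map (projection i) (prd P c c) (eq_el P c) = eq_el (D i) (ob_map (projection i) c)"
      using F(3,5) P.eq_El [OF c] P.prd_Ob [OF c c] c i by (simp add: P_sel)
  next
    show "el_map (projection i) b (reidx P f x) = reidx (D i) (ar_map (projection i) f) (el_map (projection i) c x)"
      if f: "f \<in> hom_set P b c" and x: "x \<in> El P c" for f b c x
      using F(5) P.hom_Ob [OF f] P.reidx_El [OF f x] A [OF f] x i by (simp add: P_sel)
  qed
qed

text \<open>Equality and order of the product are componentwise, so the projections are jointly
  faithful and jointly reflect the order.\<close>

lemma in_FAL_P:
  assumes "\<And>i. i \<in> I \<Longrightarrow> in_FAL La L (D i)"
  shows "in_FAL La L P"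
proof (rule in_FAL_reflect [OF language, where F = projection and I = I])
  show "FA P La" by unfold_locales
  fix i assume i: "i \<in> I"
  show "FA_morphism La (projection i)" by (rule FA_morphism_projection [OF i])
  show "src (projection i) = P" "in_FAL La L (tgt (projection i))"
    using assms i by (simp_all add: projection_def)
next
  fix b c f g assume f: "f \<in> hom_set P b c" and g: "g \<in> hom_set P b c"
    and "\<And>i. i \<in> I \<Longrightarrow> ar_map (projection i) f = ar_map (projection i) g"
  then show "f = g"
    using P.hom_Ar [OF f] P.hom_Ar [OF g] by (rule_tac tuples_eqI; simp add: projection_def P_iff)
next
  fix c x y assume "c \<in> Ob P" "x \<in> El P c" "y \<in> El P c"
    and "\<And>i. i \<in> I \<Longrightarrow> (el_map (projection i) c x, el_map (projection i) c y)
      \<in> Po (tgt (projection i)) (ob_map (projection i) c)"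
  then show "(x, y) \<in> Po P c"
    by (auto simp: Po_P projection_def El_P)
qed

end

section \<open>The morphism into a product induced by a family of morphisms\<close>

locale morphism_family =
  fixes small :: "'u set \<Rightarrow> bool" and tup :: "'u set \<Rightarrow> ('u \<Rightarrow> 'u) \<Rightarrow> 'u" and La :: "'u language"
    and I :: "'u set" and A :: "('o, 'a, 'p, 'u) propcat"
    and F :: "'u \<Rightarrow> ('o, 'a, 'p, 'u, 'u, 'u, 'u) morphism"
  assumes universe: "universe small tup" and language: "is_language small La"
    and small_I: "small I" and FA_A: "FA A La"
    and F: "\<And>i. i \<in> I \<Longrightarrow> FA_morphism La (F i)" and src_F: "\<And>i. i \<in> I \<Longrightarrow> src (F i) = A"
begin

sublocale product_family small tup La I "\<lambda>i. tgt (F i)"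
  by (rule product_family.intro [OF universe language small_I FA_morphism.axioms(2) [OF F]])

sublocale A: FA A La by (rule FA_A)

abbreviation "T \<equiv> tuple_morphism tup I A F"

lemma T_sel:
  "src T = A" "tgt T = P"
  "c \<in> Ob A \<Longrightarrow> ob_map T c = tp (\<lambda>i. ob_map (F i) c)"
  "f \<in> Ar A \<Longrightarrow> ar_map T f = tp (\<lambda>i. ar_map (F i) f)"
  "c \<in> Ob A \<Longrightarrow> x \<in> El A c \<Longrightarrow> el_map T c x = tp (\<lambda>i. el_map (F i) c x)"
  by (simp_all add: tuple_morphism_def)

lemma T_hom: "f \<in> hom_set A b c \<Longrightarrow> ar_map T f = tp (\<lambda>i. ar_map (F i) f)"
  using T_sel(4) A.hom_Ar by blast

lemma T_hom_hom: "f \<in> hom_set A b c \<Longrightarrow> ar_map T f \<in> hom_set P (ob_map T b) (ob_map T c)"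
  using A.hom_Ob by (auto simp: T_hom T_sel hom_P src_F intro: FA_morphism.map_hom [OF F])

lemma T_comparison:
  assumes bc: "b \<in> Ob A" "c \<in> Ob A"
  shows "comparison T b c = tp (\<lambda>i. comparison (F i) b c)"
proof -
  note p = T_hom_hom [OF A.pr1_hom [OF bc]] T_hom_hom [OF A.pr2_hom [OF bc]]
  show ?thesis
    unfolding comparison_def T_sel(1,2) pair_P [OF p]
    by (rule tuples_eqI) (simp_all add: T_hom [OF A.pr1_hom [OF bc]] T_hom [OF A.pr2_hom [OF bc]] src_F)
qed

lemma T_comparison_hom:
  assumes bc: "b \<in> Ob A" "c \<in> Ob A"
  shows "comparison T b c \<in> hom_set P (ob_map T (prd A b c)) (prd P (ob_map T b) (ob_map T c))"
  unfolding comparison_def T_sel(1,2)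
  by (rule P.pair_hom [OF T_hom_hom [OF A.pr1_hom [OF bc]] T_hom_hom [OF A.pr2_hom [OF bc]]])

lemma T_inverse_of_comparison:
  assumes bc: "b \<in> Ob A" "c \<in> Ob A"
  shows "inverse_of P (comparison T b c) (tp (\<lambda>i. inv_ar (tgt (F i)) (comparison (F i) b c)))"
proof (rule inverse_of_P [OF T_comparison_hom [OF bc]])
  fix i assume i: "i \<in> I"
  show "inverse_of (tgt (F i)) (pr (comparison T b c) i) (inv_ar (tgt (F i)) (comparison (F i) b c))"
    using fp_category.inverse_of_inv_ar [OF FA_fp [OF i]] FA_morphism.preserves_prd [OF F [OF i]]
      src_F [OF i] bc i by (simp add: T_comparison [OF bc])
qed

text \<open>The members preserve products only up to isomorphism, so the criterion for strict
  morphisms does not apply. The inverse comparison in the quantifier axiom is evaluated by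
  \<open>T_inverse_of_comparison\<close>.\<close>

lemma FA_morphism_T: "FA_morphism La T"
proof (intro FA_morphism.intro FA_morphism_axioms.intro; unfold T_sel(1,2))
  show "FA A La" "FA P La" by unfold_locales
  show "ob_map T \<in> Ob A \<rightarrow>\<^sub>E Ob P"
    using FA_morphism.ob_map_Ob [OF F] src_F by (auto simp: tuple_morphism_def Ob_P)
  show "ar_map T \<in> Ar A \<rightarrow>\<^sub>E Ar P"
    using PiE_mem [OF FA_morphism.ar_map [OF F]] src_F by (auto simp: tuple_morphism_def Ar_P)
  show "el_map T \<in> (\<Pi>\<^sub>E c\<in>Ob A. El A c \<rightarrow>\<^sub>E El P (ob_map T c))"
    using FA_morphism.el_map_El [OF F] src_F by (auto simp: tuple_morphism_def El_P)
  show "ar_map T f \<in> hom_set P (ob_map T b) (ob_map T c)" if "f \<in> hom_set A b c" for f b c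
    by (rule T_hom_hom [OF that])
  show "ar_map T (idn A c) = idn P (ob_map T c)" if c: "c \<in> Ob A" for c
    using FA_morphism.map_idn [OF F] src_F c
    by (rule_tac tuples_eqI; simp add: T_hom [OF A.idn_hom [OF c]] T_sel P_sel)
  show "ar_map T (cmp A g f) = cmp P (ar_map T g) (ar_map T f)"
    if "f \<in> hom_set A a b" "g \<in> hom_set A b c" for f g a b c
    using FA_morphism.map_cmp [OF F] src_F that
    by (rule_tac tuples_eqI; simp add: T_hom [OF A.cmp_hom [OF that]] T_hom [OF that(1)] T_hom [OF that(2)] P_sel)
  show "is_iso P (bang P (ob_map T (top_ob A)))"
  proof -
    have T: "ob_map T (top_ob A) \<in> Ob P"
      using FA_morphism.ob_map_Ob [OF F] src_F A.top_Ob by (auto simp: T_sel Ob_P)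
    have "inverse_of P (bang P (ob_map T (top_ob A)))
        (tp (\<lambda>i. inv_ar (tgt (F i)) (bang (tgt (F i)) (ob_map (F i) (top_ob A)))))"
    proof (rule inverse_of_P [OF P.bang_hom [OF T]])
      fix i assume i: "i \<in> I"
      show "inverse_of (tgt (F i)) (pr (bang P (ob_map T (top_ob A))) i)
          (inv_ar (tgt (F i)) (bang (tgt (F i)) (ob_map (F i) (top_ob A))))"
        using fp_category.inverse_of_inv_ar [OF FA_fp [OF i]] FA_morphism.preserves_top [OF F [OF i]]
          src_F [OF i] i unfolding bang_P [OF T] by (simp add: T_sel(3) [OF A.top_Ob])
    qed
    then show ?thesis by (auto simp: is_iso_def)
  qed
  show "is_iso P (comparison T b c)" if "b \<in> Ob A" "c \<in> Ob A" for b c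
    using T_inverse_of_comparison [OF that] by (auto simp: is_iso_def)
  show "(el_map T c x, el_map T c y) \<in> Po P (ob_map T c)" if c: "c \<in> Ob A" and xy: "(x, y) \<in> Po A c" for c x y
  proof -
    have "ob_map T c \<in> Ob P"
      using FA_morphism.ob_map_Ob [OF F] src_F c by (auto simp: T_sel Ob_P)
    then show ?thesis
      using FA_morphism.map_mono [OF F] src_F c xy A.Po_El [OF c xy] by (simp add: Po_P T_sel)
  qed
  show "el_map T b (reidx A f x) = reidx P (ar_map T f) (el_map T c x)"
    if f: "f \<in> hom_set A b c" and x: "x \<in> El A c" for f b c x
    using FA_morphism.map_reidx [OF F] src_F f x A.hom_Ob [OF f] A.reidx_El [OF f x]
    by (rule_tac tuples_eqI; simp add: T_hom [OF f] T_sel P_sel)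
  show "el_map T c (conn_op A c k xs) = conn_op P (ob_map T c) k (map (el_map T c) xs)"
    if c: "c \<in> Ob A" and xs: "k \<in> conns La (length xs)" "set xs \<subseteq> El A c" for c k xs
  proof (rule tuples_eqI)
    fix i assume i: "i \<in> I"
    have e: "map (\<lambda>x. pr (el_map T c x) i) xs = map (el_map (F i) c) xs"
      using xs c i by (auto simp: T_sel)
    have "pr (conn_op P (ob_map T c) k (map (el_map T c) xs)) i =
        conn_op (tgt (F i)) (ob_map (F i) c) k (map (\<lambda>x. pr (el_map T c x) i) xs)"
      using c i by (simp add: P_sel T_sel(3) comp_def)
    then show "pr (el_map T c (conn_op A c k xs)) i = pr (conn_op P (ob_map T c) k (map (el_map T c) xs)) i"
      unfolding e using FA_morphism.map_conn [OF F [OF i]] src_F [OF i] c xs i A.conn_El [OF c xs]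
      by (simp add: T_sel)
  qed (simp_all add: T_sel c xs A.conn_El P_sel)
  show "el_map T b (quant_op A \<omega> b c x) = quant_op P \<omega> (ob_map T b) (ob_map T c)
      (reidx P (inv_ar P (comparison T b c)) (el_map T (prd A b c) x))"
    if \<omega>: "\<omega> \<in> quants La" and bc: "b \<in> Ob A" "c \<in> Ob A" and x: "x \<in> El A (prd A b c)" for \<omega> b c x
    unfolding P.inv_ar_eqI [OF T_inverse_of_comparison [OF bc]]
    using FA_morphism.map_quant [OF F] src_F \<omega> bc x A.quant_El [OF \<omega> bc x] A.prd_Ob [OF bc]
    by (rule_tac tuples_eqI; simp add: T_sel P_sel)
  show "el_map T (prd A c c) (eq_el A c) = reidx P (comparison T c c) (eq_el P (ob_map T c))"
    if c: "c \<in> Ob A" for c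
    unfolding T_comparison [OF c c]
    using FA_morphism.map_eq [OF F] src_F c A.eq_El [OF c] A.prd_Ob [OF c c]
    by (rule_tac tuples_eqI; simp add: T_sel P_sel)
qed

end


section \<open>Images of morphisms\<close>

text \<open>The objects of the image of \<open>G\<close> are those of its source, renamed by \<open>j\<close>; its arrows and
  elements are the values of \<open>G\<close>, the arrows being tagged with their domain and codomain because
  \<open>G\<close> need not be injective on objects.\<close>

definition image_propcat :: "('o, 'a, 'p, 'o2, 'a2, 'p2, 'u) morphism \<Rightarrow> ('o \<Rightarrow> 'e) \<Rightarrow>
    ('e \<times> 'e \<times> 'a2 \<Rightarrow> 'b) \<Rightarrow> ('e, 'b, 'p2, 'u) propcat" where
  "image_propcat G j tag =
     (let C = src G; D = tgt G; ob = inv_into (Ob C) j; arr = (\<lambda>x. snd (snd (inv_into UNIV tag x)));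
          el = (\<lambda>u. el_map G (ob u) ` El C (ob u))
      in \<lparr>Ob = j ` Ob C,
          Ar = {tag (j b, j c, ar_map G f) | b c f. f \<in> hom_set C b c},
          dm = (\<lambda>x. fst (inv_into UNIV tag x)),
          cd = (\<lambda>x. fst (snd (inv_into UNIV tag x))),
          idn = (\<lambda>u. tag (u, u, idn D (ob_map G (ob u)))),
          cmp = (\<lambda>y x. tag (fst (inv_into UNIV tag x), fst (snd (inv_into UNIV tag y)), cmp D (arr y) (arr x))),
          top_ob = j (top_ob C),
          prd = (\<lambda>u v. j (prd C (ob u) (ob v))),
          pr1 = (\<lambda>u v. tag (j (prd C (ob u) (ob v)), u, ar_map G (pr1 C (ob u) (ob v)))),
          pr2 = (\<lambda>u v. tag (j (prd C (ob u) (ob v)), v, ar_map G (pr2 C (ob u) (ob v)))),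
          El = el,
          Po = (\<lambda>u. {(x, y). x \<in> el u \<and> y \<in> el u \<and> (x, y) \<in> Po D (ob_map G (ob u))}),
          reidx = (\<lambda>x. reidx D (arr x)),
          conn_op = (\<lambda>u. conn_op D (ob_map G (ob u))),
          quant_op = (\<lambda>\<omega> u v x. quant_op D \<omega> (ob_map G (ob u)) (ob_map G (ob v))
            (reidx D (inv_ar D (comparison G (ob u) (ob v))) x)),
          eq_el = (\<lambda>u. reidx D (comparison G (ob u) (ob u)) (eq_el D (ob_map G (ob u))))\<rparr>)"

text \<open>The codings stay abstract here. For models, \<open>j\<close> will code contexts and
  \<open>tag\<close> triples by elements of \<open>'u\<close>, because the target of a model has its
  carriers there.\<close>

locale morphism_image = FA_morphism La G
  for La :: "'u language" and G :: "('o, 'a, 'p, 'o2, 'a2, 'p2, 'u) morphism" +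
  fixes j :: "'o \<Rightarrow> 'e" and tag :: "'e \<times> 'e \<times> 'a2 \<Rightarrow> 'b"
  assumes inj_j: "inj_on j (Ob (src G))" and inj_tag: "inj tag"
begin

abbreviation "C \<equiv> src G"
abbreviation "D \<equiv> tgt G"
abbreviation "E \<equiv> image_propcat G j tag"
abbreviation "ob \<equiv> inv_into (Ob C) j"

definition "ar b c f = tag (j b, j c, ar_map G f)"

lemma ob_j [simp]: "c \<in> Ob C \<Longrightarrow> ob (j c) = c"
  using inj_j by simp

lemma inv_tag [simp]: "inv_into UNIV tag (tag x) = x"
  using inj_tag by simp

text \<open>By injectivity of both codings, once the endpoints are fixed a representative matters
  only through its value under \<open>G\<close>.\<close>

lemma ar_eq_iff:
  "b \<in> Ob C \<Longrightarrow> c \<in> Ob C \<Longrightarrow> b' \<in> Ob C \<Longrightarrow> c' \<in> Ob C \<Longrightarrow>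
    ar b c f = ar b' c' g \<longleftrightarrow> b = b' \<and> c = c' \<and> ar_map G f = ar_map G g"
  using inj_tag inj_j by (auto simp: ar_def inj_eq inj_on_eq_iff)

lemma Ob_E: "Ob E = j ` Ob C"
  by (simp add: image_propcat_def Let_def)

lemma Ar_E: "Ar E = {ar b c f | b c f. f \<in> hom_set C b c}"
  by (simp add: image_propcat_def Let_def ar_def)

lemma E_dm_cd: "dm E (ar b c f) = j b" "cd E (ar b c f) = j c"
  by (simp_all add: image_propcat_def Let_def ar_def)

lemma ar_hom: "f \<in> hom_set C b c \<Longrightarrow> ar b c f \<in> hom_set E (j b) (j c)"
  using E_dm_cd by (auto simp: hom_set_def [of E] Ar_E)

lemma hom_E_cases:
  assumes "x \<in> hom_set E u v"
  obtains b c f where "b \<in> Ob C" "c \<in> Ob C" "f \<in> hom_set C b c" "u = j b" "v = j c" "x = ar b c f"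
proof -
  from assms obtain b c f where f: "f \<in> hom_set C b c" "x = ar b c f"
    by (auto simp: hom_set_def [of E] Ar_E)
  then have "u = j b" "v = j c" using assms E_dm_cd by (auto simp: hom_set_def [of E])
  then show thesis using that f A.hom_Ob by blast
qed

text \<open>Distinct objects of \<open>C\<close> stay distinct in \<open>E\<close>, so a
  representative can be found between prescribed objects; in particular composable arrows lift to
  composable arrows. This could fail if objects were identified along \<open>G\<close>.\<close>

lemma hom_E_obtain:
  assumes "x \<in> hom_set E (j b) (j c)" "b \<in> Ob C" "c \<in> Ob C"
  obtains f where "f \<in> hom_set C b c" "x = ar b c f"
  using hom_E_cases [OF assms(1)] inj_onD [OF inj_j] assms by metis

lemma idn_E: "c \<in> Ob C \<Longrightarrow> idn E (j c) = ar c c (idn C c)"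
  using map_idn by (simp add: image_propcat_def Let_def ar_def)

text \<open>Composition in \<open>E\<close> is computed in \<open>D\<close> after decoding; since
  \<open>G\<close> preserves it, it can be computed on representatives in \<open>C\<close>. The
  other fields are treated alike, and from here on \<open>E\<close> is handled through
  representatives.\<close>

lemma cmp_E: "f \<in> hom_set C a b \<Longrightarrow> g \<in> hom_set C b c \<Longrightarrow>
    cmp E (ar b c g) (ar a b f) = ar a c (cmp C g f)"
  using map_cmp by (simp add: image_propcat_def Let_def ar_def)

lemma top_E: "top_ob E = j (top_ob C)"
  by (simp add: image_propcat_def Let_def)

lemma prd_E: "b \<in> Ob C \<Longrightarrow> c \<in> Ob C \<Longrightarrow> prd E (j b) (j c) = j (prd C b c)"
  by (simp add: image_propcat_def Let_def)

lemma pr_E: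
  "b \<in> Ob C \<Longrightarrow> c \<in> Ob C \<Longrightarrow> pr1 E (j b) (j c) = ar (prd C b c) b (pr1 C b c)"
  "b \<in> Ob C \<Longrightarrow> c \<in> Ob C \<Longrightarrow> pr2 E (j b) (j c) = ar (prd C b c) c (pr2 C b c)"
  by (simp_all add: image_propcat_def Let_def ar_def)

lemma El_E: "c \<in> Ob C \<Longrightarrow> El E (j c) = el_map G c ` El C c"
  by (simp add: image_propcat_def Let_def)

lemma Po_E: "c \<in> Ob C \<Longrightarrow>
    (x, y) \<in> Po E (j c) \<longleftrightarrow> x \<in> El E (j c) \<and> y \<in> El E (j c) \<and> (x, y) \<in> Po D (ob_map G c)"
  by (simp add: image_propcat_def Let_def)

lemma reidx_E: "f \<in> hom_set C b c \<Longrightarrow> x \<in> El C c \<Longrightarrow>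
    reidx E (ar b c f) (el_map G c x) = el_map G b (reidx C f x)"
  using map_reidx by (simp add: image_propcat_def Let_def ar_def)

lemma conn_E: "c \<in> Ob C \<Longrightarrow> k \<in> conns La (length xs) \<Longrightarrow> set xs \<subseteq> El C c \<Longrightarrow>
    conn_op E (j c) k (map (el_map G c) xs) = el_map G c (conn_op C c k xs)"
  using map_conn by (simp add: image_propcat_def Let_def)

lemma quant_E: "\<omega> \<in> quants La \<Longrightarrow> b \<in> Ob C \<Longrightarrow> c \<in> Ob C \<Longrightarrow> x \<in> El C (prd C b c) \<Longrightarrow>
    quant_op E \<omega> (j b) (j c) (el_map G (prd C b c) x) = el_map G b (quant_op C \<omega> b c x)"
  using map_quant by (simp add: image_propcat_def Let_def)

lemma eq_E: "c \<in> Ob C \<Longrightarrow> eq_el E (j c) = el_map G (prd C c c) (eq_el C c)"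
  using map_eq by (simp add: image_propcat_def Let_def)

text \<open>Connectives take lists of elements, so representatives of a whole list have to be chosen
  at once.\<close>

lemma El_E_lists:
  assumes "c \<in> Ob C" "set ys \<subseteq> El E (j c)"
  obtains xs where "set xs \<subseteq> El C c" "ys = map (el_map G c) xs"
proof -
  have "ys \<in> lists (el_map G c ` El C c)"
    using assms by (auto simp: El_E)
  then show thesis using that unfolding lists_image by blast
qed

sublocale E: fp_category E
proof
  fix x y z u v w
  show "dm E x \<in> Ob E" "cd E x \<in> Ob E" if "x \<in> Ar E"
    using that A.hom_Ob by (auto simp: Ar_E Ob_E E_dm_cd)
  show "idn E u \<in> hom_set E u u" if "u \<in> Ob E"
    using that ar_hom A.idn_hom by (auto simp: Ob_E idn_E)
  show "cmp E y x \<in> hom_set E u w" if x: "x \<in> hom_set E u v" and y: "y \<in> hom_set E v w"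
  proof -
    from x obtain a b f where f: "a \<in> Ob C" "b \<in> Ob C" "f \<in> hom_set C a b" "u = j a" "v = j b" "x = ar a b f"
      by (rule hom_E_cases)
    from y obtain b' c g where g: "b' \<in> Ob C" "c \<in> Ob C" "g \<in> hom_set C b' c" "v = j b'" "w = j c" "y = ar b' c g"
      by (rule hom_E_cases)
    have "b' = b" using f g inj_j by (simp add: inj_on_eq_iff)
    then show ?thesis using f g ar_hom A.cmp_hom cmp_E by metis
  qed
  show "cmp E (idn E v) x = x" "cmp E x (idn E u) = x" if x: "x \<in> hom_set E u v"
    using hom_E_cases [OF x] cmp_E A.idn_hom idn_E A.idn_left A.idn_right by metis+
  show "cmp E z (cmp E y x) = cmp E (cmp E z y) x"
    if x: "x \<in> hom_set E u v" and y: "y \<in> hom_set E v w" and z: "z \<in> hom_set E w t" for t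
  proof -
    from x obtain a b f where f: "a \<in> Ob C" "b \<in> Ob C" "f \<in> hom_set C a b" "u = j a" "v = j b" "x = ar a b f"
      by (rule hom_E_cases)
    from z obtain c d h where h: "c \<in> Ob C" "d \<in> Ob C" "h \<in> hom_set C c d" "w = j c" "t = j d" "z = ar c d h"
      by (rule hom_E_cases)
    from y f h obtain g where g: "g \<in> hom_set C b c" "y = ar b c g"
      using hom_E_obtain by metis
    show ?thesis
      using cmp_E [OF f(3) g(1)] cmp_E [OF g(1) h(3)] cmp_E [OF A.cmp_hom [OF f(3) g(1)] h(3)]
        cmp_E [OF f(3) A.cmp_hom [OF g(1) h(3)]] A.cmp_assoc [OF f(3) g(1) h(3)] f g h by simp
  qed
  show "top_ob E \<in> Ob E" using A.top_Ob by (simp add: Ob_E top_E)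
  show "\<exists>!f. f \<in> hom_set E u (top_ob E)" if u: "u \<in> Ob E"
  proof -
    from u obtain b where b: "b \<in> Ob C" "u = j b" by (auto simp: Ob_E)
    note h = A.bang_hom [OF b(1)]
    show ?thesis
    proof (rule ex1I [of _ "ar b (top_ob C) (bang C b)"])
      show "ar b (top_ob C) (bang C b) \<in> hom_set E u (top_ob E)"
        using ar_hom [OF h] b top_E by simp
      show "f = ar b (top_ob C) (bang C b)" if "f \<in> hom_set E u (top_ob E)" for f
      proof (rule hom_E_obtain [of f b "top_ob C"])
        show "f \<in> hom_set E (j b) (j (top_ob C))" using that b top_E by simp
        show "f = ar b (top_ob C) (bang C b)" if "g \<in> hom_set C b (top_ob C)" "f = ar b (top_ob C) g" for g
          using that A.bang_eqI by simp
      qed (use b A.top_Ob in auto)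
    qed
  qed
  show "prd E u v \<in> Ob E" if "u \<in> Ob E" "v \<in> Ob E"
    using that A.prd_Ob by (auto simp: Ob_E prd_E)
  show "pr1 E u v \<in> hom_set E (prd E u v) u" "pr2 E u v \<in> hom_set E (prd E u v) v"
    if "u \<in> Ob E" "v \<in> Ob E"
    using that ar_hom A.pr1_hom A.pr2_hom by (auto simp: Ob_E pr_E prd_E)
  show "\<exists>!h. h \<in> hom_set E w (prd E u v) \<and> cmp E (pr1 E u v) h = x \<and> cmp E (pr2 E u v) h = y"
    if x: "x \<in> hom_set E w u" and y: "y \<in> hom_set E w v"
  proof -
    from x obtain a b f where f: "a \<in> Ob C" "b \<in> Ob C" "f \<in> hom_set C a b" "w = j a" "u = j b" "x = ar a b f"
      by (rule hom_E_cases)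
    from y obtain a' c g' where g': "a' \<in> Ob C" "c \<in> Ob C" "v = j c"
      by (rule hom_E_cases)
    then obtain g where g: "g \<in> hom_set C a c" "y = ar a c g"
      using y f hom_E_obtain by metis
    note bc = f(2) g'(2)
    note p = A.pair_props [OF f(3) g(1)]
    show ?thesis
    proof (rule ex1I [of _ "ar a (prd C b c) (pair C f g)"])
      show "ar a (prd C b c) (pair C f g) \<in> hom_set E w (prd E u v) \<and>
          cmp E (pr1 E u v) (ar a (prd C b c) (pair C f g)) = x \<and>
          cmp E (pr2 E u v) (ar a (prd C b c) (pair C f g)) = y"
        using ar_hom [OF p(1)] cmp_E [OF p(1) A.pr1_hom [OF bc]] cmp_E [OF p(1) A.pr2_hom [OF bc]]
          p f g g' by (simp add: prd_E pr_E)
      fix h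
      assume h: "h \<in> hom_set E w (prd E u v) \<and> cmp E (pr1 E u v) h = x \<and> cmp E (pr2 E u v) h = y"
      then have "h \<in> hom_set E (j a) (j (prd C b c))" using f g' by (simp add: prd_E)
      then obtain k where k: "k \<in> hom_set C a (prd C b c)" "h = ar a (prd C b c) k"
        using hom_E_obtain f(1) A.prd_Ob [OF bc] by metis
      have "ar a b (cmp C (pr1 C b c) k) = ar a b f" "ar a c (cmp C (pr2 C b c) k) = ar a c g"
        using h k cmp_E [OF k(1) A.pr1_hom [OF bc]] cmp_E [OF k(1) A.pr2_hom [OF bc]] f g g'
        by (simp_all add: pr_E)
      \<comment> \<open>The representative \<open>k\<close> need not be \<open>pair C f g\<close>,
        since its projections agree with \<open>f\<close> and \<open>g\<close> only under
        \<open>G\<close>. Product preservation makes the values under \<open>G\<close> coincide, and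
        arrows of \<open>E\<close> with given endpoints see no more than that.\<close>
      then have "ar_map G k = ar_map G (pair C f g)"
        using p f(1) bc by (intro map_prd_eqI [OF k(1) p(1) bc]) (simp_all add: ar_eq_iff)
      then show "h = ar a (prd C b c) (pair C f g)"
        using k by (simp add: ar_def)
    qed
  qed
qed

lemma pair_E:
  assumes f: "f \<in> hom_set C a b" and g: "g \<in> hom_set C a c"
  shows "pair E (ar a b f) (ar a c g) = ar a (prd C b c) (pair C f g)"
proof -
  note p = A.pair_props [OF f g]
  have bc: "b \<in> Ob C" "c \<in> Ob C" using f g A.hom_Ob by auto
  show ?thesis
    using ar_hom [OF p(1)] cmp_E [OF p(1) A.pr1_hom [OF bc]] cmp_E [OF p(1) A.pr2_hom [OF bc]] p bc
    by (intro E.pair_eqI [of _ "j a" "j b" "j c"]) (simp_all add: prd_E pr_E Ob_E)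
qed

lemma prd_id_E:
  assumes f: "f \<in> hom_set C b' b" and c: "c \<in> Ob C"
  shows "prd_id E (ar b' b f) (j c) = ar (prd C b' c) (prd C b c) (prd_id C f c)"
proof -
  have b': "b' \<in> Ob C" using A.hom_Ob [OF f] by simp
  note p = A.pr1_hom [OF b' c]
  show ?thesis
    using pair_E [OF A.cmp_hom [OF p f] A.pr2_hom [OF b' c]] cmp_E [OF p f] b' c f
    by (simp add: prd_id_def E_dm_cd pr_E A.hom_dm_cd [OF f])
qed

lemma assoc_ar_E:
  assumes b: "b \<in> Ob C" and c: "c \<in> Ob C" and d: "d \<in> Ob C"
  shows "assoc_ar E (j b) (j c) (j d) =
    ar (prd C b (prd C c d)) (prd C (prd C b c) d) (assoc_ar C b c d)"
proof -
  note cd = A.prd_Ob [OF c d]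
  note p = A.pr1_hom [OF b cd] and q = A.pr2_hom [OF b cd]
  note q1 = A.cmp_hom [OF q A.pr1_hom [OF c d]] and q2 = A.cmp_hom [OF q A.pr2_hom [OF c d]]
  show ?thesis
    unfolding assoc_ar_def Let_def
    using pair_E [OF A.pair_hom [OF p q1] q2] pair_E [OF p q1] cmp_E [OF q A.pr1_hom [OF c d]]
      cmp_E [OF q A.pr2_hom [OF c d]] b c d cd by (simp add: prd_E pr_E)
qed

sublocale E: prop_category E
proof
  fix u v w x y f g
  show "partial_order_on (El E u) (Po E u)" if u: "u \<in> Ob E"
  proof -
    from u obtain c where c: "c \<in> Ob C" "u = j c" by (auto simp: Ob_E)
    note Dc = ob_map_Ob [OF c(1)]
    show ?thesis
      unfolding partial_order_on_def preorder_on_def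
    proof (intro conjI)
      show "Po E u \<subseteq> El E u \<times> El E u" using c by (auto simp: Po_E)
      show "refl_on (El E u) (Po E u)"
        using B.Po_refl [OF Dc] el_map_El [OF c(1)] c by (auto simp: Po_E El_E refl_on_def)
      show "trans (Po E u)"
        using B.Po_trans [OF Dc] c by (auto simp: Po_E intro!: transI)
      show "antisym (Po E u)"
        using B.Po_antisym [OF Dc] c by (auto simp: Po_E intro!: antisymI)
    qed
  qed
  show "(reidx E f x, reidx E f y) \<in> Po E u" if f: "f \<in> hom_set E u v" and xy: "(x, y) \<in> Po E v"
  proof -
    from f obtain b c f' where f': "b \<in> Ob C" "c \<in> Ob C" "f' \<in> hom_set C b c" "u = j b" "v = j c" "f = ar b c f'"
      by (rule hom_E_cases)
    from xy f' obtain x' y' where xy': "x' \<in> El C c" "x = el_map G c x'" "y' \<in> El C c" "y = el_map G c y'"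
      and le: "(el_map G c x', el_map G c y') \<in> Po D (ob_map G c)"
      by (auto simp: Po_E El_E)
    \<comment> \<open>The order of \<open>E\<close> is inherited from \<open>D\<close>, and the
      representatives \<open>x'\<close> and \<open>y'\<close> need not be comparable in
      \<open>C\<close>; so the monotonicity used is that of \<open>D\<close>.\<close>
    have "(el_map G b (reidx C f' x'), el_map G b (reidx C f' y')) \<in> Po D (ob_map G b)"
      using B.reidx_mono [OF map_hom [OF f'(3)] le] map_reidx [OF f'(3)] xy' by simp
    then show ?thesis
      using A.reidx_El [OF f'(3)] f' xy' by (simp add: reidx_E Po_E El_E)
  qed
  show "reidx E (idn E u) x = x" if u: "u \<in> Ob E" and x: "x \<in> El E u"
  proof -
    from u obtain c where c: "c \<in> Ob C" "u = j c" by (auto simp: Ob_E)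
    with x obtain x' where "x' \<in> El C c" "x = el_map G c x'" by (auto simp: El_E)
    then show ?thesis using c by (simp add: idn_E reidx_E [OF A.idn_hom] A.reidx_idn)
  qed
  show "reidx E (cmp E g f) x = reidx E f (reidx E g x)"
    if f: "f \<in> hom_set E u v" and g: "g \<in> hom_set E v w" and x: "x \<in> El E w"
  proof -
    from f obtain a b f' where f': "a \<in> Ob C" "b \<in> Ob C" "f' \<in> hom_set C a b" "u = j a" "v = j b" "f = ar a b f'"
      by (rule hom_E_cases)
    from g obtain b' c g' where c: "c \<in> Ob C" "w = j c"
      by (rule hom_E_cases)
    from g f' c obtain g' where g': "g' \<in> hom_set C b c" "g = ar b c g'"
      using hom_E_obtain by metis
    from x c obtain x' where x': "x' \<in> El C c" "x = el_map G c x'" by (auto simp: El_E)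
    show ?thesis
      using A.reidx_cmp [OF f'(3) g'(1) x'(1)] A.cmp_hom [OF f'(3) g'(1)] A.reidx_El [OF g'(1) x'(1)]
        f' g' x' by (simp add: cmp_E reidx_E)
  qed
qed

end

section \<open>Algebraic structure of the image and the corestriction onto it\<close>

locale morphism_image_language = morphism_image La G j tag
  for La :: "'u language" and G :: "('o, 'a, 'p, 'o2, 'a2, 'p2, 'u) morphism"
    and j :: "'o \<Rightarrow> 'e" and tag :: "'e \<times> 'e \<times> 'a2 \<Rightarrow> 'b" +
  fixes small :: "'u set \<Rightarrow> bool"
  assumes language: "is_language small La"
begin

lemma unit_E: "c \<in> Ob C \<Longrightarrow> unit_el La E (j c) = el_map G c (unit_el La C c)"
  using conn_E [OF _ is_language_conns(1) [OF language]] by (simp add: unit_el_def)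

lemma tensor_E: "c \<in> Ob C \<Longrightarrow> x \<in> El C c \<Longrightarrow> y \<in> El C c \<Longrightarrow>
    tensor_op La E (j c) (el_map G c x) (el_map G c y) = el_map G c (tensor_op La C c x y)"
  using conn_E [OF _ is_language_conns(2) [OF language], of c x y] by (simp add: tensor_op_def)

text \<open>\<open>el_map G c\<close> maps \<open>El C c\<close> onto \<open>El E (j c)\<close> and
  commutes with the operations, so the equations of \<open>C\<close> are inherited by
  \<open>E\<close>, just as equations pass to homomorphic images of algebras.\<close>

sublocale E: FA E La
proof (rule FA.intro [OF E.prop_category_axioms], rule FA_axioms.intro)
  fix u v w f k xs \<omega> x
  show "conn_op E u k xs \<in> El E u"
    if u: "u \<in> Ob E" and k: "k \<in> conns La (length xs)" "set xs \<subseteq> El E u"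
  proof -
    from u obtain c where c: "c \<in> Ob C" "u = j c" by (auto simp: Ob_E)
    obtain ys where ys: "set ys \<subseteq> El C c" "xs = map (el_map G c) ys"
      using El_E_lists c k(2) by metis
    then show ?thesis
      using conn_E [OF c(1)] A.conn_El [OF c(1)] k c by (simp add: El_E)
  qed
  show "reidx E f (conn_op E v k xs) = conn_op E u k (map (reidx E f) xs)"
    if f: "f \<in> hom_set E u v" and k: "k \<in> conns La (length xs)" "set xs \<subseteq> El E v"
  proof -
    from f obtain b c f' where f': "b \<in> Ob C" "c \<in> Ob C" "f' \<in> hom_set C b c" "u = j b" "v = j c" "f = ar b c f'"
      by (rule hom_E_cases)
    obtain ys where ys: "set ys \<subseteq> El C c" "xs = map (el_map G c) ys"
      using El_E_lists f' k(2) by metis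
    have k': "k \<in> conns La (length ys)" using k(1) ys by simp
    have m: "map (reidx E f) xs = map (el_map G b) (map (reidx C f') ys)"
      using ys f' by (auto simp: reidx_E)
    have "set (map (reidx C f') ys) \<subseteq> El C b"
      using ys A.reidx_El [OF f'(3)] by auto
    then show ?thesis
      unfolding m
      using conn_E [OF f'(1), of k "map (reidx C f') ys"] conn_E [OF f'(2) k' ys(1)] k' ys(2) f'
        A.conn_reidx [OF f'(3) k' ys(1)] A.conn_El [OF f'(2) k' ys(1)] by (simp add: reidx_E)
  qed
  show "monoid \<lparr>carrier = El E u, mult = tensor_op La E u, one = unit_el La E u\<rparr>" if u: "u \<in> Ob E"
  proof -
    from u obtain c where c: "c \<in> Ob C" "u = j c" by (auto simp: Ob_E)
    note m = A.monoid [OF c(1)]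
    show ?thesis
      using A.tensor_El [OF c(1)] A.unit_El [OF c(1)] monoid.m_assoc [OF m, simplified]
        monoid.l_one [OF m, simplified] monoid.r_one [OF m, simplified] c
      by (intro monoidI) (auto simp: El_E tensor_E unit_E)
  qed
  show "quant_op E \<omega> u v x \<in> El E u"
    if "\<omega> \<in> quants La" "u \<in> Ob E" "v \<in> Ob E" "x \<in> El E (prd E u v)"
    using that A.quant_El A.prd_Ob by (auto simp: Ob_E prd_E El_E quant_E)
  show "reidx E f (quant_op E \<omega> v w x) = quant_op E \<omega> u w (reidx E (prd_id E f w) x)"
    if \<omega>: "\<omega> \<in> quants La" and f: "f \<in> hom_set E u v" and w: "w \<in> Ob E" and x: "x \<in> El E (prd E v w)"
  proof -
    from f obtain b' b f' where f': "b' \<in> Ob C" "b \<in> Ob C" "f' \<in> hom_set C b' b" "u = j b'" "v = j b" "f = ar b' b f'"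
      by (rule hom_E_cases)
    from w obtain c where c: "c \<in> Ob C" "w = j c" by (auto simp: Ob_E)
    from x f' c obtain x' where x': "x' \<in> El C (prd C b c)" "x = el_map G (prd C b c) x'"
      using A.prd_Ob by (auto simp: prd_E El_E)
    note p = A.prd_id_hom [OF f'(3) c(1)]
    show ?thesis
      using A.quant_natural [OF \<omega> f'(3) c(1) x'(1)] A.quant_El [OF \<omega> f'(2) c(1) x'(1)]
        A.reidx_El [OF p x'(1)] reidx_E [OF p x'(1)] f' c x' \<omega>
      by (simp add: prd_id_E quant_E reidx_E)
  qed
  show "quant_op E \<omega> u (top_ob E) (reidx E (pr1 E u (top_ob E)) x) = x"
    if \<omega>: "\<omega> \<in> quants La" and u: "u \<in> Ob E" and x: "x \<in> El E u"
  proof -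
    from u obtain b where b: "b \<in> Ob C" "u = j b" by (auto simp: Ob_E)
    with x obtain x' where x': "x' \<in> El C b" "x = el_map G b x'" by (auto simp: El_E)
    note p = A.pr1_hom [OF b(1) A.top_Ob]
    show ?thesis
      using A.quant_top [OF \<omega> b(1) x'(1)] A.reidx_El [OF p x'(1)] reidx_E [OF p x'(1)] b x' \<omega> A.top_Ob
      by (simp add: top_E pr_E quant_E)
  qed
  show "quant_op E \<omega> u (prd E v w) (reidx E (assoc_ar E u v w) x) =
      quant_op E \<omega> u v (quant_op E \<omega> (prd E u v) w x)"
    if \<omega>: "\<omega> \<in> quants La" and uvw: "u \<in> Ob E" "v \<in> Ob E" "w \<in> Ob E" and x: "x \<in> El E (prd E (prd E u v) w)"
  proof -
    from uvw obtain b c d where b: "b \<in> Ob C" "u = j b" and c: "c \<in> Ob C" "v = j c" and d: "d \<in> Ob C" "w = j d"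
      by (auto simp: Ob_E)
    note bc = A.prd_Ob [OF b(1) c(1)] and cd = A.prd_Ob [OF c(1) d(1)]
    have "x \<in> el_map G (prd C (prd C b c) d) ` El C (prd C (prd C b c) d)"
      using x b c d bc A.prd_Ob [OF bc d(1)] by (simp add: prd_E El_E)
    then obtain x' where x': "x' \<in> El C (prd C (prd C b c) d)" "x = el_map G (prd C (prd C b c) d) x'"
      by blast
    note p = A.assoc_ar_hom [OF b(1) c(1) d(1)]
    show ?thesis
      using A.quant_prd [OF \<omega> b(1) c(1) d(1) x'(1)] A.reidx_El [OF p x'(1)] reidx_E [OF p x'(1)]
        A.quant_El [OF \<omega> bc d(1) x'(1)] b c d bc cd x' \<omega>
      by (simp add: prd_E assoc_ar_E quant_E)
  qed
  show "eq_el E u \<in> El E (prd E u u)" if u: "u \<in> Ob E"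
    using u A.eq_El A.prd_Ob by (auto simp: Ob_E eq_E prd_E El_E)
  show "eq_el E (top_ob E) = unit_el La E (prd E (top_ob E) (top_ob E))"
    using A.eq_top A.top_Ob A.prd_Ob by (simp add: top_E eq_E prd_E unit_E)
  show "eq_el E (prd E u v) = tensor_op La E (prd E (prd E u v) (prd E u v))
        (reidx E (pair E (cmp E (pr1 E u v) p) (cmp E (pr1 E u v) q)) (eq_el E u))
        (reidx E (pair E (cmp E (pr2 E u v) p) (cmp E (pr2 E u v) q)) (eq_el E v))"
    if uv: "u \<in> Ob E" "v \<in> Ob E" and pq: "p = pr1 E (prd E u v) (prd E u v)" "q = pr2 E (prd E u v) (prd E u v)"
    for p q
  proof -
    from uv obtain b c where b: "b \<in> Ob C" "u = j b" and c: "c \<in> Ob C" "v = j c" by (auto simp: Ob_E)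
    note bc = A.prd_Ob [OF b(1) c(1)]
    note p = A.pr1_hom [OF bc bc] and q = A.pr2_hom [OF bc bc]
    note p1 = A.pr1_hom [OF b(1) c(1)] and p2 = A.pr2_hom [OF b(1) c(1)]
    note e1 = A.pair_hom [OF A.cmp_hom [OF p p1] A.cmp_hom [OF q p1]]
      and e2 = A.pair_hom [OF A.cmp_hom [OF p p2] A.cmp_hom [OF q p2]]
    note El1 = A.reidx_El [OF e1 A.eq_El [OF b(1)]] and El2 = A.reidx_El [OF e2 A.eq_El [OF c(1)]]
    have pq': "p = ar (prd C (prd C b c) (prd C b c)) (prd C b c) (pr1 C (prd C b c) (prd C b c))"
      "q = ar (prd C (prd C b c) (prd C b c)) (prd C b c) (pr2 C (prd C b c) (prd C b c))"
      using pq b c bc by (simp_all add: prd_E pr_E)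
    show ?thesis
      unfolding pq' b(2) c(2) pr_E [OF b(1) c(1)] cmp_E [OF p p1] cmp_E [OF q p1] cmp_E [OF p p2]
        cmp_E [OF q p2] pair_E [OF A.cmp_hom [OF p p1] A.cmp_hom [OF q p1]]
        pair_E [OF A.cmp_hom [OF p p2] A.cmp_hom [OF q p2]] eq_E [OF b(1)] eq_E [OF c(1)]
        prd_E [OF b(1) c(1)] prd_E [OF bc bc] eq_E [OF bc]
        reidx_E [OF e1 A.eq_El [OF b(1)]] reidx_E [OF e2 A.eq_El [OF c(1)]]
        tensor_E [OF A.prd_Ob [OF bc bc] El1 El2]
        A.eq_prd [OF b(1) c(1) HOL.refl HOL.refl] ..
  qed
qed

definition corestriction :: "('o, 'a, 'p, 'e, 'b, 'p2, 'u) morphism" where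
  "corestriction = \<lparr>src = C, tgt = E, ob_map = restrict j (Ob C),
     ar_map = (\<lambda>f\<in>Ar C. ar (dm C f) (cd C f) f), el_map = el_map G\<rparr>"

lemma corestriction_sel:
  "src corestriction = C" "tgt corestriction = E"
  "c \<in> Ob C \<Longrightarrow> ob_map corestriction c = j c"
  "f \<in> hom_set C b c \<Longrightarrow> ar_map corestriction f = ar b c f"
  "el_map corestriction = el_map G"
  by (auto simp: corestriction_def hom_set_def)

text \<open>Although \<open>G\<close> need not preserve products on the nose, its corestriction
  does, because \<open>E\<close> takes its objects and their products from \<open>C\<close>. The
  deviation from strictness is left to the inclusion.\<close>

lemma FA_morphism_corestriction: "FA_morphism La corestriction"
proof (rule FA_morphism_strictI; unfold corestriction_sel(1,2,5))
  show "FA C La" "FA E La" by unfold_locales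
  show "ob_map corestriction \<in> Ob C \<rightarrow>\<^sub>E Ob E"
    by (auto simp: corestriction_def Ob_E)
  have "ar (dm C f) (cd C f) f \<in> Ar E" if "f \<in> Ar C" for f
    using that by (auto simp: Ar_E hom_set_def)
  then show "ar_map corestriction \<in> Ar C \<rightarrow>\<^sub>E Ar E"
    by (auto simp: corestriction_def)
  show "el_map G \<in> (\<Pi>\<^sub>E c\<in>Ob C. El C c \<rightarrow>\<^sub>E El E (ob_map corestriction c))"
    using el_map by (auto simp: corestriction_sel(3) PiE_iff El_E)
  show "ar_map corestriction f \<in> hom_set E (ob_map corestriction b) (ob_map corestriction c)"
    if f: "f \<in> hom_set C b c" for f b c
    using ar_hom [OF f] A.hom_Ob [OF f] by (simp add: corestriction_sel(4) [OF f] corestriction_sel(3))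
  show "ar_map corestriction (idn C c) = idn E (ob_map corestriction c)" if "c \<in> Ob C" for c
    using that by (simp add: corestriction_sel(4) [OF A.idn_hom] corestriction_sel(3) idn_E)
  show "ar_map corestriction (cmp C g f) = cmp E (ar_map corestriction g) (ar_map corestriction f)"
    if f: "f \<in> hom_set C a b" and g: "g \<in> hom_set C b c" for f g a b c
    unfolding corestriction_sel(4) [OF f] corestriction_sel(4) [OF g]
      corestriction_sel(4) [OF A.cmp_hom [OF f g]] cmp_E [OF f g] ..
  show "ob_map corestriction (top_ob C) = top_ob E"
    using A.top_Ob by (simp add: corestriction_sel(3) top_E)
  fix b c assume bc: "b \<in> Ob C" "c \<in> Ob C"
  show "ob_map corestriction (prd C b c) = prd E (ob_map corestriction b) (ob_map corestriction c)"
    using bc A.prd_Ob [OF bc] by (simp add: corestriction_sel(3) prd_E)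
  show "ar_map corestriction (pr1 C b c) = pr1 E (ob_map corestriction b) (ob_map corestriction c)"
    "ar_map corestriction (pr2 C b c) = pr2 E (ob_map corestriction b) (ob_map corestriction c)"
    using bc by (simp_all add: corestriction_sel(4) [OF A.pr1_hom] corestriction_sel(4) [OF A.pr2_hom]
      corestriction_sel(3) pr_E)
  show "el_map G b (quant_op C \<omega> b c x) =
      quant_op E \<omega> (ob_map corestriction b) (ob_map corestriction c) (el_map G (prd C b c) x)"
    if "\<omega> \<in> quants La" "x \<in> El C (prd C b c)" for \<omega> x
    using that bc by (simp add: corestriction_sel(3) quant_E)
next
  fix c assume c: "c \<in> Ob C"
  show "(el_map G c x, el_map G c y) \<in> Po E (ob_map corestriction c)" if "(x, y) \<in> Po C c" for x y
    using map_mono [OF c that] A.Po_El [OF c that] c by (simp add: corestriction_sel(3) Po_E El_E)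
  show "el_map G c (conn_op C c k xs) = conn_op E (ob_map corestriction c) k (map (el_map G c) xs)"
    if "k \<in> conns La (length xs)" "set xs \<subseteq> El C c" for k xs
    using that c by (simp add: corestriction_sel(3) conn_E)
  show "el_map G (prd C c c) (eq_el C c) = eq_el E (ob_map corestriction c)"
    using c by (simp add: corestriction_sel(3) eq_E)
next
  show "el_map G b (reidx C f x) = reidx E (ar_map corestriction f) (el_map G c x)"
    if "f \<in> hom_set C b c" "x \<in> El C c" for f b c x
    using reidx_E [OF that] by (simp add: corestriction_sel(4) [OF that(1)])
qed

end

text \<open>The last two hypotheses place the kernel of \<open>G\<close> inside that of
  \<open>F\<close>, for arbitrary arrows and inequalities; this is exactly what a map defined on
  values of \<open>G\<close> needs in order to be well defined and monotone.\<close>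

locale image_factorization = morphism_image_language La G j tag small
  for La :: "'u language" and G :: "('o, 'a, 'p, 'o2, 'a2, 'p2, 'u) morphism"
    and j :: "'o \<Rightarrow> 'e" and tag :: "'e \<times> 'e \<times> 'a2 \<Rightarrow> 'b" and small +
  fixes F :: "('o, 'a, 'p, 'o3, 'a3, 'p3, 'u) morphism"
  assumes F: "FA_morphism La F" and src_F: "src F = C"
    and ker_ar: "\<And>b c f g. f \<in> hom_set C b c \<Longrightarrow> g \<in> hom_set C b c \<Longrightarrow>
      ar_map G f = ar_map G g \<Longrightarrow> ar_map F f = ar_map F g"
    and ker_el: "\<And>c x y. c \<in> Ob C \<Longrightarrow> x \<in> El C c \<Longrightarrow> y \<in> El C c \<Longrightarrow>
      (el_map G c x, el_map G c y) \<in> Po D (ob_map G c) \<Longrightarrow>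
      (el_map F c x, el_map F c y) \<in> Po (tgt F) (ob_map F c)"
begin

sublocale F: FA_morphism La F by (rule F)

lemmas F_maps = F.map_hom [unfolded src_F] F.ob_map_Ob [unfolded src_F] F.el_map_El [unfolded src_F]

text \<open>Values are computed at representatives chosen by \<open>SOME\<close>;
  \<open>factor_ar\<close> and \<open>factor_el\<close> show that the choice is immaterial.\<close>

definition factor :: "('e, 'b, 'p2, 'o3, 'a3, 'p3, 'u) morphism" where
  "factor = \<lparr>src = E, tgt = tgt F,
     ob_map = (\<lambda>u\<in>Ob E. ob_map F (ob u)),
     ar_map = (\<lambda>x\<in>Ar E. ar_map F (SOME f. f \<in> hom_set C (ob (dm E x)) (ob (cd E x)) \<and>
       ar (ob (dm E x)) (ob (cd E x)) f = x)),
     el_map = (\<lambda>u\<in>Ob E. \<lambda>x\<in>El E u. el_map F (ob u) (SOME y. y \<in> El C (ob u) \<and> el_map G (ob u) y = x))\<rparr>"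

lemma factor_sel: "src factor = E" "tgt factor = tgt F"
  by (simp_all add: factor_def)

lemma factor_ob: "c \<in> Ob C \<Longrightarrow> ob_map factor (j c) = ob_map F c"
  by (simp add: factor_def Ob_E)

lemma factor_ar:
  assumes f: "f \<in> hom_set C b c"
  shows "ar_map factor (ar b c f) = ar_map F f"
proof -
  have bc: "b \<in> Ob C" "c \<in> Ob C" using A.hom_Ob [OF f] by auto
  define g where "g = (SOME g. g \<in> hom_set C b c \<and> ar b c g = ar b c f)"
  have g: "g \<in> hom_set C b c \<and> ar b c g = ar b c f"
    unfolding g_def by (rule someI [of _ f]) (simp add: f)
  have "ar_map factor (ar b c f) = ar_map F g"
    using bc E.hom_Ar [OF ar_hom [OF f]] by (simp add: factor_def g_def E_dm_cd)
  also have "\<dots> = ar_map F f" using g f bc by (intro ker_ar) (auto simp: ar_eq_iff)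
  finally show ?thesis .
qed

lemma factor_el:
  assumes c: "c \<in> Ob C" and x: "x \<in> El C c"
  shows "el_map factor (j c) (el_map G c x) = el_map F c x"
proof -
  define y where "y = (SOME y. y \<in> El C c \<and> el_map G c y = el_map G c x)"
  have y: "y \<in> El C c \<and> el_map G c y = el_map G c x"
    unfolding y_def by (rule someI [of _ x]) (simp add: x)
  have "el_map factor (j c) (el_map G c x) = el_map F c y"
    using c x by (simp add: factor_def Ob_E El_E y_def)
  \<comment> \<open>\<open>ker_el\<close> speaks of the order, so equality comes from using it in
    both directions together with antisymmetry.\<close>
  also have "\<dots> = el_map F c x"
    using y x c ker_el [OF c] B.Po_refl [OF ob_map_Ob [OF c] el_map_El [OF c x]]
    by (intro F.B.Po_antisym [OF F_maps(2) [OF c]]) simp_all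
  finally show ?thesis .
qed

text \<open>The products of \<open>E\<close> come from \<open>C\<close>, so the comparisons of the
  factor are those of \<open>F\<close> and inherit their invertibility.\<close>

lemma factor_comparison:
  "b \<in> Ob C \<Longrightarrow> c \<in> Ob C \<Longrightarrow> comparison factor (j b) (j c) = comparison F b c"
  by (simp add: comparison_def factor_sel pr_E src_F factor_ar [OF A.pr1_hom] factor_ar [OF A.pr2_hom])

lemma FA_morphism_factor: "FA_morphism La factor"
proof (intro FA_morphism.intro FA_morphism_axioms.intro; unfold factor_sel)
  show "FA E La" "FA (tgt F) La" by unfold_locales
  show "ob_map factor \<in> Ob E \<rightarrow>\<^sub>E Ob (tgt F)"
    using F_maps(2) by (auto simp: factor_def Ob_E)
  have "ar_map factor x \<in> Ar (tgt F)" if "x \<in> Ar E" for x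
    using that factor_ar F.B.hom_Ar [OF F_maps(1)] by (auto simp: Ar_E)
  moreover have "ar_map factor \<in> extensional (Ar E)" by (simp add: factor_def)
  ultimately show "ar_map factor \<in> Ar E \<rightarrow>\<^sub>E Ar (tgt F)" by (simp add: PiE_iff)
  have "el_map factor u x \<in> El (tgt F) (ob_map factor u)" if "u \<in> Ob E" "x \<in> El E u" for u x
    using that factor_el factor_ob F_maps(3) by (auto simp: Ob_E El_E)
  moreover have "el_map factor \<in> extensional (Ob E)" "\<And>u. u \<in> Ob E \<Longrightarrow> el_map factor u \<in> extensional (El E u)"
    by (simp_all add: factor_def)
  ultimately show "el_map factor \<in> (\<Pi>\<^sub>E c\<in>Ob E. El E c \<rightarrow>\<^sub>E El (tgt F) (ob_map factor c))"
    by (simp add: PiE_iff)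
  show "ar_map factor f \<in> hom_set (tgt F) (ob_map factor u) (ob_map factor v)"
    if f: "f \<in> hom_set E u v" for f u v
    using f
  proof (rule hom_E_cases)
    fix b c f' assume "b \<in> Ob C" "c \<in> Ob C" "f' \<in> hom_set C b c" "u = j b" "v = j c" "f = ar b c f'"
    then show ?thesis using F_maps(1) by (simp add: factor_ar factor_ob)
  qed
  show "ar_map factor (idn E u) = idn (tgt F) (ob_map factor u)" if "u \<in> Ob E" for u
    using that F.map_idn [unfolded src_F] by (auto simp: Ob_E idn_E factor_ar [OF A.idn_hom] factor_ob)
  show "ar_map factor (cmp E g f) = cmp (tgt F) (ar_map factor g) (ar_map factor f)"
    if f: "f \<in> hom_set E u v" and g: "g \<in> hom_set E v w" for f g u v w
  proof -
    from f obtain a b f' where f': "a \<in> Ob C" "b \<in> Ob C" "f' \<in> hom_set C a b" "u = j a" "v = j b" "f = ar a b f'"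
      by (rule hom_E_cases)
    from g obtain b' c g' where c: "c \<in> Ob C" "w = j c"
      by (rule hom_E_cases)
    from g f' c obtain g' where g': "g' \<in> hom_set C b c" "g = ar b c g'"
      using hom_E_obtain by metis
    show ?thesis
      unfolding f'(6) g'(2) cmp_E [OF f'(3) g'(1)] factor_ar [OF f'(3)] factor_ar [OF g'(1)]
        factor_ar [OF A.cmp_hom [OF f'(3) g'(1)]]
      by (rule F.map_cmp [unfolded src_F, OF f'(3) g'(1)])
  qed
  show "is_iso (tgt F) (bang (tgt F) (ob_map factor (top_ob E)))"
    using F.preserves_top A.top_Ob by (simp add: top_E factor_ob src_F)
  show "is_iso (tgt F) (comparison factor u v)" if "u \<in> Ob E" "v \<in> Ob E" for u v
    using that F.preserves_prd [unfolded src_F] by (auto simp: Ob_E factor_comparison)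
  show "(el_map factor u x, el_map factor u y) \<in> Po (tgt F) (ob_map factor u)"
    if u: "u \<in> Ob E" and xy: "(x, y) \<in> Po E u" for u x y
  proof -
    from u obtain c where c: "c \<in> Ob C" "u = j c" by (auto simp: Ob_E)
    from xy c obtain x' y' where xy': "x' \<in> El C c" "x = el_map G c x'" "y' \<in> El C c" "y = el_map G c y'"
      and le: "(el_map G c x', el_map G c y') \<in> Po D (ob_map G c)"
      by (auto simp: Po_E El_E)
    \<comment> \<open>\<open>x'\<close> and \<open>y'\<close> are known to be related only after
      \<open>G\<close>, so monotonicity of \<open>F\<close> does not suffice: the kernels must be
      nested for inequalities, not just for equations.\<close>
    show ?thesis using ker_el [OF c(1) xy'(1,3) le] c xy' by (simp add: factor_el factor_ob)
  qed
  show "el_map factor u (reidx E f x) = reidx (tgt F) (ar_map factor f) (el_map factor v x)"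
    if f: "f \<in> hom_set E u v" and x: "x \<in> El E v" for f u v x
  proof -
    from f obtain b c f' where f': "b \<in> Ob C" "c \<in> Ob C" "f' \<in> hom_set C b c" "u = j b" "v = j c" "f = ar b c f'"
      by (rule hom_E_cases)
    from x f' obtain x' where x': "x' \<in> El C c" "x = el_map G c x'" by (auto simp: El_E)
    show ?thesis
      using F.map_reidx [unfolded src_F, OF f'(3) x'(1)] A.reidx_El [OF f'(3) x'(1)] f' x'
      by (simp add: reidx_E factor_el factor_ar)
  qed
  show "el_map factor u (conn_op E u k xs) = conn_op (tgt F) (ob_map factor u) k (map (el_map factor u) xs)"
    if u: "u \<in> Ob E" and k: "k \<in> conns La (length xs)" "set xs \<subseteq> El E u" for u k xs
  proof -
    from u obtain c where c: "c \<in> Ob C" "u = j c" by (auto simp: Ob_E)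
    obtain ys where ys: "set ys \<subseteq> El C c" "xs = map (el_map G c) ys"
      using El_E_lists c k(2) by metis
    have k': "k \<in> conns La (length ys)" using k(1) ys by simp
    have m: "map (el_map factor u) xs = map (el_map F c) ys"
      using ys c by (auto simp: factor_el)
    show ?thesis
      unfolding m unfolding c(2) ys(2)
      using F.map_conn [unfolded src_F, OF c(1) k' ys(1)] A.conn_El [OF c(1) k' ys(1)] c
      by (simp add: conn_E [OF c(1) k' ys(1)] factor_el factor_ob)
  qed
  show "el_map factor u (quant_op E \<omega> u v x) = quant_op (tgt F) \<omega> (ob_map factor u) (ob_map factor v)
      (reidx (tgt F) (inv_ar (tgt F) (comparison factor u v)) (el_map factor (prd E u v) x))"
    if \<omega>: "\<omega> \<in> quants La" and uv: "u \<in> Ob E" "v \<in> Ob E" and x: "x \<in> El E (prd E u v)" for \<omega> u v x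
  proof -
    from uv obtain b c where b: "b \<in> Ob C" "u = j b" and c: "c \<in> Ob C" "v = j c" by (auto simp: Ob_E)
    note bc = A.prd_Ob [OF b(1) c(1)]
    from x b c bc obtain x' where x': "x' \<in> El C (prd C b c)" "x = el_map G (prd C b c) x'"
      by (auto simp: prd_E El_E)
    show ?thesis
      using F.map_quant [unfolded src_F, OF \<omega> b(1) c(1) x'(1)] A.quant_El [OF \<omega> b(1) c(1) x'(1)] b c bc x' \<omega>
      by (simp add: prd_E quant_E factor_el factor_ob factor_comparison)
  qed
  show "el_map factor (prd E u u) (eq_el E u) = reidx (tgt F) (comparison factor u u) (eq_el (tgt F) (ob_map factor u))"
    if "u \<in> Ob E" for u
    using that F.map_eq [unfolded src_F] A.eq_El A.prd_Ob
    by (auto simp: Ob_E prd_E eq_E factor_el factor_ob factor_comparison)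
qed

text \<open>Morphisms are compared as records. Beyond agreement on objects, arrows and elements this
  uses that the maps of \<open>F\<close> are extensional.\<close>

lemma factor_corestriction: "comp_morphism factor corestriction = F"
proof -
  have e: "ob_map F \<in> extensional (Ob C)" "ar_map F \<in> extensional (Ar C)" "el_map F \<in> extensional (Ob C)"
    "\<And>c. c \<in> Ob C \<Longrightarrow> el_map F c \<in> extensional (El C c)"
    using F.ob_map F.ar_map F.el_map src_F by (simp_all add: PiE_iff)
  have "compose (Ob C) (ob_map factor) (ob_map corestriction) = ob_map F"
    using e by (intro extensionalityI [of _ "Ob C"]) (simp_all add: compose_def corestriction_sel factor_ob)
  moreover have "compose (Ar C) (ar_map factor) (ar_map corestriction) = ar_map F"
  proof (rule extensionalityI [of _ "Ar C"])
    fix f assume "f \<in> Ar C"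
    then have f: "f \<in> hom_set C (dm C f) (cd C f)" by (simp add: hom_set_def)
    then show "compose (Ar C) (ar_map factor) (ar_map corestriction) f = ar_map F f"
      using \<open>f \<in> Ar C\<close> by (simp add: compose_def corestriction_sel(4) [OF f] factor_ar)
  qed (use e in \<open>simp_all add: compose_def\<close>)
  moreover have "(\<lambda>c\<in>Ob C. compose (El C c) (el_map factor (ob_map corestriction c)) (el_map corestriction c)) =
      el_map F"
  proof (rule extensionalityI [of _ "Ob C"])
    fix c assume c: "c \<in> Ob C"
    have "compose (El C c) (el_map factor (j c)) (el_map G c) = el_map F c"
      using e c by (intro extensionalityI [of _ "El C c"]) (simp_all add: compose_def factor_el)
    then show "(\<lambda>c\<in>Ob C. compose (El C c) (el_map factor (ob_map corestriction c)) (el_map corestriction c)) c =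
        el_map F c"
      using c by (simp add: corestriction_sel)
  qed (use e in simp_all)
  ultimately show ?thesis
    by (simp add: comp_morphism_def corestriction_sel(1) factor_sel src_F [symmetric])
qed

end

context morphism_image_language
begin

text \<open>With \<open>F = G\<close> the kernel conditions are trivial and \<open>factor\<close>
  becomes the inclusion of the image into the target of \<open>G\<close>.\<close>

sublocale inclusion: image_factorization La G j tag small G
  by unfold_locales simp_all

text \<open>Arrows of \<open>E\<close> with common endpoints differ only in their values under
  \<open>G\<close>, and the order of \<open>E\<close> is the restriction of that of
  \<open>D\<close>; faithfulness and the order embedding are built into the construction.\<close>

lemma subprop_inclusion: "subprop_morphism La inclusion.factor"
  unfolding subprop_morphism_def inclusion.factor_sel
proof (intro conjI ballI)
  show "FA_morphism La inclusion.factor" by (rule inclusion.FA_morphism_factor)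
  fix u v assume "u \<in> Ob E" "v \<in> Ob E"
  then obtain b c where b: "b \<in> Ob C" "u = j b" and c: "c \<in> Ob C" "v = j c" by (auto simp: Ob_E)
  show "inj_on (ar_map inclusion.factor) (hom_set E u v)"
  proof (rule inj_onI)
    fix x y assume x: "x \<in> hom_set E u v" and y: "y \<in> hom_set E u v"
      and e: "ar_map inclusion.factor x = ar_map inclusion.factor y"
    obtain f where f: "f \<in> hom_set C b c" "x = ar b c f"
      using x b c hom_E_obtain by metis
    obtain g where g: "g \<in> hom_set C b c" "y = ar b c g"
      using y b c hom_E_obtain by metis
    show "x = y"
      using e f g inclusion.factor_ar by (simp add: ar_def)
  qed
next
  fix u x y assume u: "u \<in> Ob E" and xy: "x \<in> El E u" "y \<in> El E u"
  then obtain c where c: "c \<in> Ob C" "u = j c" by (auto simp: Ob_E)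
  then show "(x, y) \<in> Po E u \<longleftrightarrow>
      (el_map inclusion.factor u x, el_map inclusion.factor u y) \<in> Po (tgt G) (ob_map inclusion.factor u)"
    using xy inclusion.factor_el inclusion.factor_ob by (auto simp: Po_E El_E)
qed

end

text \<open>A subprop-morphism is by itself a jointly conservative family, indexed by the type
  \<open>unit\<close>.\<close>

lemma in_FAL_subprop:
  assumes La: "is_language small La" and "subprop_morphism La \<iota>" "in_FAL La L (tgt \<iota>)"
  shows "in_FAL La L (src \<iota>)"
proof -
  have \<iota>: "FA_morphism La \<iota>"
    and inj: "\<forall>b\<in>Ob (src \<iota>). \<forall>c\<in>Ob (src \<iota>). inj_on (ar_map \<iota>) (hom_set (src \<iota>) b c)"
    and emb: "\<forall>c\<in>Ob (src \<iota>). \<forall>x\<in>El (src \<iota>) c. \<forall>y\<in>El (src \<iota>) c.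
      (x, y) \<in> Po (src \<iota>) c \<longleftrightarrow> (el_map \<iota> c x, el_map \<iota> c y) \<in> Po (tgt \<iota>) (ob_map \<iota> c)"
    using assms(2) by (simp_all add: subprop_morphism_def)
  interpret FA_morphism La \<iota> by (rule \<iota>)
  show ?thesis
  proof (rule in_FAL_reflect [OF La, where F = "\<lambda>_ :: unit. \<iota>" and I = UNIV])
    show "FA (src \<iota>) La" by unfold_locales
    fix b c f g
    assume f: "f \<in> hom_set (src \<iota>) b c" and g: "g \<in> hom_set (src \<iota>) b c"
      and "\<And>i :: unit. i \<in> UNIV \<Longrightarrow> ar_map \<iota> f = ar_map \<iota> g"
    then show "f = g" using inj A.hom_Ob [OF f] by (meson UNIV_I inj_onD)
  qed (use \<iota> assms(3) emb in auto)
qed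


section \<open>Substitution\<close>

lemma vars_0 [simp]: "vars m 0 = []"
  by (simp add: vars_def)

lemma vars_Suc: "vars m (Suc n) = Var m # vars (Suc m) n"
  unfolding vars_def by (subst upt_conv_Cons) simp_all

lemma length_vars [simp]: "length (vars m n) = n"
  by (simp add: vars_def)

lemma nth_vars [simp]: "i < n \<Longrightarrow> vars m n ! i = Var (m + i)"
  by (simp add: vars_def)

lemma vars_append: "vars m n @ vars (m + n) k = vars m (n + k)"
  by (rule nth_equalityI) (auto simp: nth_append)

lemma vars_snoc: "vars m n @ [Var (m + n)] = vars m (Suc n)"
  using vars_append [of m n 1] by (simp add: vars_def)

lemma map_tm_subst_vars:
  "b + k \<le> n \<Longrightarrow> map (tm_subst (vars a n)) (vars b k) = vars (a + b) k"
  by (rule nth_equalityI) (auto simp: add.assoc)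

lemma map_tm_subst_vars_append:
  "length Ms = n \<Longrightarrow> map (tm_subst (Ms @ Ns)) (vars 0 n) = Ms"
  "length Ms = n \<Longrightarrow> length Ns = k \<Longrightarrow> map (tm_subst (Ms @ Ns)) (vars n k) = Ns"
  by (rule nth_equalityI; auto simp: nth_append)+

lemma is_tm_Var_iff [simp]: "is_tm Sg \<Gamma> (Var i) \<tau> \<longleftrightarrow> i < length \<Gamma> \<and> \<tau> = \<Gamma> ! i"
  by (auto elim: is_tm.cases intro: is_tm.var)

lemma is_tm_weaken: "is_tm Sg \<Gamma> M \<tau> \<Longrightarrow> is_tm Sg (\<Gamma> @ \<Delta>) M \<tau>"
proof (induction rule: is_tm.induct)
  case ("fun" f \<sigma>s \<tau> Ms)
  then show ?case by (intro is_tm.fun) (auto elim: list_all2_mono)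
qed (simp add: nth_append)

lemma vars_typed: "list_all2 (is_tm Sg (\<Gamma> @ \<Delta> @ \<Theta>)) (vars (length \<Gamma>) (length \<Delta>)) \<Delta>"
  by (simp add: list_all2_conv_all_nth nth_append)

lemma vars_0_typed: "list_all2 (is_tm Sg (\<Gamma> @ \<Delta>)) (vars 0 (length \<Gamma>)) \<Gamma>"
  using vars_typed [of Sg "[]" \<Gamma> \<Delta>] by simp

lemma is_tm_subst:
  assumes Ns: "list_all2 (is_tm Sg \<Delta>) Ns \<Gamma>"
  shows "is_tm Sg \<Gamma> M \<tau> \<Longrightarrow> is_tm Sg \<Delta> (tm_subst Ns M) \<tau>"
proof (induction rule: is_tm.induct)
  case (var i)
  then show ?case using Ns by (simp add: list_all2_conv_all_nth)
next
  case ("fun" f \<sigma>s \<tau> Ms)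
  then show ?case by (auto simp: list_all2_map1 intro!: is_tm.fun elim: list_all2_mono)
qed

lemma tms_subst_typed:
  assumes "list_all2 (is_tm Sg \<Delta>) Ns \<Gamma>" "list_all2 (is_tm Sg \<Gamma>) Ms \<Theta>"
  shows "list_all2 (is_tm Sg \<Delta>) (map (tm_subst Ns) Ms) \<Theta>"
  using assms(2) is_tm_subst [OF assms(1)] by (auto simp: list_all2_map1 elim: list_all2_mono)

text \<open>Substitution looks terms up by position; typing keeps every lookup inside the
  list.\<close>

lemma tm_subst_comp:
  "is_tm Sg \<Gamma> M \<tau> \<Longrightarrow> length Ns = length \<Gamma> \<Longrightarrow>
    tm_subst Ks (tm_subst Ns M) = tm_subst (map (tm_subst Ks) Ns) M"
proof (induction rule: is_tm.induct)
  case ("fun" f \<sigma>s \<tau> Ms)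
  then show ?case by (auto simp: list_all2_conv_all_nth in_set_conv_nth)
qed simp

lemma tm_subst_id: "is_tm Sg \<Gamma> M \<tau> \<Longrightarrow> length \<Gamma> = n \<Longrightarrow> tm_subst (vars 0 n) M = M"
proof (induction rule: is_tm.induct)
  case ("fun" f \<sigma>s \<tau> Ms)
  then show ?case by (auto simp: list_all2_conv_all_nth in_set_conv_nth intro!: map_idI)
qed simp

lemma list_all2_is_tmD: "list_all2 (is_tm Sg \<Gamma>) Ms \<sigma>s \<Longrightarrow> M \<in> set Ms \<Longrightarrow> \<exists>\<sigma>. is_tm Sg \<Gamma> M \<sigma>"
  by (auto simp: list_all2_conv_all_nth in_set_conv_nth)

lemma map_tm_subst_comp:
  "list_all2 (is_tm Sg \<Gamma>) Ms \<sigma>s \<Longrightarrow> length Ns = length \<Gamma> \<Longrightarrow>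
    map (tm_subst Ks) (map (tm_subst Ns) Ms) = map (tm_subst (map (tm_subst Ks) Ns)) Ms"
  using tm_subst_comp list_all2_is_tmD by fastforce

lemma map_tm_subst_id:
  "list_all2 (is_tm Sg \<Gamma>) Ms \<sigma>s \<Longrightarrow> length \<Gamma> = n \<Longrightarrow> map (tm_subst (vars 0 n)) Ms = Ms"
  using tm_subst_id list_all2_is_tmD by (fastforce intro: map_idI)

lemma is_fm_subst:
  "is_fm La Sg \<Gamma> \<phi> \<Longrightarrow> list_all2 (is_tm Sg \<Delta>) Ns \<Gamma> \<Longrightarrow> is_fm La Sg \<Delta> (fm_subst \<phi> (length \<Delta>) Ns)"
proof (induction arbitrary: \<Delta> Ns rule: is_fm.induct)
  case (rel r \<sigma>s \<Gamma> Ms)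
  show ?case using is_fm.rel [OF rel(1) tms_subst_typed [OF rel(3,2)]] by simp
next
  case (equ \<sigma> \<Gamma> M N)
  show ?case using is_fm.equ [OF equ(1) is_tm_subst [OF equ(4,2)] is_tm_subst [OF equ(4,3)]] by simp
next
  case (conn k \<phi>s \<Gamma>)
  then show ?case by (auto intro!: is_fm.conn)
next
  case (quant \<omega> \<sigma> \<Gamma> \<phi>)
  \<comment> \<open>The bound variable is the next free level: \<open>length \<Gamma>\<close> before
    and \<open>length \<Delta>\<close> after the substitution. The list is therefore extended by the
    latter.\<close>
  have t: "list_all2 (is_tm Sg (\<Delta> @ [\<sigma>])) (Ns @ [Var (length \<Delta>)]) (\<Gamma> @ [\<sigma>])"
    using quant(5) by (auto simp: list_all2_append list_all2_lengthD intro: is_tm_weaken elim: list_all2_mono)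
  show ?case using is_fm.quant [OF quant(1,2) quant.IH [OF t, unfolded length_append_singleton]] by simp
qed

lemma fm_subst_comp:
  "is_fm La Sg \<Gamma> \<phi> \<Longrightarrow> list_all2 (is_tm Sg \<Delta>) Ns \<Gamma> \<Longrightarrow> length Ks = length \<Delta> \<Longrightarrow>
    fm_subst (fm_subst \<phi> (length \<Delta>) Ns) k Ks = fm_subst \<phi> k (map (tm_subst Ks) Ns)"
proof (induction arbitrary: \<Delta> Ns k Ks rule: is_fm.induct)
  case (rel r \<sigma>s \<Gamma> Ms)
  then show ?case using map_tm_subst_comp [OF rel(2)] by (auto dest: list_all2_lengthD)
next
  case (equ \<sigma> \<Gamma> M N)
  show ?case
    using tm_subst_comp [OF equ(2)] tm_subst_comp [OF equ(3)] list_all2_lengthD [OF equ(4)] by simp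
next
  case (conn k \<phi>s \<Gamma>)
  then show ?case by auto
next
  case (quant \<omega> \<sigma> \<Gamma> \<phi>)
  have t: "list_all2 (is_tm Sg (\<Delta> @ [\<sigma>])) (Ns @ [Var (length \<Delta>)]) (\<Gamma> @ [\<sigma>])"
    using quant(5) by (auto simp: list_all2_append list_all2_lengthD intro: is_tm_weaken elim: list_all2_mono)
  \<comment> \<open>Terms in context \<open>\<Delta>\<close> cannot see the extra entry
    \<open>Var k\<close>. Inserting the identity substitution proves this without an induction, as
    it selects the first \<open>length \<Delta>\<close> entries of the extended list.\<close>
  have m: "map (tm_subst (Ks @ [Var k])) Ns = map (tm_subst Ks) Ns"
  proof (rule map_cong [OF HOL.refl])
    fix M assume "M \<in> set Ns"
    then obtain \<tau> where M: "is_tm Sg \<Delta> M \<tau>" using list_all2_is_tmD [OF quant(5)] by blast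
    have "tm_subst (Ks @ [Var k]) (tm_subst (vars 0 (length \<Delta>)) M) = tm_subst Ks M"
      using tm_subst_comp [OF M] map_tm_subst_vars_append(1) [OF quant(6)] by simp
    then show "tm_subst (Ks @ [Var k]) M = tm_subst Ks M"
      using tm_subst_id [OF M HOL.refl] by simp
  qed
  then show ?case
    using quant.IH [OF t, of "Ks @ [Var k]" "Suc k", unfolded map_append m] quant(6)
    by (simp add: nth_append)
qed

lemma fm_subst_id: "is_fm La Sg \<Gamma> \<phi> \<Longrightarrow> length \<Gamma> = n \<Longrightarrow> fm_subst \<phi> n (vars 0 n) = \<phi>"
proof (induction arbitrary: n rule: is_fm.induct)
  case (rel r \<sigma>s \<Gamma> Ms)
  show ?case using map_tm_subst_id [OF rel(2,3)] by simp
next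
  case (equ \<sigma> \<Gamma> M N)
  show ?case using tm_subst_id [OF equ(2,4)] tm_subst_id [OF equ(3,4)] by simp
next
  case (conn k \<phi>s \<Gamma>)
  then show ?case by (auto intro: map_idI)
next
  case (quant \<omega> \<sigma> \<Gamma> \<phi>)
  then show ?case by (simp add: vars_snoc [of 0, simplified])
qed

text \<open>Each quantifier of the block adds one level, so below the block the substitution ends in
  fresh variables that start at level \<open>m\<close>. Naturality of quantification over a whole
  context rests on this.\<close>

lemma fm_subst_foldr_Quant:
  "fm_subst (foldr (Quant \<omega>) \<Delta> \<phi>) m Ns =
    foldr (Quant \<omega>) \<Delta> (fm_subst \<phi> (m + length \<Delta>) (Ns @ vars m (length \<Delta>)))"
  by (induction \<Delta> arbitrary: m Ns) (simp_all add: vars_Suc)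

lemma is_fm_foldr_Quant:
  "\<omega> \<in> quants La \<Longrightarrow> is_ctx Sg \<Delta> \<Longrightarrow> is_fm La Sg (\<Gamma> @ \<Delta>) \<phi> \<Longrightarrow> is_fm La Sg \<Gamma> (foldr (Quant \<omega>) \<Delta> \<phi>)"
  by (induction \<Delta> arbitrary: \<Gamma>) (auto simp: is_ctx_def intro: is_fm.quant)

lemma fm_subst_Tensors: "fm_subst (Tensors La \<phi>s) m Ns = Tensors La (map (\<lambda>\<phi>. fm_subst \<phi> m Ns) \<phi>s)"
  unfolding Tensors_def
  by (induction \<phi>s rule: induct_list012) (simp_all add: Unit_def Tensor_def)

lemma is_ctx_append [simp]: "is_ctx Sg (\<Gamma> @ \<Delta>) \<longleftrightarrow> is_ctx Sg \<Gamma> \<and> is_ctx Sg \<Delta>"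
  by (simp add: is_ctx_def)


section \<open>Derivability\<close>

locale classifying_syntax =
  fixes small :: "'u set \<Rightarrow> bool" and La :: "'u language" and Sg :: "'u signature"
  assumes language: "is_language small La"
begin

abbreviation "fm \<equiv> is_fm La Sg"
abbreviation "tms \<Gamma> \<equiv> list_all2 (is_tm Sg \<Gamma>)"
abbreviation "thms \<equiv> Lm La Sg {}"
abbreviation "Cl \<equiv> classifying La Sg"
abbreviation "tc \<equiv> tms_class La Sg"
abbreviation "fc \<equiv> fm_class La Sg"

definition "teq \<Gamma> \<Delta> Ms Ns \<longleftrightarrow> eqns \<Gamma> \<Delta> Ms Ns \<subseteq> thms"

lemma teq_iff: "teq \<Gamma> \<Delta> Ms Ns \<longleftrightarrow> (\<forall>i<length \<Delta>. Eqn \<Gamma> (\<Delta> ! i) (Ms ! i) (Ns ! i) \<in> thms)"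
  by (auto simp: teq_def eqns_def)

lemma Eqn_refl: "is_ctx Sg \<Gamma> \<Longrightarrow> is_tm Sg \<Gamma> M \<tau> \<Longrightarrow> Eqn \<Gamma> \<tau> M M \<in> thms"
  by (rule Lm.eq_rule [OF eq_rule.refl]) auto

lemma Eqn_sym: "Eqn \<Gamma> \<tau> M N \<in> thms \<Longrightarrow> Eqn \<Gamma> \<tau> N M \<in> thms"
  by (rule Lm.eq_rule [OF eq_rule.sym]) auto

lemma Eqn_trans: "Eqn \<Gamma> \<tau> M N \<in> thms \<Longrightarrow> Eqn \<Gamma> \<tau> N K \<in> thms \<Longrightarrow> Eqn \<Gamma> \<tau> M K \<in> thms"
  by (rule Lm.eq_rule [OF eq_rule.trans]) auto

lemma Eqn_subst:
  assumes "is_ctx Sg \<Delta>" "length Ns = length \<Gamma>" "length Ns' = length \<Gamma>"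
    and "Eqn \<Gamma> \<tau> M M' \<in> thms" "teq \<Delta> \<Gamma> Ns Ns'"
  shows "Eqn \<Delta> \<tau> (tm_subst Ns M) (tm_subst Ns' M') \<in> thms"
  by (rule Lm.eq_rule [OF eq_rule.subst [OF assms(1-3)]]) (use assms(4,5) in \<open>auto simp: teq_def\<close>)

lemma teq_refl: "is_ctx Sg \<Gamma> \<Longrightarrow> tms \<Gamma> Ms \<Delta> \<Longrightarrow> teq \<Gamma> \<Delta> Ms Ms"
  using Eqn_refl by (auto simp: teq_iff list_all2_conv_all_nth)

lemma teq_sym: "teq \<Gamma> \<Delta> Ms Ns \<Longrightarrow> teq \<Gamma> \<Delta> Ns Ms"
  using Eqn_sym by (auto simp: teq_iff)

lemma teq_trans: "teq \<Gamma> \<Delta> Ms Ns \<Longrightarrow> teq \<Gamma> \<Delta> Ns Ks \<Longrightarrow> teq \<Gamma> \<Delta> Ms Ks"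
  using Eqn_trans by (auto simp: teq_iff)

text \<open>Varying the substituted terms and the terms substituted into at the same time gives
  independence of composition from both representatives.\<close>

lemma teq_subst:
  assumes "is_ctx Sg \<Gamma>" "tms \<Gamma> Ns \<Delta>" "tms \<Gamma> Ns' \<Delta>" "teq \<Gamma> \<Delta> Ns Ns'"
    and "tms \<Delta> Ms \<Theta>" "tms \<Delta> Ms' \<Theta>" "teq \<Delta> \<Theta> Ms Ms'"
  shows "teq \<Gamma> \<Theta> (map (tm_subst Ns) Ms) (map (tm_subst Ns') Ms')"
  unfolding teq_iff
proof (intro allI impI)
  fix i assume "i < length \<Theta>"
  then show "Eqn \<Gamma> (\<Theta> ! i) (map (tm_subst Ns) Ms ! i) (map (tm_subst Ns') Ms' ! i) \<in> thms"
    using Eqn_subst [OF assms(1) _ _ _ assms(4)] assms by (auto simp: teq_iff list_all2_conv_all_nth)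
qed

lemma Seq_ax: "is_ctx Sg \<Gamma> \<Longrightarrow> fm \<Gamma> \<phi> \<Longrightarrow> Seq \<Gamma> [\<phi>] \<phi> \<in> thms"
  by (rule Lm.m_rule [OF m_rule.ax]) auto

lemma Seq_trans: "Seq \<Gamma> [\<phi>] \<psi> \<in> thms \<Longrightarrow> Seq \<Gamma> [\<psi>] \<theta> \<in> thms \<Longrightarrow> Seq \<Gamma> [\<phi>] \<theta> \<in> thms"
  using Lm.m_rule [OF m_rule.cut [of La Sg \<Gamma> "[\<phi>]" \<psi> "[]" "[]" \<theta>]] by auto

text \<open>One list is substituted on each side of the sequent. With \<open>Ms = Ns\<close> this is
  monotonicity of reindexing; with provably equal lists it makes reindexing independent of
  representatives.\<close>

lemma Seq_subst:
  assumes "is_ctx Sg \<Delta>" "tms \<Delta> Ms \<Gamma>" "tms \<Delta> Ns \<Gamma>" "teq \<Delta> \<Gamma> Ms Ns" "Seq \<Gamma> [\<phi>] \<psi> \<in> thms"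
  shows "Seq \<Delta> [fm_subst \<phi> (length \<Delta>) Ms] (fm_subst \<psi> (length \<Delta>) Ns) \<in> thms"
  using Lm.m_rule [OF m_rule.subst [of Sg \<Delta> Ms \<Gamma> Ns La "[\<phi>]" \<psi>], of "{}"] assms
  by (auto simp: teq_def dest: list_all2_lengthD)

definition "eqv \<Gamma> \<phi> \<psi> \<longleftrightarrow> Seq \<Gamma> [\<phi>] \<psi> \<in> thms \<and> Seq \<Gamma> [\<psi>] \<phi> \<in> thms"

lemma eqv_refl: "is_ctx Sg \<Gamma> \<Longrightarrow> fm \<Gamma> \<phi> \<Longrightarrow> eqv \<Gamma> \<phi> \<phi>"
  by (simp add: eqv_def Seq_ax)

lemma eqv_sym: "eqv \<Gamma> \<phi> \<psi> \<Longrightarrow> eqv \<Gamma> \<psi> \<phi>"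
  by (simp add: eqv_def)

lemma eqv_trans: "eqv \<Gamma> \<phi> \<psi> \<Longrightarrow> eqv \<Gamma> \<psi> \<theta> \<Longrightarrow> eqv \<Gamma> \<phi> \<theta>"
  unfolding eqv_def using Seq_trans by blast

lemma eqv_subst:
  assumes "is_ctx Sg \<Delta>" "tms \<Delta> Ms \<Gamma>" "tms \<Delta> Ns \<Gamma>" "teq \<Delta> \<Gamma> Ms Ns" "eqv \<Gamma> \<phi> \<psi>"
  shows "eqv \<Delta> (fm_subst \<phi> (length \<Delta>) Ms) (fm_subst \<psi> (length \<Delta>) Ns)"
  using Seq_subst [OF assms(1-4)] Seq_subst [OF assms(1,3,2) teq_sym [OF assms(4)]] assms(5)
  by (simp add: eqv_def)

lemma eqv_conn:
  assumes "is_ctx Sg \<Gamma>" "k \<in> conns La (length \<phi>s)" "list_all2 (eqv \<Gamma>) \<phi>s \<psi>s"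
  shows "eqv \<Gamma> (Conn k \<phi>s) (Conn k \<psi>s)"
proof -
  have "Seq \<Gamma> [Conn k \<phi>s] (Conn k \<psi>s) \<in> thms"
    if "k \<in> conns La (length \<phi>s)" "list_all2 (eqv \<Gamma>) \<phi>s \<psi>s" for \<phi>s \<psi>s
    by (rule Lm.m_rule [OF m_rule.conn [OF assms(1) that(1)]])
      (use that(2) in \<open>auto simp: list_all2_conv_all_nth eqv_def\<close>)
  moreover have "list_all2 (eqv \<Gamma>) \<psi>s \<phi>s"
    using assms(3) eqv_sym by (auto simp: list_all2_conv_all_nth)
  ultimately show ?thesis
    using assms list_all2_lengthD [OF assms(3)] by (simp add: eqv_def)
qed

lemma eqv_quant: "\<omega> \<in> quants La \<Longrightarrow> eqv (\<Gamma> @ [\<sigma>]) \<phi> \<psi> \<Longrightarrow> eqv \<Gamma> (Quant \<omega> \<sigma> \<phi>) (Quant \<omega> \<sigma> \<psi>)"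
  unfolding eqv_def by (intro conjI; rule Lm.m_rule [OF m_rule.quant]; auto)

lemma eqv_foldr_Quant:
  "\<omega> \<in> quants La \<Longrightarrow> eqv (\<Gamma> @ \<Delta>) \<phi> \<psi> \<Longrightarrow> eqv \<Gamma> (foldr (Quant \<omega>) \<Delta> \<phi>) (foldr (Quant \<omega>) \<Delta> \<psi>)"
proof (induction \<Delta> arbitrary: \<Gamma>)
  case (Cons \<sigma> \<Delta>)
  then show ?case using eqv_quant Cons.IH [of "\<Gamma> @ [\<sigma>]"] by simp
qed simp

lemma Unit_fm: "fm \<Gamma> (Unit La)"
  unfolding Unit_def by (rule is_fm.conn) (use is_language_conns(1) [OF language] in auto)

lemma Tensor_fm: "fm \<Gamma> \<phi> \<Longrightarrow> fm \<Gamma> \<psi> \<Longrightarrow> fm \<Gamma> (Tensor La \<phi> \<psi>)"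
  unfolding Tensor_def by (rule is_fm.conn) (use is_language_conns(2) [OF language] in auto)

lemma Tensors_fm: "(\<And>\<phi>. \<phi> \<in> set \<phi>s \<Longrightarrow> fm \<Gamma> \<phi>) \<Longrightarrow> fm \<Gamma> (Tensors La \<phi>s)"
  unfolding Tensors_def by (induction \<phi>s rule: induct_list012) (auto simp: Unit_fm Tensor_fm)

lemma Seq_tensor:
  "Seq \<Gamma> (\<Phi> @ [\<alpha>, \<beta>] @ \<Psi>) \<theta> \<in> thms \<longleftrightarrow> Seq \<Gamma> (\<Phi> @ [Tensor La \<alpha> \<beta>] @ \<Psi>) \<theta> \<in> thms"
  using Lm.m_rule [OF m_rule.tensor [of La Sg \<Gamma> \<Phi> \<alpha> \<beta> \<Psi> \<theta>], of "{}"]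
    Lm.m_rule [OF m_rule.tensor' [of La Sg \<Gamma> \<Phi> \<alpha> \<beta> \<Psi> \<theta>], of "{}"] by auto

lemma Seq_unit: "Seq \<Gamma> (\<Phi> @ \<Psi>) \<theta> \<in> thms \<longleftrightarrow> Seq \<Gamma> (\<Phi> @ [Unit La] @ \<Psi>) \<theta> \<in> thms"
  using Lm.m_rule [OF m_rule.unit [of La Sg \<Gamma> \<Phi> \<Psi> \<theta>], of "{}"]
    Lm.m_rule [OF m_rule.unit' [of La Sg \<Gamma> \<Phi> \<Psi> \<theta>], of "{}"] by auto

text \<open>A Yoneda argument: by the axiom rule each formula is among its own consequences, hence
  among those of the other. It suits the two-way rules, which describe tensor and unit through
  consequences.\<close>

lemma eqvI_Seq:
  assumes "is_ctx Sg \<Gamma>" "fm \<Gamma> \<phi>" "fm \<Gamma> \<psi>"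
    and "\<And>\<theta>. Seq \<Gamma> [\<phi>] \<theta> \<in> thms \<longleftrightarrow> Seq \<Gamma> [\<psi>] \<theta> \<in> thms"
  shows "eqv \<Gamma> \<phi> \<psi>"
  using assms Seq_ax by (auto simp: eqv_def)

text \<open>Unpacked by the two-way rule, both formulas have the same consequences as the list
  \<open>[\<alpha>, \<beta>, \<gamma>]\<close>.\<close>

lemma eqv_tensor_assoc:
  assumes "is_ctx Sg \<Gamma>" "fm \<Gamma> \<alpha>" "fm \<Gamma> \<beta>" "fm \<Gamma> \<gamma>"
  shows "eqv \<Gamma> (Tensor La (Tensor La \<alpha> \<beta>) \<gamma>) (Tensor La \<alpha> (Tensor La \<beta> \<gamma>))"
proof (rule eqvI_Seq)
  fix \<theta>
  show "Seq \<Gamma> [Tensor La (Tensor La \<alpha> \<beta>) \<gamma>] \<theta> \<in> thms \<longleftrightarrow> Seq \<Gamma> [Tensor La \<alpha> (Tensor La \<beta> \<gamma>)] \<theta> \<in> thms"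
    using Seq_tensor [of \<Gamma> "[]" "Tensor La \<alpha> \<beta>" \<gamma> "[]" \<theta>] Seq_tensor [of \<Gamma> "[]" \<alpha> \<beta> "[\<gamma>]" \<theta>]
      Seq_tensor [of \<Gamma> "[]" \<alpha> "Tensor La \<beta> \<gamma>" "[]" \<theta>] Seq_tensor [of \<Gamma> "[\<alpha>]" \<beta> \<gamma> "[]" \<theta>] by simp
qed (use assms Tensor_fm in auto)

lemma eqv_unit:
  assumes "is_ctx Sg \<Gamma>" "fm \<Gamma> \<alpha>"
  shows "eqv \<Gamma> (Tensor La (Unit La) \<alpha>) \<alpha>" "eqv \<Gamma> (Tensor La \<alpha> (Unit La)) \<alpha>"
proof -
  show "eqv \<Gamma> (Tensor La (Unit La) \<alpha>) \<alpha>"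
  proof (rule eqvI_Seq)
    show "Seq \<Gamma> [Tensor La (Unit La) \<alpha>] \<theta> \<in> thms \<longleftrightarrow> Seq \<Gamma> [\<alpha>] \<theta> \<in> thms" for \<theta>
      using Seq_tensor [of \<Gamma> "[]" "Unit La" \<alpha> "[]" \<theta>] Seq_unit [of \<Gamma> "[]" "[\<alpha>]" \<theta>] by simp
  qed (use assms Tensor_fm Unit_fm in auto)
  show "eqv \<Gamma> (Tensor La \<alpha> (Unit La)) \<alpha>"
  proof (rule eqvI_Seq)
    show "Seq \<Gamma> [Tensor La \<alpha> (Unit La)] \<theta> \<in> thms \<longleftrightarrow> Seq \<Gamma> [\<alpha>] \<theta> \<in> thms" for \<theta>
      using Seq_tensor [of \<Gamma> "[]" \<alpha> "Unit La" "[]" \<theta>] Seq_unit [of \<Gamma> "[\<alpha>]" "[]" \<theta>] by simp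
  qed (use assms Tensor_fm Unit_fm in auto)
qed


section \<open>The classifying prop-category\<close>

lemma tc_eq_iff:
  assumes "is_ctx Sg \<Gamma>" "tms \<Gamma> Ms \<Delta>" "tms \<Gamma> Ns \<Delta>"
  shows "tc \<Gamma> \<Delta> Ms = tc \<Gamma> \<Delta> Ns \<longleftrightarrow> teq \<Gamma> \<Delta> Ms Ns"
proof
  assume "tc \<Gamma> \<Delta> Ms = tc \<Gamma> \<Delta> Ns"
  moreover have "Ns \<in> snd (snd (tc \<Gamma> \<Delta> Ns))"
    using teq_refl [OF assms(1,3)] assms(3) by (simp add: tms_class_def teq_def)
  ultimately have "Ns \<in> snd (snd (tc \<Gamma> \<Delta> Ms))" by simp
  then show "teq \<Gamma> \<Delta> Ms Ns" by (simp add: tms_class_def teq_def)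
next
  assume "teq \<Gamma> \<Delta> Ms Ns"
  then have "teq \<Gamma> \<Delta> Ms Ks \<longleftrightarrow> teq \<Gamma> \<Delta> Ns Ks" for Ks
    using teq_sym teq_trans by blast
  then show "tc \<Gamma> \<Delta> Ms = tc \<Gamma> \<Delta> Ns"
    by (simp add: tms_class_def teq_def)
qed

text \<open>The class is named as part of a triple because composition and reindexing of
  \<open>classifying\<close> take their arguments apart by pattern matching.\<close>

lemma tc_rep:
  assumes "is_ctx Sg \<Gamma>" "tms \<Gamma> Ms \<Delta>" "tc \<Gamma> \<Delta> Ms = (\<Gamma>', \<Delta>', X)"
  shows "tms \<Gamma> (rep X) \<Delta>" "teq \<Gamma> \<Delta> Ms (rep X)"
proof -
  have X: "X = {Ns. tms \<Gamma> Ns \<Delta> \<and> teq \<Gamma> \<Delta> Ms Ns}"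
    using arg_cong [OF assms(3), of "\<lambda>x. snd (snd x)"] by (simp add: tms_class_def teq_def)
  have "rep X \<in> X"
    unfolding rep_def by (rule someI [of _ Ms]) (use X assms teq_refl in auto)
  then show "tms \<Gamma> (rep X) \<Delta>" "teq \<Gamma> \<Delta> Ms (rep X)" using X by auto
qed

lemma fc_eq_iff:
  assumes "is_ctx Sg \<Gamma>" "fm \<Gamma> \<phi>" "fm \<Gamma> \<psi>"
  shows "fc \<Gamma> \<phi> = fc \<Gamma> \<psi> \<longleftrightarrow> eqv \<Gamma> \<phi> \<psi>"
proof
  assume "fc \<Gamma> \<phi> = fc \<Gamma> \<psi>"
  moreover have "\<psi> \<in> fc \<Gamma> \<psi>"
    using eqv_refl [OF assms(1,3)] assms(3) by (simp add: fm_class_def eqv_def)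
  ultimately have "\<psi> \<in> fc \<Gamma> \<phi>" by simp
  then show "eqv \<Gamma> \<phi> \<psi>" by (simp add: fm_class_def eqv_def)
next
  assume "eqv \<Gamma> \<phi> \<psi>"
  then have "eqv \<Gamma> \<phi> \<theta> \<longleftrightarrow> eqv \<Gamma> \<psi> \<theta>" for \<theta>
    using eqv_sym eqv_trans by blast
  then show "fc \<Gamma> \<phi> = fc \<Gamma> \<psi>"
    by (simp add: fm_class_def eqv_def)
qed

lemma fc_rep:
  assumes "is_ctx Sg \<Gamma>" "fm \<Gamma> \<phi>"
  shows "fm \<Gamma> (rep (fc \<Gamma> \<phi>))" "eqv \<Gamma> \<phi> (rep (fc \<Gamma> \<phi>))"
proof -
  have X: "fc \<Gamma> \<phi> = {\<psi>. fm \<Gamma> \<psi> \<and> eqv \<Gamma> \<phi> \<psi>}"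
    by (simp add: fm_class_def eqv_def)
  have "rep (fc \<Gamma> \<phi>) \<in> fc \<Gamma> \<phi>"
    unfolding rep_def by (rule someI [of _ \<phi>]) (use X assms eqv_refl in auto)
  then show "fm \<Gamma> (rep (fc \<Gamma> \<phi>))" "eqv \<Gamma> \<phi> (rep (fc \<Gamma> \<phi>))" using X by auto
qed

lemma Cl_sel:
  "Ob Cl = {\<Gamma>. is_ctx Sg \<Gamma>}"
  "idn Cl \<Gamma> = tc \<Gamma> \<Gamma> (vars 0 (length \<Gamma>))"
  "top_ob Cl = []"
  "prd Cl \<Gamma> \<Delta> = \<Gamma> @ \<Delta>"
  "pr1 Cl \<Gamma> \<Delta> = tc (\<Gamma> @ \<Delta>) \<Gamma> (vars 0 (length \<Gamma>))"
  "pr2 Cl \<Gamma> \<Delta> = tc (\<Gamma> @ \<Delta>) \<Delta> (vars (length \<Gamma>) (length \<Delta>))"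
  "El Cl \<Gamma> = fc \<Gamma> ` {\<phi>. fm \<Gamma> \<phi>}"
  by (simp_all add: classifying_def)

lemma hom_Cl: "hom_set Cl \<Gamma> \<Delta> = {tc \<Gamma> \<Delta> Ms | Ms. is_ctx Sg \<Gamma> \<and> is_ctx Sg \<Delta> \<and> tms \<Gamma> Ms \<Delta>}"
  by (auto simp: hom_set_def classifying_def tms_class_def)

lemma tc_hom: "is_ctx Sg \<Gamma> \<Longrightarrow> is_ctx Sg \<Delta> \<Longrightarrow> tms \<Gamma> Ms \<Delta> \<Longrightarrow> tc \<Gamma> \<Delta> Ms \<in> hom_set Cl \<Gamma> \<Delta>"
  by (auto simp: hom_Cl)

lemma dm_cd_Cl: "dm Cl (tc \<Gamma> \<Delta> Ms) = \<Gamma>" "cd Cl (tc \<Gamma> \<Delta> Ms) = \<Delta>"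
  by (simp_all add: classifying_def tms_class_def)

lemma hom_ClE:
  assumes "f \<in> hom_set Cl \<Gamma> \<Delta>"
  obtains Ms where "is_ctx Sg \<Gamma>" "is_ctx Sg \<Delta>" "tms \<Gamma> Ms \<Delta>" "f = tc \<Gamma> \<Delta> Ms"
  using assms by (auto simp: hom_Cl)

text \<open>The definition composes chosen representatives; by \<open>teq_subst\<close> any others
  give the same class. The evaluations of reindexing, connectives and quantifiers follow the same
  pattern with the matching congruence.\<close>

lemma cmp_Cl:
  assumes "is_ctx Sg \<Gamma>" "is_ctx Sg \<Delta>" "tms \<Gamma> Ms \<Delta>" "tms \<Delta> Ns \<Theta>"
  shows "cmp Cl (tc \<Delta> \<Theta> Ns) (tc \<Gamma> \<Delta> Ms) = tc \<Gamma> \<Theta> (map (tm_subst Ms) Ns)"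
proof -
  obtain X where X: "tc \<Gamma> \<Delta> Ms = (\<Gamma>, \<Delta>, X)" by (simp add: tms_class_def)
  obtain Y where Y: "tc \<Delta> \<Theta> Ns = (\<Delta>, \<Theta>, Y)" by (simp add: tms_class_def)
  note x = tc_rep [OF assms(1,3) X] and y = tc_rep [OF assms(2,4) Y]
  have "cmp Cl (tc \<Delta> \<Theta> Ns) (tc \<Gamma> \<Delta> Ms) = tc \<Gamma> \<Theta> (map (tm_subst (rep X)) (rep Y))"
    unfolding X Y by (simp add: classifying_def)
  also have "\<dots> = tc \<Gamma> \<Theta> (map (tm_subst Ms) Ns)"
    using teq_subst [OF assms(1) x(1) assms(3) teq_sym [OF x(2)] y(1) assms(4) teq_sym [OF y(2)]]
      tc_eq_iff [OF assms(1) tms_subst_typed [OF x(1) y(1)] tms_subst_typed [OF assms(3,4)]] by simp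
  finally show ?thesis .
qed

lemma reidx_Cl:
  assumes "is_ctx Sg \<Gamma>" "is_ctx Sg \<Delta>" "tms \<Gamma> Ms \<Delta>" "fm \<Delta> \<phi>"
  shows "reidx Cl (tc \<Gamma> \<Delta> Ms) (fc \<Delta> \<phi>) = fc \<Gamma> (fm_subst \<phi> (length \<Gamma>) Ms)"
proof -
  obtain X where X: "tc \<Gamma> \<Delta> Ms = (\<Gamma>, \<Delta>, X)" by (simp add: tms_class_def)
  note x = tc_rep [OF assms(1,3) X] and y = fc_rep [OF assms(2,4)]
  have "reidx Cl (tc \<Gamma> \<Delta> Ms) (fc \<Delta> \<phi>) = fc \<Gamma> (fm_subst (rep (fc \<Delta> \<phi>)) (length \<Gamma>) (rep X))"
    unfolding X by (simp add: classifying_def)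
  also have "\<dots> = fc \<Gamma> (fm_subst \<phi> (length \<Gamma>) Ms)"
    using eqv_subst [OF assms(1) x(1) assms(3) teq_sym [OF x(2)] eqv_sym [OF y(2)]]
      fc_eq_iff [OF assms(1) is_fm_subst [OF y(1) x(1)] is_fm_subst [OF assms(4,3)]] by simp
  finally show ?thesis .
qed

lemma conn_Cl:
  assumes "is_ctx Sg \<Gamma>" "k \<in> conns La (length \<phi>s)" "\<And>\<phi>. \<phi> \<in> set \<phi>s \<Longrightarrow> fm \<Gamma> \<phi>"
  shows "conn_op Cl \<Gamma> k (map (fc \<Gamma>) \<phi>s) = fc \<Gamma> (Conn k \<phi>s)"
proof -
  let ?\<psi>s = "map (\<lambda>\<phi>. rep (fc \<Gamma> \<phi>)) \<phi>s"
  have "eqv \<Gamma> (Conn k ?\<psi>s) (Conn k \<phi>s)"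
    using assms fc_rep(2) eqv_sym by (intro eqv_conn) (auto simp: list_all2_conv_all_nth)
  moreover have "fm \<Gamma> (Conn k ?\<psi>s)" "fm \<Gamma> (Conn k \<phi>s)"
    using assms fc_rep(1) by (auto intro!: is_fm.conn)
  ultimately have "fc \<Gamma> (Conn k ?\<psi>s) = fc \<Gamma> (Conn k \<phi>s)"
    using fc_eq_iff [OF assms(1)] by blast
  then show ?thesis by (simp add: classifying_def comp_def)
qed

lemma quant_Cl:
  assumes "\<omega> \<in> quants La" "is_ctx Sg \<Gamma>" "is_ctx Sg \<Delta>" "fm (\<Gamma> @ \<Delta>) \<phi>"
  shows "quant_op Cl \<omega> \<Gamma> \<Delta> (fc (\<Gamma> @ \<Delta>) \<phi>) = fc \<Gamma> (foldr (Quant \<omega>) \<Delta> \<phi>)"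
proof -
  have c: "is_ctx Sg (\<Gamma> @ \<Delta>)" using assms by simp
  note y = fc_rep [OF c assms(4)]
  have "fc \<Gamma> (foldr (Quant \<omega>) \<Delta> (rep (fc (\<Gamma> @ \<Delta>) \<phi>))) = fc \<Gamma> (foldr (Quant \<omega>) \<Delta> \<phi>)"
    using eqv_foldr_Quant [OF assms(1) eqv_sym [OF y(2)]]
      fc_eq_iff [OF assms(2) is_fm_foldr_Quant [OF assms(1,3) y(1)] is_fm_foldr_Quant [OF assms(1,3,4)]]
    by simp
  then show ?thesis by (simp add: classifying_def)
qed

lemma Po_Cl:
  assumes "is_ctx Sg \<Gamma>" "fm \<Gamma> \<phi>" "fm \<Gamma> \<psi>"
  shows "(fc \<Gamma> \<phi>, fc \<Gamma> \<psi>) \<in> Po Cl \<Gamma> \<longleftrightarrow> Seq \<Gamma> [\<phi>] \<psi> \<in> thms"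
proof
  assume "(fc \<Gamma> \<phi>, fc \<Gamma> \<psi>) \<in> Po Cl \<Gamma>"
  then obtain \<phi>' \<psi>' where "fc \<Gamma> \<phi> = fc \<Gamma> \<phi>'" "fc \<Gamma> \<psi> = fc \<Gamma> \<psi>'" "fm \<Gamma> \<phi>'" "fm \<Gamma> \<psi>'" "Seq \<Gamma> [\<phi>'] \<psi>' \<in> thms"
    by (auto simp: classifying_def)
  then show "Seq \<Gamma> [\<phi>] \<psi> \<in> thms"
    using fc_eq_iff [OF assms(1)] assms(2,3) Seq_trans unfolding eqv_def by metis
qed (use assms in \<open>auto simp: classifying_def\<close>)

lemma Po_ClE:
  assumes "(x, y) \<in> Po Cl \<Gamma>"
  obtains \<phi> \<psi> where "x = fc \<Gamma> \<phi>" "y = fc \<Gamma> \<psi>" "fm \<Gamma> \<phi>" "fm \<Gamma> \<psi>" "Seq \<Gamma> [\<phi>] \<psi> \<in> thms"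
  using assms by (auto simp: classifying_def)

lemma El_ClE:
  assumes "x \<in> El Cl \<Gamma>" obtains \<phi> where "fm \<Gamma> \<phi>" "x = fc \<Gamma> \<phi>"
  using assms by (auto simp: Cl_sel)

lemma El_Cl_I: "fm \<Gamma> \<phi> \<Longrightarrow> fc \<Gamma> \<phi> \<in> El Cl \<Gamma>"
  by (simp add: Cl_sel)

lemma El_Cl_lists:
  assumes "set xs \<subseteq> El Cl \<Gamma>"
  obtains \<phi>s where "\<And>\<phi>. \<phi> \<in> set \<phi>s \<Longrightarrow> fm \<Gamma> \<phi>" "xs = map (fc \<Gamma>) \<phi>s"
proof -
  have "xs \<in> lists (fc \<Gamma> ` {\<phi>. fm \<Gamma> \<phi>})" using assms by (auto simp: Cl_sel)
  then show thesis using that unfolding lists_image by auto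
qed

lemma pr1_typed: "tms (\<Gamma> @ \<Delta>) (vars 0 (length \<Gamma>)) \<Gamma>"
  by (rule vars_0_typed)

lemma pr2_typed: "tms (\<Gamma> @ \<Delta>) (vars (length \<Gamma>) (length \<Delta>)) \<Delta>"
  using vars_typed [of Sg \<Gamma> \<Delta> "[]"] by simp

lemma idn_typed: "tms \<Gamma> (vars 0 (length \<Gamma>)) \<Gamma>"
  using vars_0_typed [of Sg \<Gamma> "[]"] by simp

lemma pair_typed: "tms \<Gamma> Ms \<Delta> \<Longrightarrow> tms \<Gamma> Ns \<Theta> \<Longrightarrow> tms \<Gamma> (Ms @ Ns) (\<Delta> @ \<Theta>)"
  by (simp add: list_all2_appendI)

lemma cmp_pr_Cl:
  assumes "is_ctx Sg \<Gamma>" "is_ctx Sg \<Delta>" "is_ctx Sg \<Theta>" "tms \<Gamma> Ms \<Delta>" "tms \<Gamma> Ns \<Theta>"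
  shows "cmp Cl (pr1 Cl \<Delta> \<Theta>) (tc \<Gamma> (\<Delta> @ \<Theta>) (Ms @ Ns)) = tc \<Gamma> \<Delta> Ms"
    "cmp Cl (pr2 Cl \<Delta> \<Theta>) (tc \<Gamma> (\<Delta> @ \<Theta>) (Ms @ Ns)) = tc \<Gamma> \<Theta> Ns"
  using cmp_Cl [OF assms(1) _ pair_typed [OF assms(4,5)] pr1_typed]
    cmp_Cl [OF assms(1) _ pair_typed [OF assms(4,5)] pr2_typed] assms
    list_all2_lengthD [OF assms(4)] list_all2_lengthD [OF assms(5)]
  by (simp_all add: Cl_sel map_tm_subst_vars_append)

sublocale Cl: fp_category Cl
proof
  fix \<Gamma> \<Delta> \<Theta> \<Lambda> f g h
  show "dm Cl f \<in> Ob Cl" "cd Cl f \<in> Ob Cl" if "f \<in> Ar Cl"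
    using that by (auto simp: classifying_def tms_class_def)
  show "idn Cl \<Gamma> \<in> hom_set Cl \<Gamma> \<Gamma>" if "\<Gamma> \<in> Ob Cl"
    using that by (simp add: Cl_sel tc_hom idn_typed)
  show "cmp Cl g f \<in> hom_set Cl \<Gamma> \<Theta>" if "f \<in> hom_set Cl \<Gamma> \<Delta>" "g \<in> hom_set Cl \<Delta> \<Theta>"
    using that by (elim hom_ClE) (simp add: cmp_Cl tc_hom tms_subst_typed)
  show "cmp Cl (idn Cl \<Delta>) f = f" "cmp Cl f (idn Cl \<Gamma>) = f" if f: "f \<in> hom_set Cl \<Gamma> \<Delta>"
  proof -
    from f obtain Ms where Ms: "is_ctx Sg \<Gamma>" "is_ctx Sg \<Delta>" "tms \<Gamma> Ms \<Delta>" "f = tc \<Gamma> \<Delta> Ms"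
      by (rule hom_ClE)
    have "map (tm_subst Ms) (vars 0 (length \<Delta>)) = Ms"
      using map_tm_subst_vars_append(1) [of Ms "length \<Delta>" "[]"] list_all2_lengthD [OF Ms(3)] by simp
    then show "cmp Cl (idn Cl \<Delta>) f = f" "cmp Cl f (idn Cl \<Gamma>) = f"
      using cmp_Cl [OF Ms(1-3) idn_typed] cmp_Cl [OF Ms(1,1) idn_typed Ms(3)]
        map_tm_subst_id [OF Ms(3) HOL.refl] Ms(4) by (simp_all add: Cl_sel)
  qed
  show "cmp Cl h (cmp Cl g f) = cmp Cl (cmp Cl h g) f"
    if f: "f \<in> hom_set Cl \<Gamma> \<Delta>" and g: "g \<in> hom_set Cl \<Delta> \<Theta>" and h: "h \<in> hom_set Cl \<Theta> \<Lambda>"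
  proof -
    from f obtain Ms where Ms: "is_ctx Sg \<Gamma>" "is_ctx Sg \<Delta>" "tms \<Gamma> Ms \<Delta>" "f = tc \<Gamma> \<Delta> Ms"
      by (rule hom_ClE)
    from g obtain Ns where Ns: "is_ctx Sg \<Theta>" "tms \<Delta> Ns \<Theta>" "g = tc \<Delta> \<Theta> Ns"
      by (rule hom_ClE)
    from h obtain Ks where Ks: "is_ctx Sg \<Lambda>" "tms \<Theta> Ks \<Lambda>" "h = tc \<Theta> \<Lambda> Ks"
      by (rule hom_ClE)
    show ?thesis
      unfolding Ms(4) Ns(3) Ks(3) cmp_Cl [OF Ms(1-3) Ns(2)] cmp_Cl [OF Ms(2) Ns(1,2) Ks(2)]
        cmp_Cl [OF Ms(1) Ns(1) tms_subst_typed [OF Ms(3) Ns(2)] Ks(2)]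
        cmp_Cl [OF Ms(1-3) tms_subst_typed [OF Ns(2) Ks(2)]]
        map_tm_subst_comp [OF Ks(2) list_all2_lengthD [OF Ns(2)]] ..
  qed
  show "top_ob Cl \<in> Ob Cl" by (simp add: Cl_sel)
  \<comment> \<open>The terminal object is the empty context, and the empty list is the only list of
    terms that matches it.\<close>
  show "\<exists>!f. f \<in> hom_set Cl \<Gamma> (top_ob Cl)" if "\<Gamma> \<in> Ob Cl"
    using that by (auto simp: Cl_sel hom_Cl)
  show "prd Cl \<Gamma> \<Delta> \<in> Ob Cl" "pr1 Cl \<Gamma> \<Delta> \<in> hom_set Cl (prd Cl \<Gamma> \<Delta>) \<Gamma>"
    "pr2 Cl \<Gamma> \<Delta> \<in> hom_set Cl (prd Cl \<Gamma> \<Delta>) \<Delta>" if "\<Gamma> \<in> Ob Cl" "\<Delta> \<in> Ob Cl"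
    using that by (auto simp: Cl_sel intro!: tc_hom pr1_typed pr2_typed)
  show "\<exists>!h. h \<in> hom_set Cl \<Gamma> (prd Cl \<Delta> \<Theta>) \<and> cmp Cl (pr1 Cl \<Delta> \<Theta>) h = f \<and> cmp Cl (pr2 Cl \<Delta> \<Theta>) h = g"
    if f: "f \<in> hom_set Cl \<Gamma> \<Delta>" and g: "g \<in> hom_set Cl \<Gamma> \<Theta>"
  proof -
    from f obtain Ms where Ms: "is_ctx Sg \<Gamma>" "is_ctx Sg \<Delta>" "tms \<Gamma> Ms \<Delta>" "f = tc \<Gamma> \<Delta> Ms"
      by (rule hom_ClE)
    from g obtain Ns where Ns: "is_ctx Sg \<Theta>" "tms \<Gamma> Ns \<Theta>" "g = tc \<Gamma> \<Theta> Ns"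
      by (rule hom_ClE)
    show ?thesis
    proof (rule ex1I [of _ "tc \<Gamma> (\<Delta> @ \<Theta>) (Ms @ Ns)"])
      show "tc \<Gamma> (\<Delta> @ \<Theta>) (Ms @ Ns) \<in> hom_set Cl \<Gamma> (prd Cl \<Delta> \<Theta>) \<and>
          cmp Cl (pr1 Cl \<Delta> \<Theta>) (tc \<Gamma> (\<Delta> @ \<Theta>) (Ms @ Ns)) = f \<and>
          cmp Cl (pr2 Cl \<Delta> \<Theta>) (tc \<Gamma> (\<Delta> @ \<Theta>) (Ms @ Ns)) = g"
        using cmp_pr_Cl [OF Ms(1,2) Ns(1) Ms(3) Ns(2)] tc_hom [OF Ms(1) _ pair_typed [OF Ms(3) Ns(2)]] Ms Ns
        by (simp add: Cl_sel(4))
      fix h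
      assume h: "h \<in> hom_set Cl \<Gamma> (prd Cl \<Delta> \<Theta>) \<and> cmp Cl (pr1 Cl \<Delta> \<Theta>) h = f \<and> cmp Cl (pr2 Cl \<Delta> \<Theta>) h = g"
      then obtain Ks where Ks: "tms \<Gamma> Ks (\<Delta> @ \<Theta>)" "h = tc \<Gamma> (\<Delta> @ \<Theta>) Ks"
        by (auto simp: Cl_sel(4) elim: hom_ClE)
      \<comment> \<open>A list of terms for a concatenated context splits at
        \<open>length \<Delta>\<close>, and the parts represent the two projections.\<close>
      then obtain Ms' Ns' where K: "Ks = Ms' @ Ns'" "tms \<Gamma> Ms' \<Delta>" "tms \<Gamma> Ns' \<Theta>"
        by (auto simp: list_all2_append2)
      have "tc \<Gamma> \<Delta> Ms' = tc \<Gamma> \<Delta> Ms" "tc \<Gamma> \<Theta> Ns' = tc \<Gamma> \<Theta> Ns"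
        using h cmp_pr_Cl [OF Ms(1,2) Ns(1) K(2,3)] Ks K Ms Ns by auto
      then have "teq \<Gamma> \<Delta> Ms' Ms" "teq \<Gamma> \<Theta> Ns' Ns"
        using tc_eq_iff Ms Ns K by auto
      then have "teq \<Gamma> (\<Delta> @ \<Theta>) Ks (Ms @ Ns)"
        using list_all2_lengthD [OF K(2)] list_all2_lengthD [OF Ms(3)]
        by (auto simp: teq_iff K(1) nth_append)
      then show "h = tc \<Gamma> (\<Delta> @ \<Theta>) (Ms @ Ns)"
        using tc_eq_iff [OF Ms(1) Ks(1) pair_typed [OF Ms(3) Ns(2)]] Ks by simp
    qed
  qed
qed

lemma pair_Cl:
  assumes "is_ctx Sg \<Gamma>" "is_ctx Sg \<Delta>" "is_ctx Sg \<Theta>" "tms \<Gamma> Ms \<Delta>" "tms \<Gamma> Ns \<Theta>"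
  shows "pair Cl (tc \<Gamma> \<Delta> Ms) (tc \<Gamma> \<Theta> Ns) = tc \<Gamma> (\<Delta> @ \<Theta>) (Ms @ Ns)"
proof (rule Cl.pair_eqI [OF _ _ _ cmp_pr_Cl [OF assms]])
  show "tc \<Gamma> (\<Delta> @ \<Theta>) (Ms @ Ns) \<in> hom_set Cl \<Gamma> (prd Cl \<Delta> \<Theta>)"
    using assms tc_hom [OF _ _ pair_typed [OF assms(4,5)]] by (simp add: Cl_sel)
qed (use assms in \<open>auto simp: Cl_sel\<close>)

lemma prd_id_Cl:
  assumes "is_ctx Sg \<Gamma>" "is_ctx Sg \<Delta>" "is_ctx Sg \<Theta>" "tms \<Gamma> Ms \<Delta>"
  shows "prd_id Cl (tc \<Gamma> \<Delta> Ms) \<Theta> = tc (\<Gamma> @ \<Theta>) (\<Delta> @ \<Theta>) (Ms @ vars (length \<Gamma>) (length \<Theta>))"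
proof -
  have c: "is_ctx Sg (\<Gamma> @ \<Theta>)" using assms by simp
  have m: "map (tm_subst (vars 0 (length \<Gamma>))) Ms = Ms"
    using map_tm_subst_id [OF assms(4)] by simp
  have "tms (\<Gamma> @ \<Theta>) Ms \<Delta>"
    using tms_subst_typed [OF pr1_typed assms(4)] m by simp
  then show ?thesis
    using cmp_Cl [OF c assms(1) pr1_typed assms(4)] pair_Cl [OF c assms(2,3) _ pr2_typed] m
    by (simp add: prd_id_def dm_cd_Cl Cl_sel)
qed

lemma prd_id_typed:
  assumes "tms \<Gamma> Ms \<Delta>"
  shows "tms (\<Gamma> @ \<Theta>) (Ms @ vars (length \<Gamma>) (length \<Theta>)) (\<Delta> @ \<Theta>)"
proof -
  have "tms (\<Gamma> @ \<Theta>) Ms \<Delta>"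
    using assms by (rule list_all2_mono) (rule is_tm_weaken)
  from pair_typed [OF this pr2_typed] show ?thesis .
qed

text \<open>Products of contexts are concatenations, which associate on the nose, so this arrow
  lists all variables in their own order. The iteration law for quantifiers thereby loses its
  reindexing.\<close>

lemma assoc_ar_Cl:
  assumes "is_ctx Sg \<Gamma>" "is_ctx Sg \<Delta>" "is_ctx Sg \<Theta>"
  shows "assoc_ar Cl \<Gamma> \<Delta> \<Theta> = idn Cl (\<Gamma> @ \<Delta> @ \<Theta>)"
proof -
  have c: "is_ctx Sg (\<Gamma> @ \<Delta> @ \<Theta>)" "is_ctx Sg (\<Delta> @ \<Theta>)" "is_ctx Sg (\<Gamma> @ \<Delta>)" using assms by auto
  let ?n = "length \<Gamma>" and ?m = "length \<Delta>" and ?k = "length \<Theta>"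
  have t: "tms (\<Gamma> @ \<Delta> @ \<Theta>) (vars ?n ?m) \<Delta>" "tms (\<Gamma> @ \<Delta> @ \<Theta>) (vars (?n + ?m) ?k) \<Theta>"
    "tms (\<Gamma> @ \<Delta> @ \<Theta>) (vars 0 ?n) \<Gamma>" "tms (\<Gamma> @ \<Delta> @ \<Theta>) (vars ?n (?m + ?k)) (\<Delta> @ \<Theta>)"
    using vars_typed [of Sg \<Gamma> \<Delta> \<Theta>] vars_typed [of Sg "\<Gamma> @ \<Delta>" \<Theta> "[]"] vars_0_typed [of Sg \<Gamma> "\<Delta> @ \<Theta>"]
      vars_typed [of Sg \<Gamma> "\<Delta> @ \<Theta>" "[]"] by auto
  have "cmp Cl (pr1 Cl \<Delta> \<Theta>) (pr2 Cl \<Gamma> (\<Delta> @ \<Theta>)) = tc (\<Gamma> @ \<Delta> @ \<Theta>) \<Delta> (vars ?n ?m)"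
    using cmp_Cl [OF c(1,2) t(4) pr1_typed] by (simp add: Cl_sel map_tm_subst_vars)
  moreover have "cmp Cl (pr2 Cl \<Delta> \<Theta>) (pr2 Cl \<Gamma> (\<Delta> @ \<Theta>)) = tc (\<Gamma> @ \<Delta> @ \<Theta>) \<Theta> (vars (?n + ?m) ?k)"
    using cmp_Cl [OF c(1,2) t(4) pr2_typed] by (simp add: Cl_sel map_tm_subst_vars)
  moreover have "pair Cl (tc (\<Gamma> @ \<Delta> @ \<Theta>) \<Gamma> (vars 0 ?n)) (tc (\<Gamma> @ \<Delta> @ \<Theta>) \<Delta> (vars ?n ?m)) =
      tc (\<Gamma> @ \<Delta> @ \<Theta>) (\<Gamma> @ \<Delta>) (vars 0 (?n + ?m))"
    using pair_Cl [OF c(1) assms(1,2) t(3,1)] vars_append [of 0 ?n ?m, where 'a = 'u] by simp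
  moreover have "pair Cl (tc (\<Gamma> @ \<Delta> @ \<Theta>) (\<Gamma> @ \<Delta>) (vars 0 (?n + ?m))) (tc (\<Gamma> @ \<Delta> @ \<Theta>) \<Theta> (vars (?n + ?m) ?k)) =
      tc (\<Gamma> @ \<Delta> @ \<Theta>) (\<Gamma> @ \<Delta> @ \<Theta>) (vars 0 (?n + ?m + ?k))"
    using pair_Cl [OF c(1,3) assms(3) _ t(2), of "vars 0 (?n + ?m)"] vars_append [of 0 "?n + ?m" ?k, where 'a = 'u]
      vars_0_typed [of Sg "\<Gamma> @ \<Delta>" \<Theta>] by simp
  ultimately show ?thesis
    by (simp add: assoc_ar_def Let_def Cl_sel(2,4,5) add.assoc)
qed

sublocale Cl: prop_category Cl
proof
  fix \<Gamma> \<Delta> \<Theta> f g x y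
  show "partial_order_on (El Cl \<Gamma>) (Po Cl \<Gamma>)" if "\<Gamma> \<in> Ob Cl"
  proof -
    have \<Gamma>: "is_ctx Sg \<Gamma>" using that by (simp add: Cl_sel)
    show ?thesis
      unfolding partial_order_on_def preorder_on_def
    proof (intro conjI)
      show "Po Cl \<Gamma> \<subseteq> El Cl \<Gamma> \<times> El Cl \<Gamma>" by (auto elim!: Po_ClE intro: El_Cl_I)
      show "refl_on (El Cl \<Gamma>) (Po Cl \<Gamma>)"
        using Po_Cl [OF \<Gamma>] Seq_ax [OF \<Gamma>] by (auto simp: refl_on_def elim!: El_ClE)
      show "trans (Po Cl \<Gamma>)"
      proof (rule transI)
        fix x y z assume xy: "(x, y) \<in> Po Cl \<Gamma>" and yz: "(y, z) \<in> Po Cl \<Gamma>"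
        from xy obtain \<phi> \<psi> where p: "x = fc \<Gamma> \<phi>" "y = fc \<Gamma> \<psi>" "fm \<Gamma> \<phi>" "fm \<Gamma> \<psi>" "Seq \<Gamma> [\<phi>] \<psi> \<in> thms"
          by (rule Po_ClE)
        from yz obtain \<theta> where q: "z = fc \<Gamma> \<theta>" "fm \<Gamma> \<theta>" by (rule Po_ClE)
        then have "Seq \<Gamma> [\<psi>] \<theta> \<in> thms" using yz p Po_Cl [OF \<Gamma> p(4) q(2)] by simp
        then show "(x, z) \<in> Po Cl \<Gamma>" using p q Po_Cl [OF \<Gamma>] Seq_trans by blast
      qed
      show "antisym (Po Cl \<Gamma>)"
      proof (rule antisymI)
        fix x y assume xy: "(x, y) \<in> Po Cl \<Gamma>" and yx: "(y, x) \<in> Po Cl \<Gamma>"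
        from xy obtain \<phi> \<psi> where p: "x = fc \<Gamma> \<phi>" "y = fc \<Gamma> \<psi>" "fm \<Gamma> \<phi>" "fm \<Gamma> \<psi>" "Seq \<Gamma> [\<phi>] \<psi> \<in> thms"
          by (rule Po_ClE)
        then show "x = y" using yx Po_Cl [OF \<Gamma> p(4,3)] fc_eq_iff [OF \<Gamma> p(3,4)] by (simp add: eqv_def)
      qed
    qed
  qed
  show "(reidx Cl f x, reidx Cl f y) \<in> Po Cl \<Gamma>" if f: "f \<in> hom_set Cl \<Gamma> \<Delta>" and xy: "(x, y) \<in> Po Cl \<Delta>"
  proof -
    from f obtain Ms where Ms: "is_ctx Sg \<Gamma>" "is_ctx Sg \<Delta>" "tms \<Gamma> Ms \<Delta>" "f = tc \<Gamma> \<Delta> Ms"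
      by (rule hom_ClE)
    from xy obtain \<phi> \<psi> where p: "x = fc \<Delta> \<phi>" "y = fc \<Delta> \<psi>" "fm \<Delta> \<phi>" "fm \<Delta> \<psi>" "Seq \<Delta> [\<phi>] \<psi> \<in> thms"
      by (rule Po_ClE)
    show ?thesis
      using Seq_subst [OF Ms(1,3,3) teq_refl [OF Ms(1,3)] p(5)] Po_Cl [OF Ms(1)] is_fm_subst [OF _ Ms(3)] p Ms
      by (simp add: reidx_Cl)
  qed
  show "reidx Cl (idn Cl \<Gamma>) x = x" if \<Gamma>: "\<Gamma> \<in> Ob Cl" and x: "x \<in> El Cl \<Gamma>"
  proof -
    from x obtain \<phi> where "fm \<Gamma> \<phi>" "x = fc \<Gamma> \<phi>" by (rule El_ClE)
    then show ?thesis
      using \<Gamma> by (simp add: Cl_sel reidx_Cl [OF _ _ idn_typed] fm_subst_id)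
  qed
  show "reidx Cl (cmp Cl g f) x = reidx Cl f (reidx Cl g x)"
    if f: "f \<in> hom_set Cl \<Gamma> \<Delta>" and g: "g \<in> hom_set Cl \<Delta> \<Theta>" and x: "x \<in> El Cl \<Theta>"
  proof -
    from f obtain Ms where Ms: "is_ctx Sg \<Gamma>" "is_ctx Sg \<Delta>" "tms \<Gamma> Ms \<Delta>" "f = tc \<Gamma> \<Delta> Ms"
      by (rule hom_ClE)
    from g obtain Ns where Ns: "is_ctx Sg \<Theta>" "tms \<Delta> Ns \<Theta>" "g = tc \<Delta> \<Theta> Ns"
      by (rule hom_ClE)
    from x obtain \<phi> where p: "fm \<Theta> \<phi>" "x = fc \<Theta> \<phi>" by (rule El_ClE)
    show ?thesis
      using fm_subst_comp [OF p(1) Ns(2) list_all2_lengthD [OF Ms(3)]] p Ms Ns is_fm_subst [OF p(1) Ns(2)]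
      by (simp add: cmp_Cl reidx_Cl tms_subst_typed [OF Ms(3) Ns(2)])
  qed
qed

section \<open>Tensor, equality and quantifiers of the classifying prop-category\<close>

lemma unit_Cl: "is_ctx Sg \<Gamma> \<Longrightarrow> unit_el La Cl \<Gamma> = fc \<Gamma> (Unit La)"
  using conn_Cl [OF _ is_language_conns(1) [OF language]] by (simp add: unit_el_def Unit_def)

lemma tensor_Cl: "is_ctx Sg \<Gamma> \<Longrightarrow> fm \<Gamma> \<phi> \<Longrightarrow> fm \<Gamma> \<psi> \<Longrightarrow>
    tensor_op La Cl \<Gamma> (fc \<Gamma> \<phi>) (fc \<Gamma> \<psi>) = fc \<Gamma> (Tensor La \<phi> \<psi>)"
  using conn_Cl [OF _ is_language_conns(2) [OF language], of \<Gamma> \<phi> \<psi>] by (auto simp: tensor_op_def Tensor_def)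

lemma monoid_Cl:
  assumes \<Gamma>: "is_ctx Sg \<Gamma>"
  shows "monoid \<lparr>carrier = El Cl \<Gamma>, mult = tensor_op La Cl \<Gamma>, one = unit_el La Cl \<Gamma>\<rparr>"
proof (rule monoidI; simp only: partial_object.simps monoid.simps)
  fix x y z assume "x \<in> El Cl \<Gamma>" "y \<in> El Cl \<Gamma>" "z \<in> El Cl \<Gamma>"
  then obtain \<phi> \<psi> \<theta> where f: "fm \<Gamma> \<phi>" "fm \<Gamma> \<psi>" "fm \<Gamma> \<theta>" and x: "x = fc \<Gamma> \<phi>" "y = fc \<Gamma> \<psi>" "z = fc \<Gamma> \<theta>"
    by (auto elim!: El_ClE)
  have "fc \<Gamma> (Tensor La (Tensor La \<phi> \<psi>) \<theta>) = fc \<Gamma> (Tensor La \<phi> (Tensor La \<psi> \<theta>))"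
    by (rule fc_eq_iff [OF \<Gamma>, THEN iffD2]) (intro Tensor_fm f eqv_tensor_assoc \<Gamma>)+
  then show "tensor_op La Cl \<Gamma> (tensor_op La Cl \<Gamma> x y) z = tensor_op La Cl \<Gamma> x (tensor_op La Cl \<Gamma> y z)"
    unfolding x using f by (simp add: tensor_Cl \<Gamma> Tensor_fm)
next
  fix x y assume "x \<in> El Cl \<Gamma>" "y \<in> El Cl \<Gamma>"
  then show "tensor_op La Cl \<Gamma> x y \<in> El Cl \<Gamma>"
    by (auto simp: tensor_Cl \<Gamma> intro!: El_Cl_I Tensor_fm elim!: El_ClE)
next
  show "unit_el La Cl \<Gamma> \<in> El Cl \<Gamma>"
    unfolding unit_Cl [OF \<Gamma>] by (rule El_Cl_I [OF Unit_fm])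
next
  fix x assume "x \<in> El Cl \<Gamma>"
  then obtain \<phi> where f: "fm \<Gamma> \<phi>" and x: "x = fc \<Gamma> \<phi>" by (rule El_ClE)
  have "fc \<Gamma> (Tensor La (Unit La) \<phi>) = fc \<Gamma> \<phi>" "fc \<Gamma> (Tensor La \<phi> (Unit La)) = fc \<Gamma> \<phi>"
    using f by (simp_all add: fc_eq_iff \<Gamma> Tensor_fm Unit_fm eqv_unit)
  then show "tensor_op La Cl \<Gamma> (unit_el La Cl \<Gamma>) x = x" "tensor_op La Cl \<Gamma> x (unit_el La Cl \<Gamma>) = x"
    unfolding x unit_Cl [OF \<Gamma>] using f by (simp_all add: tensor_Cl \<Gamma> Unit_fm)
qed

text \<open>\<open>Tensors\<close> nests to the right and adds no trailing unit, so concatenation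
  matches the tensor only up to derivability: unit laws cover empty lists, associativity the rest.
  The equality axiom for products of contexts depends on it.\<close>

lemma Tensors_append_Cl:
  assumes \<Gamma>: "is_ctx Sg \<Gamma>"
  shows "(\<And>\<phi>. \<phi> \<in> set (\<phi>s @ \<psi>s) \<Longrightarrow> fm \<Gamma> \<phi>) \<Longrightarrow>
    fc \<Gamma> (Tensors La (\<phi>s @ \<psi>s)) = tensor_op La Cl \<Gamma> (fc \<Gamma> (Tensors La \<phi>s)) (fc \<Gamma> (Tensors La \<psi>s))"
proof (induction \<phi>s rule: induct_list012)
  case 1
  then have f: "fm \<Gamma> (Tensors La \<psi>s)" by (intro Tensors_fm) auto
  have "Tensors La [] = Unit La" by (simp add: Tensors_def)
  then show ?case
    using fc_eq_iff [OF \<Gamma> Tensor_fm [OF Unit_fm f] f] eqv_unit(1) [OF \<Gamma> f]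
    by (simp add: tensor_Cl \<Gamma> Unit_fm f)
next
  case (2 \<phi>)
  then have f: "fm \<Gamma> \<phi>" "fm \<Gamma> (Tensors La \<psi>s)" by (auto intro: Tensors_fm)
  show ?case
  proof (cases \<psi>s)
    case Nil
    then show ?thesis
      using fc_eq_iff [OF \<Gamma> Tensor_fm [OF f(1) Unit_fm] f(1)] eqv_unit(2) [OF \<Gamma> f(1)]
      by (simp add: tensor_Cl \<Gamma> Unit_fm f Tensors_def)
  next
    case (Cons \<psi> \<psi>s')
    then have "Tensors La ([\<phi>] @ \<psi>s) = Tensor La \<phi> (Tensors La \<psi>s)" "Tensors La [\<phi>] = \<phi>"
      by (simp_all add: Tensors_def)
    then show ?thesis using f by (simp add: tensor_Cl \<Gamma>)
  qed
next
  case (3 \<phi> \<phi>' \<phi>s)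
  let ?a = "Tensors La (\<phi>' # \<phi>s)" and ?b = "Tensors La \<psi>s" and ?c = "Tensors La ((\<phi>' # \<phi>s) @ \<psi>s)"
  have f: "fm \<Gamma> \<phi>" "fm \<Gamma> ?a" "fm \<Gamma> ?b" "fm \<Gamma> ?c" using 3(3) Tensors_fm [of "\<phi>' # \<phi>s" \<Gamma>]
      Tensors_fm [of \<psi>s \<Gamma>] Tensors_fm [of "(\<phi>' # \<phi>s) @ \<psi>s" \<Gamma>] by auto
  have "Tensors La ((\<phi> # \<phi>' # \<phi>s) @ \<psi>s) = Tensor La \<phi> ?c"
    and e: "Tensors La (\<phi> # \<phi>' # \<phi>s) = Tensor La \<phi> ?a" by (simp_all add: Tensors_def)
  then have "fc \<Gamma> (Tensors La ((\<phi> # \<phi>' # \<phi>s) @ \<psi>s)) = tensor_op La Cl \<Gamma> (fc \<Gamma> \<phi>) (fc \<Gamma> ?c)"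
    using f by (simp add: tensor_Cl \<Gamma>)
  also have "fc \<Gamma> ?c = tensor_op La Cl \<Gamma> (fc \<Gamma> ?a) (fc \<Gamma> ?b)"
    using 3 by simp
  also have "tensor_op La Cl \<Gamma> (fc \<Gamma> \<phi>) \<dots> = fc \<Gamma> (Tensor La \<phi> (Tensor La ?a ?b))"
    using f by (simp add: tensor_Cl \<Gamma> Tensor_fm)
  also have "\<dots> = fc \<Gamma> (Tensor La (Tensor La \<phi> ?a) ?b)"
    using fc_eq_iff [OF \<Gamma>] eqv_sym [OF eqv_tensor_assoc [OF \<Gamma> f(1-3)]] f Tensor_fm by auto
  also have "\<dots> = tensor_op La Cl \<Gamma> (fc \<Gamma> (Tensors La (\<phi> # \<phi>' # \<phi>s))) (fc \<Gamma> ?b)"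
    unfolding e using f by (simp add: tensor_Cl \<Gamma> Tensor_fm)
  finally show ?case .
qed

text \<open>Two free offsets are allowed because reindexing the equality predicate along two blocks
  of variables gives a list of the same form, with the starting levels of the blocks as
  offsets.\<close>

definition "equalities \<Gamma> m n = map (\<lambda>i. Equ (\<Gamma> ! i) (Var (m + i)) (Var (n + i))) [0..<length \<Gamma>]"

lemma eq_Cl: "eq_el Cl \<Gamma> = fc (\<Gamma> @ \<Gamma>) (Tensors La (equalities \<Gamma> 0 (length \<Gamma>)))"
  by (simp add: classifying_def equalities_def)

lemma equalities_fm:
  assumes "is_ctx Sg \<Gamma>" "tms \<Delta> (vars m (length \<Gamma>)) \<Gamma>" "tms \<Delta> (vars n (length \<Gamma>)) \<Gamma>"
  shows "\<phi> \<in> set (equalities \<Gamma> m n) \<Longrightarrow> fm \<Delta> \<phi>"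
proof -
  assume "\<phi> \<in> set (equalities \<Gamma> m n)"
  then obtain i where i: "i < length \<Gamma>" and \<phi>: "\<phi> = Equ (\<Gamma> ! i) (Var (m + i)) (Var (n + i))"
    by (auto simp: equalities_def)
  have "is_tm Sg \<Delta> (vars m (length \<Gamma>) ! i) (\<Gamma> ! i)" "is_tm Sg \<Delta> (vars n (length \<Gamma>) ! i) (\<Gamma> ! i)"
    using assms i by (simp_all only: list_all2_conv_all_nth)
  moreover have "\<Gamma> ! i \<in> sorts Sg" using assms(1) i nth_mem unfolding is_ctx_def by blast
  ultimately show "fm \<Delta> \<phi>" unfolding \<phi> using i by (intro is_fm.equ) simp_all
qed

lemma equalities_append:
  "equalities (\<Gamma> @ \<Delta>) m n = equalities \<Gamma> m n @ equalities \<Delta> (m + length \<Gamma>) (n + length \<Gamma>)"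
  unfolding equalities_def
  by (rule nth_equalityI) (auto simp: nth_append)

lemma subst_equalities:
  "map (\<lambda>\<phi>. fm_subst \<phi> k (vars m (length \<Gamma>) @ vars n (length \<Gamma>))) (equalities \<Gamma> 0 (length \<Gamma>)) =
    equalities \<Gamma> m n"
  by (auto simp: equalities_def nth_append)

lemma reidx_eq_Cl:
  assumes "is_ctx Sg \<Gamma>" "is_ctx Sg \<Delta>" "tms \<Delta> (vars m (length \<Gamma>)) \<Gamma>" "tms \<Delta> (vars n (length \<Gamma>)) \<Gamma>"
  shows "reidx Cl (tc \<Delta> (\<Gamma> @ \<Gamma>) (vars m (length \<Gamma>) @ vars n (length \<Gamma>))) (eq_el Cl \<Gamma>) =
    fc \<Delta> (Tensors La (equalities \<Gamma> m n))"
proof -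
  have "fm (\<Gamma> @ \<Gamma>) (Tensors La (equalities \<Gamma> 0 (length \<Gamma>)))"
    using equalities_fm [OF assms(1) pr1_typed pr2_typed] by (intro Tensors_fm)
  then show ?thesis
    using reidx_Cl [OF assms(2) _ pair_typed [OF assms(3,4)]] assms(1)
    by (simp add: eq_Cl fm_subst_Tensors subst_equalities)
qed

sublocale Cl: FA Cl La
proof (rule FA.intro [OF Cl.prop_category_axioms], rule FA_axioms.intro)
  fix \<Gamma> \<Delta> \<Theta> f k xs \<omega> x
  show "conn_op Cl \<Gamma> k xs \<in> El Cl \<Gamma>"
    if \<Gamma>: "\<Gamma> \<in> Ob Cl" and k: "k \<in> conns La (length xs)" "set xs \<subseteq> El Cl \<Gamma>"
  proof -
    obtain \<phi>s where \<phi>s: "\<And>\<phi>. \<phi> \<in> set \<phi>s \<Longrightarrow> fm \<Gamma> \<phi>" "xs = map (fc \<Gamma>) \<phi>s"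
      using El_Cl_lists [OF k(2)] by metis
    then show ?thesis
      using conn_Cl [of \<Gamma> k \<phi>s] \<Gamma> k by (auto simp: Cl_sel(1) intro!: El_Cl_I is_fm.conn)
  qed
  show "reidx Cl f (conn_op Cl \<Delta> k xs) = conn_op Cl \<Gamma> k (map (reidx Cl f) xs)"
    if f: "f \<in> hom_set Cl \<Gamma> \<Delta>" and k: "k \<in> conns La (length xs)" "set xs \<subseteq> El Cl \<Delta>"
  proof -
    from f obtain Ms where Ms: "is_ctx Sg \<Gamma>" "is_ctx Sg \<Delta>" "tms \<Gamma> Ms \<Delta>" "f = tc \<Gamma> \<Delta> Ms"
      by (rule hom_ClE)
    obtain \<phi>s where \<phi>s: "\<And>\<phi>. \<phi> \<in> set \<phi>s \<Longrightarrow> fm \<Delta> \<phi>" "xs = map (fc \<Delta>) \<phi>s"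
      using El_Cl_lists [OF k(2)] by metis
    let ?\<psi>s = "map (\<lambda>\<phi>. fm_subst \<phi> (length \<Gamma>) Ms) \<phi>s"
    have k': "k \<in> conns La (length \<phi>s)" "k \<in> conns La (length ?\<psi>s)" using k \<phi>s by auto
    have m: "map (reidx Cl f) xs = map (fc \<Gamma>) ?\<psi>s"
      using \<phi>s Ms by (auto simp: reidx_Cl)
    have \<psi>s: "fm \<Gamma> \<psi>" if "\<psi> \<in> set ?\<psi>s" for \<psi>
      using that \<phi>s is_fm_subst [OF _ Ms(3)] by auto
    have "fm \<Delta> (Conn k \<phi>s)" using k' \<phi>s by (intro is_fm.conn)
    then have "reidx Cl f (conn_op Cl \<Delta> k xs) = fc \<Gamma> (Conn k ?\<psi>s)"
      using conn_Cl [OF Ms(2) k'(1) \<phi>s(1)] reidx_Cl [OF Ms(1-3)] \<phi>s(2) Ms(4) by simp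
    then show ?thesis
      unfolding m using conn_Cl [OF Ms(1) k'(2) \<psi>s] by simp
  qed
  show "monoid \<lparr>carrier = El Cl \<Gamma>, mult = tensor_op La Cl \<Gamma>, one = unit_el La Cl \<Gamma>\<rparr>" if "\<Gamma> \<in> Ob Cl"
    using that monoid_Cl by (simp add: Cl_sel(1))
  show "quant_op Cl \<omega> \<Gamma> \<Delta> x \<in> El Cl \<Gamma>"
    if "\<omega> \<in> quants La" "\<Gamma> \<in> Ob Cl" "\<Delta> \<in> Ob Cl" "x \<in> El Cl (prd Cl \<Gamma> \<Delta>)"
    using that by (auto simp: Cl_sel(1,4) quant_Cl elim!: El_ClE intro!: El_Cl_I is_fm_foldr_Quant)
  show "reidx Cl f (quant_op Cl \<omega> \<Delta> \<Theta> x) = quant_op Cl \<omega> \<Gamma> \<Theta> (reidx Cl (prd_id Cl f \<Theta>) x)"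
    if \<omega>: "\<omega> \<in> quants La" and f: "f \<in> hom_set Cl \<Gamma> \<Delta>" and \<Theta>: "\<Theta> \<in> Ob Cl" and x: "x \<in> El Cl (prd Cl \<Delta> \<Theta>)"
  proof -
    from f obtain Ms where Ms: "is_ctx Sg \<Gamma>" "is_ctx Sg \<Delta>" "tms \<Gamma> Ms \<Delta>" "f = tc \<Gamma> \<Delta> Ms"
      by (rule hom_ClE)
    have \<Theta>: "is_ctx Sg \<Theta>" using \<Theta> by (simp add: Cl_sel)
    from x obtain \<phi> where \<phi>: "fm (\<Delta> @ \<Theta>) \<phi>" "x = fc (\<Delta> @ \<Theta>) \<phi>" by (auto simp: Cl_sel(4) elim: El_ClE)
    have c: "is_ctx Sg (\<Gamma> @ \<Theta>)" "is_ctx Sg (\<Delta> @ \<Theta>)" using Ms \<Theta> by auto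
    note p = prd_id_typed [OF Ms(3), of \<Theta>]
    show ?thesis
      using quant_Cl [OF \<omega> Ms(2) \<Theta> \<phi>(1)] reidx_Cl [OF Ms(1-3) is_fm_foldr_Quant [OF \<omega> \<Theta> \<phi>(1)]]
        reidx_Cl [OF c p \<phi>(1)] quant_Cl [OF \<omega> Ms(1) \<Theta> is_fm_subst [OF \<phi>(1) p]] \<phi>(2) Ms(4)
        prd_id_Cl [OF Ms(1,2) \<Theta> Ms(3)]
      by (simp add: fm_subst_foldr_Quant)
  qed
  show "quant_op Cl \<omega> \<Gamma> (top_ob Cl) (reidx Cl (pr1 Cl \<Gamma> (top_ob Cl)) x) = x"
    if \<omega>: "\<omega> \<in> quants La" and \<Gamma>: "\<Gamma> \<in> Ob Cl" and x: "x \<in> El Cl \<Gamma>"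
  proof -
    from x obtain \<phi> where \<phi>: "fm \<Gamma> \<phi>" "x = fc \<Gamma> \<phi>" by (rule El_ClE)
    then show ?thesis
      using \<Gamma> \<omega> quant_Cl [OF \<omega>, of \<Gamma> "[]" \<phi>]
      by (simp add: Cl_sel(1,3,5) reidx_Cl [OF _ _ idn_typed] fm_subst_id)
  qed
  show "quant_op Cl \<omega> \<Gamma> (prd Cl \<Delta> \<Theta>) (reidx Cl (assoc_ar Cl \<Gamma> \<Delta> \<Theta>) x) =
      quant_op Cl \<omega> \<Gamma> \<Delta> (quant_op Cl \<omega> (prd Cl \<Gamma> \<Delta>) \<Theta> x)"
    if \<omega>: "\<omega> \<in> quants La" and ob: "\<Gamma> \<in> Ob Cl" "\<Delta> \<in> Ob Cl" "\<Theta> \<in> Ob Cl" and x: "x \<in> El Cl (prd Cl (prd Cl \<Gamma> \<Delta>) \<Theta>)"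
  proof -
    have c: "is_ctx Sg \<Gamma>" "is_ctx Sg \<Delta>" "is_ctx Sg \<Theta>" using ob by (auto simp: Cl_sel)
    from x obtain \<phi> where \<phi>: "fm (\<Gamma> @ \<Delta> @ \<Theta>) \<phi>" "x = fc (\<Gamma> @ \<Delta> @ \<Theta>) \<phi>"
      by (auto simp: Cl_sel(4) elim: El_ClE)
    \<comment> \<open>With the associator equal to the identity, only an equation between nested
      blocks of quantifiers remains.\<close>
    have r: "reidx Cl (assoc_ar Cl \<Gamma> \<Delta> \<Theta>) x = x"
      unfolding assoc_ar_Cl [OF c] using x c by (intro Cl.reidx_idn) (simp_all add: Cl_sel(1,4))
    have \<phi>': "fm ((\<Gamma> @ \<Delta>) @ \<Theta>) \<phi>" using \<phi>(1) by simp
    show ?thesis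
      unfolding r
      using quant_Cl [OF \<omega> c(1), of "\<Delta> @ \<Theta>" \<phi>] quant_Cl [OF \<omega> _ c(3) \<phi>'] c \<phi>
        quant_Cl [OF \<omega> c(1,2) is_fm_foldr_Quant [OF \<omega> c(3) \<phi>']]
      by (simp add: Cl_sel(4))
  qed
  show "eq_el Cl \<Gamma> \<in> El Cl (prd Cl \<Gamma> \<Gamma>)" if "\<Gamma> \<in> Ob Cl"
    using that Tensors_fm [OF equalities_fm [OF _ pr1_typed pr2_typed]]
    by (simp add: Cl_sel(1,4) eq_Cl El_Cl_I)
  show "eq_el Cl (top_ob Cl) = unit_el La Cl (prd Cl (top_ob Cl) (top_ob Cl))"
    by (simp add: Cl_sel(3,4) eq_Cl unit_Cl equalities_def Tensors_def)
  show "eq_el Cl (prd Cl \<Gamma> \<Delta>) = tensor_op La Cl (prd Cl (prd Cl \<Gamma> \<Delta>) (prd Cl \<Gamma> \<Delta>))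
        (reidx Cl (pair Cl (cmp Cl (pr1 Cl \<Gamma> \<Delta>) p) (cmp Cl (pr1 Cl \<Gamma> \<Delta>) q)) (eq_el Cl \<Gamma>))
        (reidx Cl (pair Cl (cmp Cl (pr2 Cl \<Gamma> \<Delta>) p) (cmp Cl (pr2 Cl \<Gamma> \<Delta>) q)) (eq_el Cl \<Delta>))"
    if ob: "\<Gamma> \<in> Ob Cl" "\<Delta> \<in> Ob Cl"
      and pq: "p = pr1 Cl (prd Cl \<Gamma> \<Delta>) (prd Cl \<Gamma> \<Delta>)" "q = pr2 Cl (prd Cl \<Gamma> \<Delta>) (prd Cl \<Gamma> \<Delta>)" for p q
  proof -
    let ?\<Theta> = "(\<Gamma> @ \<Delta>) @ (\<Gamma> @ \<Delta>)" and ?n = "length \<Gamma>" and ?m = "length \<Delta>"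
    have c: "is_ctx Sg \<Gamma>" "is_ctx Sg \<Delta>" "is_ctx Sg (\<Gamma> @ \<Delta>)" "is_ctx Sg ?\<Theta>" using ob by (auto simp: Cl_sel)
    have t: "tms ?\<Theta> (vars 0 ?n) \<Gamma>" "tms ?\<Theta> (vars ?n ?m) \<Delta>" "tms ?\<Theta> (vars (?n + ?m) ?n) \<Gamma>"
      "tms ?\<Theta> (vars (?n + ?m + ?n) ?m) \<Delta>" "tms ?\<Theta> (vars 0 (?n + ?m)) (\<Gamma> @ \<Delta>)"
      "tms ?\<Theta> (vars (?n + ?m) (?n + ?m)) (\<Gamma> @ \<Delta>)"
      using vars_0_typed [of Sg \<Gamma> "\<Delta> @ \<Gamma> @ \<Delta>"] vars_typed [of Sg \<Gamma> \<Delta> "\<Gamma> @ \<Delta>"]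
        vars_typed [of Sg "\<Gamma> @ \<Delta>" \<Gamma> \<Delta>] vars_typed [of Sg "\<Gamma> @ \<Delta> @ \<Gamma>" \<Delta> "[]"]
        vars_0_typed [of Sg "\<Gamma> @ \<Delta>" "\<Gamma> @ \<Delta>"] vars_typed [of Sg "\<Gamma> @ \<Delta>" "\<Gamma> @ \<Delta>" "[]"]
      by (simp_all add: add.assoc)
    have p: "p = tc ?\<Theta> (\<Gamma> @ \<Delta>) (vars 0 (?n + ?m))" and q: "q = tc ?\<Theta> (\<Gamma> @ \<Delta>) (vars (?n + ?m) (?n + ?m))"
      using pq by (simp_all add: Cl_sel)
    have "cmp Cl (pr1 Cl \<Gamma> \<Delta>) p = tc ?\<Theta> \<Gamma> (vars 0 ?n)" "cmp Cl (pr2 Cl \<Gamma> \<Delta>) p = tc ?\<Theta> \<Delta> (vars ?n ?m)"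
      "cmp Cl (pr1 Cl \<Gamma> \<Delta>) q = tc ?\<Theta> \<Gamma> (vars (?n + ?m) ?n)"
      "cmp Cl (pr2 Cl \<Gamma> \<Delta>) q = tc ?\<Theta> \<Delta> (vars (?n + ?m + ?n) ?m)"
      unfolding p q Cl_sel(5,6) cmp_Cl [OF c(4,3) t(5) pr1_typed] cmp_Cl [OF c(4,3) t(5) pr2_typed]
        cmp_Cl [OF c(4,3) t(6) pr1_typed] cmp_Cl [OF c(4,3) t(6) pr2_typed]
      by (simp_all add: map_tm_subst_vars)
    then have e: "reidx Cl (pair Cl (cmp Cl (pr1 Cl \<Gamma> \<Delta>) p) (cmp Cl (pr1 Cl \<Gamma> \<Delta>) q)) (eq_el Cl \<Gamma>) =
        fc ?\<Theta> (Tensors La (equalities \<Gamma> 0 (?n + ?m)))"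
      "reidx Cl (pair Cl (cmp Cl (pr2 Cl \<Gamma> \<Delta>) p) (cmp Cl (pr2 Cl \<Gamma> \<Delta>) q)) (eq_el Cl \<Delta>) =
        fc ?\<Theta> (Tensors La (equalities \<Delta> ?n (?n + ?m + ?n)))"
      using pair_Cl [OF c(4,1,1) t(1,3)] pair_Cl [OF c(4,2,2) t(2,4)] reidx_eq_Cl [OF c(1,4) t(1,3)]
        reidx_eq_Cl [OF c(2,4) t(2,4)] by simp_all
    \<comment> \<open>In the doubled context the copies of \<open>\<Gamma>\<close> start at levels
      \<open>0\<close> and \<open>?n + ?m\<close>, those of \<open>\<Delta>\<close> at
      \<open>?n\<close> and \<open>?n + ?m + ?n\<close>.\<close>
    have a: "equalities (\<Gamma> @ \<Delta>) 0 (?n + ?m) = equalities \<Gamma> 0 (?n + ?m) @ equalities \<Delta> ?n (?n + ?m + ?n)"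
      by (simp add: equalities_append)
    have f: "fm ?\<Theta> \<phi>" if "\<phi> \<in> set (equalities \<Gamma> 0 (?n + ?m) @ equalities \<Delta> ?n (?n + ?m + ?n))" for \<phi>
      using that equalities_fm [OF c(1) t(1,3)] equalities_fm [OF c(2) t(2,4)] by auto
    have "eq_el Cl (\<Gamma> @ \<Delta>) = fc ?\<Theta> (Tensors La (equalities \<Gamma> 0 (?n + ?m) @ equalities \<Delta> ?n (?n + ?m + ?n)))"
      unfolding eq_Cl length_append a ..
    also have "\<dots> = tensor_op La Cl ?\<Theta> (fc ?\<Theta> (Tensors La (equalities \<Gamma> 0 (?n + ?m))))
        (fc ?\<Theta> (Tensors La (equalities \<Delta> ?n (?n + ?m + ?n))))"
      by (rule Tensors_append_Cl [OF c(4) f])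
    finally show ?thesis
      unfolding e Cl_sel(4) .
  qed
qed

end


section \<open>Smallness of the syntax\<close>

text \<open>A bijection from \<open>A \<times> A\<close> to \<open>A\<close> folds a list into one
  element. The code of the empty list may also be the code of a pair, so injectivity is shown among
  lists of equal length, and pairing with a code of the length repairs the rest.\<close>

lemma infinite_lists_lepoll:
  assumes "infinite A"
  shows "lists A \<lesssim> A"
proof -
  obtain p where p: "bij_betw p (A \<times> A) A"
    using card_of_Times_same_infinite [OF assms] card_of_ordIso by blast
  obtain \<nu> :: "nat \<Rightarrow> 'a" where \<nu>: "inj \<nu>" "range \<nu> \<subseteq> A"
    using assms unfolding infinite_iff_countable_subset by blast
  define c where "c = rec_list (\<nu> 0) (\<lambda>x _ r. p (x, r))"
  have c: "c [] = \<nu> 0" "\<And>x xs. c (x # xs) = p (x, c xs)" by (simp_all add: c_def)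
  have pA: "p (x, y) \<in> A" if "x \<in> A" "y \<in> A" for x y
    using p that by (auto simp: bij_betw_def)
  have pD: "x = x' \<and> y = y'" if "p (x, y) = p (x', y')" "x \<in> A" "y \<in> A" "x' \<in> A" "y' \<in> A" for x y x' y'
    using p that by (auto simp: bij_betw_def inj_on_def)
  have cA: "c xs \<in> A" if "xs \<in> lists A" for xs
    using that \<nu>(2) pA by (induction xs) (auto simp: c)
  have inj: "xs = ys" if "length xs = length ys" "xs \<in> lists A" "ys \<in> lists A" "c xs = c ys" for xs ys
    using that
  proof (induction xs ys rule: list_induct2)
    case (Cons x xs y ys)
    then show ?case using pD [of x "c xs" y "c ys"] cA by (auto simp: c)
  qed simp
  have "inj_on (\<lambda>xs. p (\<nu> (length xs), c xs)) (lists A)"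
  proof (rule inj_onI)
    fix xs ys assume l: "xs \<in> lists A" "ys \<in> lists A"
      and e: "p (\<nu> (length xs), c xs) = p (\<nu> (length ys), c ys)"
    have "\<nu> (length xs) = \<nu> (length ys) \<and> c xs = c ys"
      using pD [OF e] cA l \<nu>(2) by blast
    then show "xs = ys" using inj l \<nu>(1) by (auto dest: injD)
  qed
  moreover have "(\<lambda>xs. p (\<nu> (length xs), c xs)) ` lists A \<subseteq> A"
    using pA cA \<nu>(2) by blast
  ultimately show ?thesis unfolding lepoll_def by blast
qed

text \<open>The code of a list of subexpressions is preceded by its length, so that no code is a proper
  prefix of another.\<close>

primrec tm_code :: "(nat \<Rightarrow> 'u) \<Rightarrow> 'u tm \<Rightarrow> 'u list" where
  "tm_code \<nu> (Var i) = [\<nu> 0, \<nu> i]"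
| "tm_code \<nu> (Fun f Ms) = \<nu> 1 # f # \<nu> (length Ms) # concat (map (tm_code \<nu>) Ms)"

primrec fm_code :: "(nat \<Rightarrow> 'u) \<Rightarrow> 'u fm \<Rightarrow> 'u list" where
  "fm_code \<nu> (Rel r Ms) = \<nu> 0 # r # \<nu> (length Ms) # concat (map (tm_code \<nu>) Ms)"
| "fm_code \<nu> (Equ \<sigma> M N) = \<nu> 1 # \<sigma> # tm_code \<nu> M @ tm_code \<nu> N"
| "fm_code \<nu> (Conn k \<phi>s) = \<nu> 2 # k # \<nu> (length \<phi>s) # concat (map (fm_code \<nu>) \<phi>s)"
| "fm_code \<nu> (Quant \<omega> \<sigma> \<phi>) = \<nu> 3 # \<omega> # \<sigma> # fm_code \<nu> \<phi>"

primrec assertion_code :: "(nat \<Rightarrow> 'u) \<Rightarrow> 'u assertion \<Rightarrow> 'u list" where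
  "assertion_code \<nu> (Eqn \<Gamma> \<tau> M N) = \<nu> 0 # \<nu> (length \<Gamma>) # \<Gamma> @ \<tau> # tm_code \<nu> M @ tm_code \<nu> N"
| "assertion_code \<nu> (Seq \<Gamma> \<Phi> \<phi>) =
     \<nu> 1 # \<nu> (length \<Gamma>) # \<Gamma> @ \<nu> (length \<Phi>) # concat (map (fm_code \<nu>) \<Phi>) @ fm_code \<nu> \<phi>"

text \<open>The premise concerns only the members of \<open>xs\<close>, so that induction hypotheses
  for the subexpressions of a term or formula can discharge it.\<close>

lemma concat_map_prefix_inj:
  assumes "\<And>x y us vs. x \<in> set xs \<Longrightarrow> f x @ us = f y @ vs \<Longrightarrow> x = y \<and> us = vs"
    and "length xs = length ys" "concat (map f xs) @ us = concat (map f ys) @ vs"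
  shows "xs = ys \<and> us = vs"
  using assms(2,1,3)
proof (induction xs ys rule: list_induct2)
  case (Cons x xs y ys)
  have "x = y \<and> concat (map f xs) @ us = concat (map f ys) @ vs"
    using Cons.prems(1) [of x "concat (map f xs) @ us" y "concat (map f ys) @ vs"] Cons.prems(2) by simp
  then show ?case using Cons.IH Cons.prems(1) by auto
qed simp

context
  fixes \<nu> :: "nat \<Rightarrow> 'u"
  assumes \<nu>: "inj \<nu>"
begin

lemma \<nu>_eq [simp]: "\<nu> i = \<nu> k \<longleftrightarrow> i = k"
  using \<nu> by (simp add: inj_eq)

text \<open>Codes of subterms are concatenated without separators, so plain injectivity would not
  pass through the induction; unique parsing with an arbitrary remainder does.\<close>

lemma tm_code_prefix_inj: "tm_code \<nu> M @ us = tm_code \<nu> N @ vs \<Longrightarrow> M = N \<and> us = vs"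
proof (induction M arbitrary: N us vs)
  case (Var i)
  then show ?case by (cases N) auto
next
  case (Fun f Ms)
  show ?case
  proof (cases N)
    case (Fun g Ns)
    then have "f = g" "length Ms = length Ns"
      and "concat (map (tm_code \<nu>) Ms) @ us = concat (map (tm_code \<nu>) Ns) @ vs"
      using Fun.prems by auto
    then show ?thesis using Fun concat_map_prefix_inj [OF Fun.IH] by blast
  qed (use Fun.prems in simp)
qed

lemma fm_code_prefix_inj: "fm_code \<nu> \<phi> @ us = fm_code \<nu> \<psi> @ vs \<Longrightarrow> \<phi> = \<psi> \<and> us = vs"
proof (induction \<phi> arbitrary: \<psi> us vs)
  case (Rel r Ms)
  show ?case
  proof (cases \<psi>)
    case (Rel r' Ns)
    then have "r = r'" "length Ms = length Ns"
      and "concat (map (tm_code \<nu>) Ms) @ us = concat (map (tm_code \<nu>) Ns) @ vs"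
      using Rel.prems by auto
    then show ?thesis using Rel concat_map_prefix_inj [OF tm_code_prefix_inj] by blast
  qed (use Rel.prems in simp_all)
next
  case (Equ \<sigma> M N)
  show ?case
  proof (cases \<psi>)
    case (Equ \<sigma>' M' N')
    then have e: "\<sigma> = \<sigma>'" "tm_code \<nu> M @ tm_code \<nu> N @ us = tm_code \<nu> M' @ tm_code \<nu> N' @ vs"
      using Equ.prems by auto
    show ?thesis using e(1) Equ tm_code_prefix_inj [OF e(2)] tm_code_prefix_inj by blast
  qed (use Equ.prems in simp_all)
next
  case (Conn k \<phi>s)
  show ?case
  proof (cases \<psi>)
    case (Conn k' \<psi>s)
    then have "k = k'" "length \<phi>s = length \<psi>s"
      and "concat (map (fm_code \<nu>) \<phi>s) @ us = concat (map (fm_code \<nu>) \<psi>s) @ vs"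
      using Conn.prems by auto
    then show ?thesis using Conn concat_map_prefix_inj [OF Conn.IH] by blast
  qed (use Conn.prems in simp_all)
next
  case (Quant \<omega> \<sigma> \<phi>)
  show ?case
  proof (cases \<psi>)
    case (Quant \<omega>' \<sigma>' \<psi>')
    then show ?thesis using Quant.prems Quant.IH by auto
  qed (use Quant.prems in simp_all)
qed

lemma inj_assertion_code: "inj (assertion_code \<nu>)"
proof (rule injI)
  fix a b assume e: "assertion_code \<nu> a = assertion_code \<nu> b"
  show "a = b"
  proof (cases a)
    case a: (Eqn \<Gamma> \<tau> M N)
    show ?thesis
    proof (cases b)
      case b: (Eqn \<Gamma>' \<tau>' M' N')
      have \<Gamma>: "\<Gamma> = \<Gamma>' \<and> \<tau> = \<tau>'" and t: "tm_code \<nu> M @ tm_code \<nu> N = tm_code \<nu> M' @ tm_code \<nu> N'"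
        using e a b by auto
      \<comment> \<open>The last component has no remainder; appending \<open>[]\<close> brings it
        into the form of the parsing lemma.\<close>
      from tm_code_prefix_inj [OF t] have "M = M'" "tm_code \<nu> N @ [] = tm_code \<nu> N' @ []" by auto
      with tm_code_prefix_inj \<Gamma> a b show ?thesis by blast
    qed (use a e in simp)
  next
    case a: (Seq \<Gamma> \<Phi> \<phi>)
    show ?thesis
    proof (cases b)
      case b: (Seq \<Gamma>' \<Phi>' \<phi>')
      have \<Gamma>: "\<Gamma> = \<Gamma>'" and l: "length \<Phi> = length \<Phi>'"
        and t: "concat (map (fm_code \<nu>) \<Phi>) @ fm_code \<nu> \<phi> = concat (map (fm_code \<nu>) \<Phi>') @ fm_code \<nu> \<phi>'"
        using e a b by auto
      from concat_map_prefix_inj [OF fm_code_prefix_inj l t]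
      have "\<Phi> = \<Phi>'" "fm_code \<nu> \<phi> @ [] = fm_code \<nu> \<phi>' @ []" by auto
      with fm_code_prefix_inj \<Gamma> a b show ?thesis by blast
    qed (use a e in simp)
  qed
qed

end

section \<open>Well-formed syntax is coded over a small set of symbols\<close>

lemma tm_code_lists:
  assumes "range \<nu> \<subseteq> A" "dom (funs Sg) \<subseteq> A"
  shows "is_tm Sg \<Gamma> M \<tau> \<Longrightarrow> set (tm_code \<nu> M) \<subseteq> A"
proof (induction rule: is_tm.induct)
  case ("fun" f \<sigma>s \<tau> Ms)
  have "set (tm_code \<nu> M) \<subseteq> A" if "M \<in> set Ms" for M
    using "fun"(2) that by (auto simp: list_all2_conv_all_nth in_set_conv_nth)
  moreover have "f \<in> A" using "fun"(1) assms(2) by auto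
  ultimately show ?case using assms(1) by auto
qed (use assms in auto)

lemma fm_code_lists:
  assumes "range \<nu> \<subseteq> A" "dom (funs Sg) \<subseteq> A" "dom (rels Sg) \<subseteq> A" "sorts Sg \<subseteq> A"
    "quants La \<subseteq> A" "(\<Union>n. conns La n) \<subseteq> A"
  shows "is_fm La Sg \<Gamma> \<phi> \<Longrightarrow> set (fm_code \<nu> \<phi>) \<subseteq> A"
proof (induction rule: is_fm.induct)
  case (rel r \<sigma>s \<Gamma> Ms)
  have "set (tm_code \<nu> M) \<subseteq> A" if M: "M \<in> set Ms" for M
    using list_all2_is_tmD [OF rel(2) M] tm_code_lists [OF assms(1,2)] by blast
  moreover have "r \<in> A" using rel(1) assms(3) by auto
  ultimately show ?case using assms(1) by auto
next
  case (equ \<sigma> \<Gamma> M N)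
  then show ?case
    using assms(1,4) tm_code_lists [OF assms(1,2) equ(2)] tm_code_lists [OF assms(1,2) equ(3)] by auto
next
  case (conn k \<phi>s \<Gamma>)
  then have "k \<in> A" using assms(6) by blast
  then show ?case using conn assms(1) by auto
next
  case (quant \<omega> \<sigma> \<Gamma> \<phi>)
  then show ?case using assms(1,4,5) by auto
qed

text \<open>\<open>is_assertion\<close> does not ask for the sort of an equation to belong to the
  signature; well-typed terms force it. Both the coding of equations and the typing of their arrows
  rely on this.\<close>

lemma is_tm_sort: "is_signature Sg \<Longrightarrow> is_ctx Sg \<Gamma> \<Longrightarrow> is_tm Sg \<Gamma> M \<tau> \<Longrightarrow> \<tau> \<in> sorts Sg"
  by (erule is_tm.cases) (auto simp: is_signature_def is_ctx_def)

lemma assertion_code_lists: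
  assumes "range \<nu> \<subseteq> A" "dom (funs Sg) \<subseteq> A" "dom (rels Sg) \<subseteq> A" "sorts Sg \<subseteq> A"
    "quants La \<subseteq> A" "(\<Union>n. conns La n) \<subseteq> A" and Sg: "is_signature Sg"
    and a: "is_assertion La Sg a"
  shows "set (assertion_code \<nu> a) \<subseteq> A"
proof (cases a)
  case (Eqn \<Gamma> \<tau> M N)
  then have w: "is_ctx Sg \<Gamma>" "is_tm Sg \<Gamma> M \<tau>" "is_tm Sg \<Gamma> N \<tau>" using a by auto
  then have "\<tau> \<in> A" "set \<Gamma> \<subseteq> A" using is_tm_sort [OF Sg w(1,2)] assms(4) by (auto simp: is_ctx_def)
  then show ?thesis
    using Eqn assms(1) tm_code_lists [OF assms(1,2) w(2)] tm_code_lists [OF assms(1,2) w(3)] by auto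
next
  case (Seq \<Gamma> \<Phi> \<phi>)
  then have w: "is_ctx Sg \<Gamma>" "is_fm La Sg \<Gamma> \<phi>" "\<And>\<psi>. \<psi> \<in> set \<Phi> \<Longrightarrow> is_fm La Sg \<Gamma> \<psi>" using a by auto
  then have "set \<Gamma> \<subseteq> A" using assms(4) by (auto simp: is_ctx_def)
  then show ?thesis
    using Seq assms(1) fm_code_lists [OF assms(1-6) w(2)]
      UN_least [of "set \<Phi>", OF fm_code_lists [OF assms(1-6) w(3)]] by auto
qed

lemma universe_lepoll: "universe small tup \<Longrightarrow> small B \<Longrightarrow> A \<lesssim> B \<Longrightarrow> small A"
  unfolding universe_def by blast

text \<open>The symbols of signature and language lie in a small infinite set, and lists over it
  inject into it. One such injection codes the contexts, which are lists already, and, after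
  \<open>assertion_code\<close>, the assertions.\<close>

lemma small_syntax:
  fixes small :: "'u set \<Rightarrow> bool"
  assumes "universe small tup" "is_language small La" "small_signature small Sg"
  obtains ctx_code :: "'u ctx \<Rightarrow> 'u" and code :: "'u assertion \<Rightarrow> 'u"
    where "inj_on ctx_code {\<Gamma>. is_ctx Sg \<Gamma>}" "inj_on code (assertions La Sg)"
      "small (code ` assertions La Sg)"
proof -
  obtain B :: "'u set" where B: "small B" "infinite B"
    using assms(1) by (auto simp: universe_def)
  have Un: "small (X \<union> Y)" if "small X" "small Y" for X Y
    using assms(1) that by (auto simp: universe_def)
  \<comment> \<open>\<open>B\<close> makes \<open>A\<close> infinite even when there are few
    symbols; this provides the numerals \<open>\<nu>\<close> and the hypothesis of
    \<open>infinite_lists_lepoll\<close>.\<close>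
  define A where "A = B \<union> (dom (funs Sg) \<union> (dom (rels Sg) \<union> (sorts Sg \<union> (quants La \<union> (\<Union>n. conns La n)))))"
  have A: "small A" "infinite A"
    using assms B by (auto simp: A_def small_signature_def is_language_def intro!: Un)
  obtain h where h: "inj_on h (lists A)" "h ` lists A \<subseteq> A"
    using infinite_lists_lepoll [OF A(2)] by (auto simp: lepoll_def)
  obtain \<nu> :: "nat \<Rightarrow> 'u" where \<nu>: "inj \<nu>" "range \<nu> \<subseteq> A"
    using A(2) unfolding infinite_iff_countable_subset by blast
  have sub: "dom (funs Sg) \<subseteq> A" "dom (rels Sg) \<subseteq> A" "sorts Sg \<subseteq> A" "quants La \<subseteq> A" "(\<Union>n. conns La n) \<subseteq> A"
    unfolding A_def by blast+
  have Sg: "is_signature Sg" using assms(3) by (simp add: small_signature_def)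
  have l: "assertion_code \<nu> ` assertions La Sg \<subseteq> lists A"
    using assertion_code_lists [OF \<nu>(2) sub Sg] unfolding assertions_def by blast
  show thesis
  proof (rule that [of h "h \<circ> assertion_code \<nu>"])
    show "inj_on h {\<Gamma>. is_ctx Sg \<Gamma>}"
      using sub(3) by (intro inj_on_subset [OF h(1)]) (auto simp: is_ctx_def)
    show "inj_on (h \<circ> assertion_code \<nu>) (assertions La Sg)"
      using inj_assertion_code [OF \<nu>(1)] inj_on_subset [OF h(1) l]
      by (intro comp_inj_on) (auto intro: inj_on_subset)
    have "(h \<circ> assertion_code \<nu>) ` assertions La Sg \<lesssim> A"
      unfolding image_comp [symmetric]
      by (rule subset_imp_lepoll [OF subset_trans [OF image_mono [OF l] h(2)]])
    then show "small ((h \<circ> assertion_code \<nu>) ` assertions La Sg)"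
      by (rule universe_lepoll [OF assms(1) A(1)])
  qed
qed

text \<open>The universe codes families over small index sets, so a triple becomes a family over a
  set \<open>J\<close> of three elements, found inside an infinite small set. Restriction to
  \<open>J\<close> makes the family extensional, where \<open>tup J\<close> is injective.\<close>

lemma universe_triples:
  fixes small :: "'u set \<Rightarrow> bool"
  assumes "universe small tup"
  obtains tag :: "'u \<times> 'u \<times> 'u \<Rightarrow> 'u" where "inj tag"
proof -
  obtain B :: "'u set" where B: "small B" "infinite B"
    using assms by (auto simp: universe_def)
  obtain J where J: "J \<subseteq> B" "finite J" "card J = 3"
    using infinite_arbitrarily_large [OF B(2)] by blast
  then obtain a b c where abc: "J = {a, b, c}" "a \<noteq> b" "a \<noteq> c" "b \<noteq> c"
    by (auto simp: card_3_iff)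
  have "small J"
    by (rule universe_lepoll [OF assms B(1) subset_imp_lepoll [OF J(1)]])
  then have inj: "inj_on (tup J) (extensional J)"
    using assms by (simp add: universe_def)
  let ?f = "\<lambda>(x, y, z). \<lambda>i\<in>J. if i = a then x else if i = b then y else z"
  have "inj (\<lambda>p. tup J (?f p))"
  proof (rule injI)
    fix p q assume "tup J (?f p) = tup J (?f q)"
    moreover have "?f p \<in> extensional J" "?f q \<in> extensional J" by (auto split: prod.splits)
    ultimately have e: "?f p = ?f q" using inj by (simp add: inj_on_def)
    show "p = q"
      using fun_cong [OF e, of a] fun_cong [OF e, of b] fun_cong [OF e, of c] abc
      by (cases p, cases q) auto
  qed
  then show thesis by (rule that)
qed


section \<open>Kernels\<close>

text \<open>Kernels compare single terms, whereas arrows of the classifying prop-category are lists.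
  The context \<open>\<Delta> @ [\<tau>]\<close> is the product of \<open>\<Delta>\<close> and
  \<open>[\<tau>]\<close>, so \<open>map_prd_eqI\<close> peels off the last term.\<close>

lemma map_tm_classes_eqI:
  fixes F :: "('u ctx, 'u cl_ar, 'u fm set, 'o, 'a, 'p, 'u) morphism"
  assumes F: "FA_morphism La F" and s: "src F = classifying La Sg" and L: "is_language small La"
    and \<Gamma>: "is_ctx Sg \<Gamma>" and Ms: "list_all2 (is_tm Sg \<Gamma>) Ms \<Delta>" and Ns: "list_all2 (is_tm Sg \<Gamma>) Ns \<Delta>"
    and \<Delta>: "is_ctx Sg \<Delta>"
    and eq: "\<And>i. i < length \<Delta> \<Longrightarrow> ar_map F (tms_class La Sg \<Gamma> [\<Delta> ! i] [Ms ! i]) =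
      ar_map F (tms_class La Sg \<Gamma> [\<Delta> ! i] [Ns ! i])"
  shows "ar_map F (tms_class La Sg \<Gamma> \<Delta> Ms) = ar_map F (tms_class La Sg \<Gamma> \<Delta> Ns)"
  using Ms Ns \<Delta> eq
proof (induction \<Delta> arbitrary: Ms Ns rule: rev_induct)
  case (snoc \<tau> \<Delta>)
  interpret FA_morphism La F by (rule F)
  interpret S: classifying_syntax small La Sg using L by unfold_locales
  have \<Delta>: "is_ctx Sg \<Delta>" and \<tau>: "\<tau> \<in> sorts Sg" and \<tau>': "is_ctx Sg [\<tau>]"
    using snoc.prems(3) by (auto simp: is_ctx_def)
  obtain Ms' M where M: "Ms = Ms' @ [M]" "S.tms \<Gamma> Ms' \<Delta>" "is_tm Sg \<Gamma> M \<tau>"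
    using snoc.prems(1) by (rule list_all2_snoc_cases)
  obtain Ns' N where N: "Ns = Ns' @ [N]" "S.tms \<Gamma> Ns' \<Delta>" "is_tm Sg \<Gamma> N \<tau>"
    using snoc.prems(2) by (rule list_all2_snoc_cases)
  have l: "length Ms' = length \<Delta>" "length Ns' = length \<Delta>"
    using M(2) N(2) by (simp_all add: list_all2_lengthD)
  have M1: "S.tms \<Gamma> [M] [\<tau>]" and N1: "S.tms \<Gamma> [N] [\<tau>]" using M N by auto
  have ob: "\<Delta> \<in> Ob (src F)" "[\<tau>] \<in> Ob (src F)" using \<Delta> \<tau>' by (simp_all add: s S.Cl_sel)
  have h: "tms_class La Sg \<Gamma> (\<Delta> @ [\<tau>]) Ms \<in> hom_set (src F) \<Gamma> (prd (src F) \<Delta> [\<tau>])"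
    "tms_class La Sg \<Gamma> (\<Delta> @ [\<tau>]) Ns \<in> hom_set (src F) \<Gamma> (prd (src F) \<Delta> [\<tau>])"
    unfolding s S.Cl_sel(4) using snoc.prems(1-3) \<Gamma> by (simp_all add: S.tc_hom)
  have "ar_map F (tms_class La Sg \<Gamma> \<Delta> Ms') = ar_map F (tms_class La Sg \<Gamma> \<Delta> Ns')"
  proof (rule snoc.IH [OF M(2) N(2) \<Delta>])
    fix i assume "i < length \<Delta>"
    then show "ar_map F (tms_class La Sg \<Gamma> [\<Delta> ! i] [Ms' ! i]) =
        ar_map F (tms_class La Sg \<Gamma> [\<Delta> ! i] [Ns' ! i])"
      using snoc.prems(4) [of i] M(1) N(1) l by (simp add: nth_append)
  qed
  moreover have "ar_map F (tms_class La Sg \<Gamma> [\<tau>] [M]) = ar_map F (tms_class La Sg \<Gamma> [\<tau>] [N])"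
    using snoc.prems(4) [of "length \<Delta>"] M(1) N(1) l by (simp add: nth_append)
  ultimately show ?case
    using S.cmp_pr_Cl [OF \<Gamma> \<Delta> \<tau>' M(2) M1] S.cmp_pr_Cl [OF \<Gamma> \<Delta> \<tau>' N(2) N1] M(1) N(1)
    by (intro map_prd_eqI [OF h ob]) (simp_all add: s)
qed simp

section \<open>External models, their kernels and the three closure operators\<close>

locale external_models = classifying_syntax small La Sg
  for small :: "'u set \<Rightarrow> bool" and La :: "'u language" and Sg :: "'u signature" +
  fixes tup :: "'u set \<Rightarrow> ('u \<Rightarrow> 'u) \<Rightarrow> 'u" and L :: "'u logic"
  assumes universe: "universe small tup"
begin

lemma ModD:
  assumes "F \<in> Mod La L Sg"
  shows "src F = Cl" "FA_morphism La F" "in_FAL La L (tgt F)"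
  using assms by (auto simp: Mod_def)

lemma tc1_hom: "is_assertion La Sg (Eqn \<Gamma> \<tau> M N) \<Longrightarrow> \<tau> \<in> sorts Sg \<Longrightarrow>
    tc \<Gamma> [\<tau>] [M] \<in> hom_set Cl \<Gamma> [\<tau>] \<and> tc \<Gamma> [\<tau>] [N] \<in> hom_set Cl \<Gamma> [\<tau>]"
  by (auto intro!: tc_hom simp: is_ctx_def)

lemma assertion_El:
  assumes "is_assertion La Sg (Seq \<Gamma> \<Phi> \<phi>)"
  shows "\<Gamma> \<in> Ob Cl" "fc \<Gamma> (Tensors La \<Phi>) \<in> El Cl \<Gamma>" "fc \<Gamma> \<phi> \<in> El Cl \<Gamma>"
  using assms Tensors_fm by (auto simp: Cl_sel(1) intro!: El_Cl_I)

lemma in_ker_comp: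
  assumes Sg: "is_signature Sg" and a: "is_assertion La Sg a"
    and F: "FA_morphism La F" "src F = Cl" and H: "FA_morphism La H" "src H = tgt F"
    and ker: "in_ker La Sg a F"
  shows "in_ker La Sg a (comp_morphism H F)"
proof (cases a)
  case (Eqn \<Gamma> \<tau> M N)
  then have "\<tau> \<in> sorts Sg" using is_tm_sort [OF Sg] a by auto
  then have h: "tc \<Gamma> [\<tau>] [M] \<in> hom_set Cl \<Gamma> [\<tau>]" "tc \<Gamma> [\<tau>] [N] \<in> hom_set Cl \<Gamma> [\<tau>]"
    using tc1_hom a Eqn by auto
  show ?thesis
    using ker Cl.hom_Ar [OF h(1)] Cl.hom_Ar [OF h(2)] by (simp add: Eqn F(2))
next
  case (Seq \<Gamma> \<Phi> \<phi>)
  note e = assertion_El [OF a [unfolded Seq]]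
  interpret F: FA_morphism La F by (rule F)
  interpret H: FA_morphism La H by (rule H)
  show ?thesis
    using ker H.map_mono [unfolded H(2), OF F.ob_map_Ob] e F(2) by (simp add: Seq)
qed

lemma in_ker_subprop:
  assumes Sg: "is_signature Sg" and a: "is_assertion La Sg a"
    and H: "FA_morphism La H" "src H = Cl" and \<iota>: "subprop_morphism La \<iota>" "src \<iota> = tgt H"
    and ker: "in_ker La Sg a (comp_morphism \<iota> H)"
  shows "in_ker La Sg a H"
proof -
  interpret H: FA_morphism La H by (rule H)
  show ?thesis
  proof (cases a)
    case (Eqn \<Gamma> \<tau> M N)
    then have "\<tau> \<in> sorts Sg" using is_tm_sort [OF Sg] a by auto
    then have h: "tc \<Gamma> [\<tau>] [M] \<in> hom_set (src H) \<Gamma> [\<tau>]" "tc \<Gamma> [\<tau>] [N] \<in> hom_set (src H) \<Gamma> [\<tau>]"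
      using tc1_hom a Eqn H(2) by auto
    note ob = H.A.hom_Ob [OF h(1)]
    have "ar_map \<iota> (ar_map H (tc \<Gamma> [\<tau>] [M])) = ar_map \<iota> (ar_map H (tc \<Gamma> [\<tau>] [N]))"
      using ker H.A.hom_Ar [OF h(1)] H.A.hom_Ar [OF h(2)] by (simp add: Eqn)
    moreover have "inj_on (ar_map \<iota>) (hom_set (tgt H) (ob_map H \<Gamma>) (ob_map H [\<tau>]))"
      using \<iota> H.ob_map_Ob ob by (simp add: subprop_morphism_def)
    ultimately show ?thesis
      using H.map_hom [OF h(1)] H.map_hom [OF h(2)] by (simp add: Eqn inj_on_eq_iff)
  next
    case (Seq \<Gamma> \<Phi> \<phi>)
    note e = assertion_El [OF a [unfolded Seq], folded H(2)]
    show ?thesis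
      using ker \<iota> e H.ob_map_Ob [OF e(1)] H.el_map_El [OF e(1) e(2)] H.el_map_El [OF e(1) e(3)]
      by (simp add: Seq subprop_morphism_def)
  qed
qed

lemma morphism_familyI:
  assumes "small I" "\<And>i. i \<in> I \<Longrightarrow> F i \<in> Mod La L Sg"
  shows "morphism_family small tup La I Cl F"
  using assms ModD universe language Cl.FA_axioms by (simp add: morphism_family_def)

lemma tuple_Mod:
  assumes I: "small I" and F: "\<And>i. i \<in> I \<Longrightarrow> F i \<in> Mod La L Sg"
  shows "tuple_morphism tup I Cl F \<in> Mod La L Sg"
proof -
  interpret morphism_family small tup La I Cl F by (rule morphism_familyI [OF assms])
  show ?thesis
    using FA_morphism_T in_FAL_P [of L] ModD(3) [OF assms(2)] by (simp add: Mod_def T_sel(1,2))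
qed

lemma in_ker_tuple:
  assumes I: "small I" and F: "\<And>i. i \<in> I \<Longrightarrow> F i \<in> Mod La L Sg"
    and Sg: "is_signature Sg" and a: "is_assertion La Sg a"
  shows "in_ker La Sg a (tuple_morphism tup I Cl F) \<longleftrightarrow> (\<forall>i\<in>I. in_ker La Sg a (F i))"
proof -
  interpret morphism_family small tup La I Cl F by (rule morphism_familyI [OF I F])
  interpret T: FA_morphism La T by (rule FA_morphism_T)
  show ?thesis
  proof (cases a)
    case (Eqn \<Gamma> \<tau> M N)
    then have "\<tau> \<in> sorts Sg" using is_tm_sort [OF Sg] a by auto
    then have h: "tc \<Gamma> [\<tau>] [M] \<in> hom_set Cl \<Gamma> [\<tau>]" "tc \<Gamma> [\<tau>] [N] \<in> hom_set Cl \<Gamma> [\<tau>]"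
      using tc1_hom a Eqn by auto
    have "tp x = tp y \<longleftrightarrow> (\<forall>i\<in>I. x i = y i)" for x y
    proof
      assume "tp x = tp y"
      then have "pr (tp x) i = pr (tp y) i" for i by simp
      then show "\<forall>i\<in>I. x i = y i" by (metis pr_tp)
    qed (auto intro: arg_cong [of _ _ "tup I"] restrict_ext)
    then show ?thesis by (simp add: Eqn T_hom [OF h(1)] T_hom [OF h(2)])
  next
    case (Seq \<Gamma> \<Phi> \<phi>)
    note e = assertion_El [OF a [unfolded Seq]]
    have "ob_map T \<Gamma> \<in> Ob P" using T.ob_map_Ob [unfolded T_sel(1,2), OF e(1)] .
    then show ?thesis
      using e by (simp add: Seq T_sel Po_P)
  qed
qed

text \<open>The closure is inductive and contains products of products, so the claim to prove is
  that the models of any theory are themselves closed. The next two lemmas do the same for submodels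
  and images.\<close>

lemma products_Mod_of:
  assumes Sg: "is_signature Sg" and T: "T \<subseteq> assertions La Sg" and Y: "Y \<subseteq> Mod_of La L Sg T"
  shows "products small tup La Sg Y \<subseteq> Mod_of La L Sg T"
proof
  fix F assume "F \<in> products small tup La Sg Y"
  then show "F \<in> Mod_of La L Sg T"
  proof (induction rule: products.induct)
    case (base F)
    then show ?case using Y by blast
  next
    case (product I F)
    then have F: "\<And>i. i \<in> I \<Longrightarrow> F i \<in> Mod La L Sg" by (simp add: Mod_of_def)
    then show ?case
      using tuple_Mod [OF product(1) F] in_ker_tuple [OF product(1) F Sg] product(3) T
      by (auto simp: Mod_of_def assertions_def)
  qed
qed

lemma submodels_Mod_of:
  assumes Sg: "is_signature Sg" and T: "T \<subseteq> assertions La Sg" and Y: "Y \<subseteq> Mod_of La L Sg T"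
  shows "submodels La L Sg Y \<subseteq> Mod_of La L Sg T"
proof
  fix F assume "F \<in> submodels La L Sg Y"
  then show "F \<in> Mod_of La L Sg T"
  proof (induction rule: submodels.induct)
    case (base F)
    then show ?case using Y by blast
  next
    case (submodel \<iota> H)
    then show ?case
      using in_ker_subprop [OF Sg _ ModD(2,1)] T by (auto simp: Mod_of_def assertions_def)
  qed
qed

lemma images_Mod_of:
  assumes Sg: "is_signature Sg" and T: "T \<subseteq> assertions La Sg" and Y: "Y \<subseteq> Mod_of La L Sg T"
  shows "images La L Y \<subseteq> Mod_of La L Sg T"
proof
  fix F assume "F \<in> images La L Y"
  then show "F \<in> Mod_of La L Sg T"
  proof (induction rule: images.induct)
    case (base F)
    then show ?case using Y by blast
  next
    case (image F H)
    have F: "F \<in> Mod La L Sg" using image(5) by (simp add: Mod_of_def)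
    have "comp_morphism H F \<in> Mod La L Sg"
      using ModD [OF F] FA_morphism_comp [OF ModD(2) [OF F] image(2,3)] image(4) by (simp add: Mod_def)
    then show ?case
      using in_ker_comp [OF Sg _ ModD(2,1) [OF F] image(2,3)] image(5) T
      by (auto simp: Mod_of_def assertions_def)
  qed
qed

text \<open>The submodel of \<open>T\<close> is its image factorization, through which \<open>F\<close> factors because the
  kernel of \<open>T\<close> is contained in that of \<open>F\<close>.\<close>

lemma image_of_submodel:
  fixes ctx_code :: "'u ctx \<Rightarrow> 'u" and tag :: "'u \<times> 'u \<times> 'u \<Rightarrow> 'u"
  assumes T: "T \<in> Mod La L Sg" and F: "F \<in> Mod La L Sg"
    and ctx_code: "inj_on ctx_code {\<Gamma>. is_ctx Sg \<Gamma>}" and tag: "inj tag"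
    and ker: "\<And>a. is_assertion La Sg a \<Longrightarrow> in_ker La Sg a T \<Longrightarrow> in_ker La Sg a F"
  shows "F \<in> images La L (submodels La L Sg {T})"
proof -
  interpret T: FA_morphism La T by (rule ModD(2) [OF T])
  interpret F: FA_morphism La F by (rule ModD(2) [OF F])
  note sT = ModD(1) [OF T] and sF = ModD(1) [OF F]
  have ker_ar: "ar_map F f = ar_map F g"
    if f: "f \<in> hom_set (src T) \<Gamma> \<Delta>" and g: "g \<in> hom_set (src T) \<Gamma> \<Delta>" and e: "ar_map T f = ar_map T g"
    for \<Gamma> \<Delta> f g
  proof -
    obtain Ms where Ms: "is_ctx Sg \<Gamma>" "is_ctx Sg \<Delta>" "tms \<Gamma> Ms \<Delta>" "f = tc \<Gamma> \<Delta> Ms"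
      using f unfolding sT by (rule hom_ClE)
    obtain Ns where Ns: "tms \<Gamma> Ns \<Delta>" "g = tc \<Gamma> \<Delta> Ns"
      using g unfolding sT by (rule hom_ClE)
    show ?thesis
      unfolding Ms(4) Ns(2)
    proof (rule map_tm_classes_eqI [OF ModD(2) [OF F] sF language Ms(1,3) Ns(1) Ms(2)])
      fix i assume i: "i < length \<Delta>"
      \<comment> \<open>The \<open>i\<close>-th projection of the context, given by one variable.
        Composing with it turns the equality of \<open>f\<close> and \<open>g\<close> under
        \<open>T\<close> into an equation between single terms, which is an assertion.\<close>
      let ?p = "tc \<Delta> [\<Delta> ! i] [Var i]"
      have p: "tms \<Delta> [Var i] [\<Delta> ! i]" and \<tau>: "is_ctx Sg [\<Delta> ! i]"
        using i Ms(2) by (auto simp: is_ctx_def)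
      note h = tc_hom [OF Ms(2) \<tau> p]
      have "cmp Cl ?p f = tc \<Gamma> [\<Delta> ! i] [Ms ! i]" "cmp Cl ?p g = tc \<Gamma> [\<Delta> ! i] [Ns ! i]"
        unfolding Ms(4) Ns(2) using cmp_Cl [OF Ms(1-3) p] cmp_Cl [OF Ms(1,2) Ns(1) p] by simp_all
      moreover have "ar_map T (cmp Cl ?p f) = ar_map T (cmp Cl ?p g)"
        using T.map_cmp [unfolded sT, OF _ h] f g e by (simp add: sT)
      ultimately have "in_ker La Sg (Eqn \<Gamma> (\<Delta> ! i) (Ms ! i) (Ns ! i)) T" by simp
      then have "in_ker La Sg (Eqn \<Gamma> (\<Delta> ! i) (Ms ! i) (Ns ! i)) F"
        using Ms(1,3) Ns(1) i by (intro ker) (simp_all add: list_all2_conv_all_nth)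
      then show "ar_map F (tc \<Gamma> [\<Delta> ! i] [Ms ! i]) = ar_map F (tc \<Gamma> [\<Delta> ! i] [Ns ! i])" by simp
    qed
  qed
  have ker_el: "(el_map F \<Gamma> x, el_map F \<Gamma> y) \<in> Po (tgt F) (ob_map F \<Gamma>)"
    if \<Gamma>: "\<Gamma> \<in> Ob (src T)" and x: "x \<in> El (src T) \<Gamma>" and y: "y \<in> El (src T) \<Gamma>"
      and le: "(el_map T \<Gamma> x, el_map T \<Gamma> y) \<in> Po (tgt T) (ob_map T \<Gamma>)" for \<Gamma> x y
  proof -
    obtain \<phi> where \<phi>: "fm \<Gamma> \<phi>" "x = fc \<Gamma> \<phi>" using x unfolding sT by (rule El_ClE)
    obtain \<psi> where \<psi>: "fm \<Gamma> \<psi>" "y = fc \<Gamma> \<psi>" using y unfolding sT by (rule El_ClE)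
    \<comment> \<open>An inequality between two classes is the kernel condition of a sequent with
      one hypothesis, since \<open>Tensors\<close> leaves a single formula unchanged.\<close>
    have t: "Tensors La [\<phi>] = \<phi>" by (simp add: Tensors_def)
    have "in_ker La Sg (Seq \<Gamma> [\<phi>] \<psi>) F"
      using \<Gamma> \<phi> \<psi> le by (intro ker) (simp_all add: t sT Cl_sel(1))
    then show ?thesis by (simp add: t \<phi> \<psi>)
  qed
  \<comment> \<open>The codings place the image over \<open>'u\<close>, which makes its
    corestriction eligible as a model.\<close>
  interpret image_factorization La T ctx_code tag small F
    by unfold_locales ((rule ker_ar; assumption) | (rule ker_el; assumption) |
      (simp add: sT sF Cl_sel(1) ctx_code tag language; fail))+
  have inc: "in_FAL La L E"
    using in_FAL_subprop [OF language subprop_inclusion] ModD(3) [OF T]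
    by (simp add: inclusion.factor_sel)
  have M: "corestriction \<in> Mod La L Sg"
    using FA_morphism_corestriction inc by (simp add: Mod_def corestriction_sel(1,2) sT)
  \<comment> \<open>The rule for submodels wants a composite that is already in the class; it is
    \<open>T\<close> itself in factored form.\<close>
  have "comp_morphism inclusion.factor corestriction \<in> submodels La L Sg {T}"
    unfolding inclusion.factor_corestriction by (rule submodels.base) (rule singletonI)
  then have "corestriction \<in> submodels La L Sg {T}"
    by (rule submodels.submodel [OF _ M subprop_inclusion])
      (simp_all only: inclusion.factor_sel corestriction_sel(2) ModD(3) [OF T])
  then have "comp_morphism factor corestriction \<in> images La L (submodels La L Sg {T})"
    by (rule images.image [OF images.base FA_morphism_factor])
      (simp_all only: factor_sel corestriction_sel(2) ModD(3) [OF assms(2)])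
  then show ?thesis unfolding factor_corestriction .
qed

lemma submodels_mono: "X \<subseteq> Y \<Longrightarrow> submodels La L Sg X \<subseteq> submodels La L Sg Y"
proof
  fix F assume "X \<subseteq> Y" "F \<in> submodels La L Sg X"
  then show "F \<in> submodels La L Sg Y"
    by (induction rule: submodels.induct [OF \<open>F \<in> submodels La L Sg X\<close>])
      (auto intro: submodels.intros)
qed

lemma images_mono: "X \<subseteq> Y \<Longrightarrow> images La L X \<subseteq> images La L Y"
proof
  fix F assume "X \<subseteq> Y" "F \<in> images La L X"
  then show "F \<in> images La L Y"
    by (induction rule: images.induct [OF \<open>F \<in> images La L X\<close>])
      (auto intro: images.intros)
qed

end

theorem mainTheorem14:
  fixes small :: "'u set \<Rightarrow> bool"
    and tup :: "'u set \<Rightarrow> ('u \<Rightarrow> 'u) \<Rightarrow> 'u"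
    and La :: "'u language"
    and L :: "'u logic"
    and Sg :: "'u signature"
    and Y :: "'u model set"
  assumes "universe small tup"
    and "is_language small La"
    and "is_logic La L"
    and "small_signature small Sg"
    and "Y \<subseteq> Mod La L Sg"
  shows "Mod_of La L Sg (Th La Sg Y) = images La L (submodels La L Sg (products small tup La Sg Y))"
proof
  have Sg: "is_signature Sg" using assms(4) by (simp add: small_signature_def)
  interpret external_models small La Sg tup L
    using assms(1,2) by unfold_locales
  let ?T = "Th La Sg Y"
  have T: "?T \<subseteq> assertions La Sg" by (auto simp: Th_def)
  \<comment> \<open>The models of the theory of \<open>Y\<close> form a class containing
    \<open>Y\<close>, and the three closure lemmas keep everything generated from \<open>Y\<close>
    inside it.\<close>
  have "Y \<subseteq> Mod_of La L Sg ?T" using assms(5) by (auto simp: Mod_of_def Th_def)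
  then show "images La L (submodels La L Sg (products small tup La Sg Y)) \<subseteq> Mod_of La L Sg ?T"
    by (intro images_Mod_of submodels_Mod_of products_Mod_of Sg T)
  show "Mod_of La L Sg ?T \<subseteq> images La L (submodels La L Sg (products small tup La Sg Y))"
  proof
    fix F assume "F \<in> Mod_of La L Sg ?T"
    then have F: "F \<in> Mod La L Sg" and sat: "\<And>a. a \<in> ?T \<Longrightarrow> in_ker La Sg a F"
      by (auto simp: Mod_of_def)
    obtain ctx_code :: "'u ctx \<Rightarrow> 'u" and code :: "'u assertion \<Rightarrow> 'u"
      where ctx_code: "inj_on ctx_code {\<Gamma>. is_ctx Sg \<Gamma>}" and code: "inj_on code (assertions La Sg)"
        "small (code ` assertions La Sg)"
      using small_syntax [OF assms(1,2,4)] by blast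
    obtain tag :: "'u \<times> 'u \<times> 'u \<Rightarrow> 'u" where tag: "inj tag"
      using universe_triples [OF assms(1)] by blast
    let ?N = "assertions La Sg - ?T"
    have "\<exists>G\<in>Y. \<not> in_ker La Sg a G" if "a \<in> ?N" for a using that by (auto simp: Th_def)
    then obtain R where R: "\<And>a. a \<in> ?N \<Longrightarrow> R a \<in> Y" "\<And>a. a \<in> ?N \<Longrightarrow> \<not> in_ker La Sg a (R a)"
      by metis
    \<comment> \<open>Indices of a family must be elements of \<open>'u\<close>, hence codes replace
      the assertions. They form a small set although \<open>Y\<close> may be a proper class.\<close>
    let ?I = "code ` ?N"
    define K where "K i = R (inv_into ?N code i)" for i
    have I: "small ?I"
      by (rule universe_lepoll [OF assms(1) code(2) subset_imp_lepoll]) blast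
    have K: "K (code a) = R a" if "a \<in> ?N" for a
      unfolding K_def using inj_on_subset [OF code(1) Diff_subset] that by (simp only: inv_into_f_f)
    have KY: "K i \<in> Y" if "i \<in> ?I" for i
      using that R(1) K by auto
    have M: "K i \<in> Mod La L Sg" if "i \<in> ?I" for i
      using KY [OF that] assms(5) by blast
    \<comment> \<open>If \<open>Y\<close> is empty, its theory contains every assertion,
      \<open>?I\<close> is empty, and this is the empty product.\<close>
    let ?G = "tuple_morphism tup ?I (classifying La Sg) K"
    have G: "?G \<in> products small tup La Sg Y"
      using KY by (intro products.product I products.base)
    have G_Mod: "?G \<in> Mod La L Sg"
      by (rule tuple_Mod [OF I]) (rule M)
    have G_ker: "in_ker La Sg a ?G \<longleftrightarrow> (\<forall>i\<in>?I. in_ker La Sg a (K i))" if "is_assertion La Sg a" for a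
      by (rule in_ker_tuple [OF I _ Sg that]) (rule M)
    have "F \<in> images La L (submodels La L Sg {?G})"
    proof (rule image_of_submodel [OF G_Mod F ctx_code tag])
      fix a assume a: "is_assertion La Sg a" and "in_ker La Sg a ?G"
      then have k: "\<And>i. i \<in> ?I \<Longrightarrow> in_ker La Sg a (K i)" using G_ker by blast
      \<comment> \<open>An assertion outside the theory is refuted by its own factor
        \<open>K (code a)\<close>, hence by the product.\<close>
      have "a \<in> ?T"
      proof (rule ccontr)
        assume "a \<notin> ?T"
        then have "a \<in> ?N" using a by (simp add: assertions_def)
        then show False using k [of "code a"] R(2) K by auto
      qed
      then show "in_ker La Sg a F" by (rule sat)
    qed
    then show "F \<in> images La L (submodels La L Sg (products small tup La Sg Y))"
      using images_mono [OF submodels_mono] G by blast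
  qed
qed

end
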